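(* Let $A$ be a differential ring (commutative, with unit $1$, with $n$ commuting derivations $\partial_1,\dots,\partial_n$) and let $D=A[d_1,\dots,d_n]$ be the ring of differential operators over $A$. (a) When $M$ and $N$ are left $D$-modules, then $\mathrm{hom}_A(M,N)$ and $M\otimes_AN$ are left $D$-modules. In particular $R=\mathrm{hom}_A(M,A)$ is also a left $D$-module for the Spencer operator. (b) The structures of left $D$-modules existing therefore on $M\otimes_AN$ and $\mathrm{hom}_A(N,L)$ are coherent with the adjoint isomorphism: for all left $D$-modules $L,M,N$ there is an isomorphism $$\varphi:\mathrm{hom}_D(M\otimes_AN,L)\stackrel{\simeq}{\longrightarrow}\mathrm{hom}_D(M,\mathrm{hom}_A(N,L)),\qquad (\varphi(f)(m))(n)=f(m\otimes n).$$ (c) If $M$ and $N$ are right $D$-modules, then $\mathrm{hom}_A(M,N)$ is a left $D$-module. If $M$ is a left $D$-module and $N$ is a right $D$-module, then $M\otimes_AN$ is a right $D$-module. (d) For any left $D$-module $M$, one has $R=\mathrm{hom}_A(M,A)\simeq\mathrm{hom}_D(M,D^* )$, where $D^*=\mathrm{hom}_A(D,A)$.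
   Context: $D=A[d_1,\dots,d_n]$ is the ring of operators $P=a^\mu d_\mu$ (finite sums, $\mu$ a multi-index, $a^\mu\in A$) with $d_id_j=d_jd_i$ and $d_ia=ad_i+\partial_ia$ for $a\in A$. It is generated by $A$ and $T=\{\xi=\xi^id_i\mid \xi^i\in A\}$, with $[\xi,\eta]=\xi\eta-\eta\xi\in T$. $A$ is a left $D$-module with $d_i(a)=\partial_ia$. The actions of $a\in A$ and $\xi\in T$ meant in the statement are: - $M,N$ left, $f\in\mathrm{hom}_A(M,N)$: $(af)(m)=af(m)=f(am)$ and $(\xi f)(m)=\xi f(m)-f(\xi m)$. - $M,N$ left, on $M\otimes_AN$: $a(m\otimes n)=am\otimes n=m\otimes an$ and $\xi(m\otimes n)=\xi m\otimes n+m\otimes\xi n$. - $M,N$ right, $f\in\mathrm{hom}_A(M,N)$: $(\xi f)(m)=f(m\xi)-f(m)\xi$. - $M$ left, $N$ right, on $M\otimes_AN$: $(m\otimes n)\xi=m\otimes n\xi-\xi m\otimes n$. The Spencer operator on $R=\mathrm{hom}_A(M,A)$ is $(d_if)(m)=\partial_i(f(m))-f(d_im)$; when $M$ is generated by $y^1,\dots,y^m$ with $y^k_\mu=d_\mu y^k$ and $f^k_\mu=f(y^k_\mu)$, this reads $(d_if)^k_\mu=\partial_if^k_\mu-f^k_{\mu+1_i}$, where $\mu+1_i$ is $\mu$ with $\mu_i$ increased by $1$. $D^*=\mathrm{hom}_A(D,A)$ is taken with the left $D$-structure given by the first item for the left $D$-modules $D$ and $A$, i.e. $(af)_\mu=af_\mu$,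 $(d_if)_\mu=\partial_if_\mu-f_{\mu+1_i}$ with $f_\mu=f(d_\mu)$. *)

theory Defs
  imports "HOL-Algebra.Module" "HOL-Algebra.Free_Abelian_Groups"
begin

section \<open>Modules over a not necessarily commutative ring\<close>

locale left_module = R?: ring R + M?: abelian_group M
  for R :: "('r, 'e) ring_scheme" (structure) and M :: "('r, 'm, 'f) module_scheme" (structure) +
  assumes smult_closed:
      "\<lbrakk>a \<in> carrier R; x \<in> carrier M\<rbrakk> \<Longrightarrow> a \<odot>\<^bsub>M\<^esub> x \<in> carrier M"
    and smult_l_distr:
      "\<lbrakk>a \<in> carrier R; b \<in> carrier R; x \<in> carrier M\<rbrakk> \<Longrightarrow>
        (a \<oplus> b) \<odot>\<^bsub>M\<^esub> x = a \<odot>\<^bsub>M\<^esub> x \<oplus>\<^bsub>M\<^esub> b \<odot>\<^bsub>M\<^esub> x"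
    and smult_r_distr:
      "\<lbrakk>a \<in> carrier R; x \<in> carrier M; y \<in> carrier M\<rbrakk> \<Longrightarrow>
        a \<odot>\<^bsub>M\<^esub> (x \<oplus>\<^bsub>M\<^esub> y) = a \<odot>\<^bsub>M\<^esub> x \<oplus>\<^bsub>M\<^esub> a \<odot>\<^bsub>M\<^esub> y"
    and smult_assoc1:
      "\<lbrakk>a \<in> carrier R; b \<in> carrier R; x \<in> carrier M\<rbrakk> \<Longrightarrow>
        (a \<otimes> b) \<odot>\<^bsub>M\<^esub> x = a \<odot>\<^bsub>M\<^esub> (b \<odot>\<^bsub>M\<^esub> x)"
    and smult_one: "x \<in> carrier M \<Longrightarrow> \<one> \<odot>\<^bsub>M\<^esub> x = x"

record ('a, 'b) rmodule = "'b ring" +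
  rsmult :: "'b \<Rightarrow> 'a \<Rightarrow> 'b" (infixl \<open>\<boxdot>\<index>\<close> 70)

locale right_module = R?: ring R + M?: abelian_group M
  for R :: "('r, 'e) ring_scheme" (structure) and M :: "('r, 'm, 'f) rmodule_scheme" (structure) +
  assumes rsmult_closed:
      "\<lbrakk>a \<in> carrier R; x \<in> carrier M\<rbrakk> \<Longrightarrow> x \<boxdot>\<^bsub>M\<^esub> a \<in> carrier M"
    and rsmult_r_distr:
      "\<lbrakk>a \<in> carrier R; b \<in> carrier R; x \<in> carrier M\<rbrakk> \<Longrightarrow>
        x \<boxdot>\<^bsub>M\<^esub> (a \<oplus> b) = x \<boxdot>\<^bsub>M\<^esub> a \<oplus>\<^bsub>M\<^esub> x \<boxdot>\<^bsub>M\<^esub> b"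
    and rsmult_l_distr:
      "\<lbrakk>a \<in> carrier R; x \<in> carrier M; y \<in> carrier M\<rbrakk> \<Longrightarrow>
        (x \<oplus>\<^bsub>M\<^esub> y) \<boxdot>\<^bsub>M\<^esub> a = x \<boxdot>\<^bsub>M\<^esub> a \<oplus>\<^bsub>M\<^esub> y \<boxdot>\<^bsub>M\<^esub> a"
    and rsmult_assoc1:
      "\<lbrakk>a \<in> carrier R; b \<in> carrier R; x \<in> carrier M\<rbrakk> \<Longrightarrow>
        x \<boxdot>\<^bsub>M\<^esub> (a \<otimes> b) = (x \<boxdot>\<^bsub>M\<^esub> a) \<boxdot>\<^bsub>M\<^esub> b"
    and rsmult_one: "x \<in> carrier M \<Longrightarrow> x \<boxdot>\<^bsub>M\<^esub> \<one> = x"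

definition with_smult :: "('m, 'e) ring_scheme \<Rightarrow> ('r \<Rightarrow> 'm \<Rightarrow> 'm) \<Rightarrow> ('r, 'm) module"
  where "with_smult M s = \<lparr>carrier = carrier M, mult = mult M, one = one M,
    ring.zero = ring.zero M, add = add M, smult = s\<rparr>"

definition with_rsmult :: "('m, 'e) ring_scheme \<Rightarrow> ('m \<Rightarrow> 'r \<Rightarrow> 'm) \<Rightarrow> ('r, 'm) rmodule"
  where "with_rsmult M s = \<lparr>carrier = carrier M, mult = mult M, one = one M,
    ring.zero = ring.zero M, add = add M, rsmult = s\<rparr>"

text \<open>Homomorphisms are extensional functions, so that equality of homomorphisms is HOL equality.\<close>

definition mod_hom ::
    "('r, 'e) ring_scheme \<Rightarrow> ('r, 'm, 'f) module_scheme \<Rightarrow> ('r, 'n, 'g) module_scheme \<Rightarrow> ('m \<Rightarrow> 'n) set"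
  where "mod_hom R M N = {f \<in> carrier M \<rightarrow>\<^sub>E carrier N.
      (\<forall>x\<in>carrier M. \<forall>y\<in>carrier M. f (x \<oplus>\<^bsub>M\<^esub> y) = f x \<oplus>\<^bsub>N\<^esub> f y) \<and>
      (\<forall>a\<in>carrier R. \<forall>x\<in>carrier M. f (a \<odot>\<^bsub>M\<^esub> x) = a \<odot>\<^bsub>N\<^esub> f x)}"

text \<open>
  Only the additive structure of the following two records is meaningful; the multiplicative fields
  inherited from the record type of rings are left unspecified, here and in all modules below.
\<close>

definition hom_group ::
    "('r, 'e) ring_scheme \<Rightarrow> ('r, 'm, 'f) module_scheme \<Rightarrow> ('r, 'n, 'g) module_scheme \<Rightarrow> ('m \<Rightarrow> 'n) ring"
  where "hom_group R M N =
    \<lparr>carrier = mod_hom R M N, mult = undefined, one = undefined,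
     ring.zero = (\<lambda>x\<in>carrier M. \<zero>\<^bsub>N\<^esub>), add = (\<lambda>f g. \<lambda>x\<in>carrier M. f x \<oplus>\<^bsub>N\<^esub> g x)\<rparr>"

text \<open>
  The tensor product over a commutative ring: the free abelian group on pairs modulo the subgroup
  generated by the bilinearity relations; its elements are cosets.
\<close>

definition tensor_relators ::
    "('r, 'e) ring_scheme \<Rightarrow> ('r, 'm, 'f) module_scheme \<Rightarrow> ('r, 'n, 'g) module_scheme \<Rightarrow> ('m \<times> 'n \<Rightarrow>\<^sub>0 int) set"
  where "tensor_relators R M N =
      {frag_of (x \<oplus>\<^bsub>M\<^esub> x', y) - frag_of (x, y) - frag_of (x', y) | x x' y.
         x \<in> carrier M \<and> x' \<in> carrier M \<and> y \<in> carrier N}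
    \<union> {frag_of (x, y \<oplus>\<^bsub>N\<^esub> y') - frag_of (x, y) - frag_of (x, y') | x y y'.
         x \<in> carrier M \<and> y \<in> carrier N \<and> y' \<in> carrier N}
    \<union> {frag_of (a \<odot>\<^bsub>M\<^esub> x, y) - frag_of (x, a \<odot>\<^bsub>N\<^esub> y) | a x y.
         a \<in> carrier R \<and> x \<in> carrier M \<and> y \<in> carrier N}"

definition tensor_kernel ::
    "('r, 'e) ring_scheme \<Rightarrow> ('r, 'm, 'f) module_scheme \<Rightarrow> ('r, 'n, 'g) module_scheme \<Rightarrow> ('m \<times> 'n \<Rightarrow>\<^sub>0 int) set"
  where "tensor_kernel R M N =
    generate (free_Abelian_group (carrier M \<times> carrier N)) (tensor_relators R M N)"

definition tensor_group ::
    "('r, 'e) ring_scheme \<Rightarrow> ('r, 'm, 'f) module_scheme \<Rightarrow> ('r, 'n, 'g) module_scheme \<Rightarrow> ('m \<times> 'n \<Rightarrow>\<^sub>0 int) set ring"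
  where "tensor_group R M N =
    (let Q = free_Abelian_group (carrier M \<times> carrier N) Mod tensor_kernel R M N
     in \<lparr>carrier = carrier Q, mult = undefined, one = undefined,
         ring.zero = one Q, add = mult Q\<rparr>)"

definition pure_tensor ::
    "('r, 'e) ring_scheme \<Rightarrow> ('r, 'm, 'f) module_scheme \<Rightarrow> ('r, 'n, 'g) module_scheme
      \<Rightarrow> 'm \<Rightarrow> 'n \<Rightarrow> ('m \<times> 'n \<Rightarrow>\<^sub>0 int) set"
  where "pure_tensor R M N x y =
    tensor_kernel R M N #>\<^bsub>free_Abelian_group (carrier M \<times> carrier N)\<^esub> frag_of (x, y)"

text \<open>
  The additive map on the tensor product sending the class of \<open>(x, y)\<close> to \<open>g x y\<close>, meaningful when
  \<open>g\<close> is balanced: the \<open>\<int>\<close>-linear extension of \<open>g\<close> is then constant on cosets.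
\<close>

definition tensor_lift ::
    "('g, 'e) ring_scheme \<Rightarrow> ('m \<Rightarrow> 'n \<Rightarrow> 'g) \<Rightarrow> ('m \<times> 'n \<Rightarrow>\<^sub>0 int) set \<Rightarrow> 'g"
  where "tensor_lift G g X = the_elem
    ((\<lambda>c. \<Oplus>\<^bsub>G\<^esub>p\<in>Poly_Mapping.keys c. [Poly_Mapping.lookup c p] \<cdot>\<^bsub>G\<^esub> g (fst p) (snd p)) ` X)"

definition tensor_module ::
    "('r, 'e) ring_scheme \<Rightarrow> ('r, 'm, 'f) module_scheme \<Rightarrow> ('r, 'n, 'g) module_scheme
      \<Rightarrow> ('r, ('m \<times> 'n \<Rightarrow>\<^sub>0 int) set) module"
  where "tensor_module R M N = with_smult (tensor_group R M N)
    (\<lambda>a. tensor_lift (tensor_group R M N) (\<lambda>x y. pure_tensor R M N (a \<odot>\<^bsub>M\<^esub> x) y))"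


section \<open>Differential rings and their rings of differential operators\<close>

text \<open>The \<open>n\<close> derivations are numbered \<open>0, \<dots>, n - 1\<close>, where \<open>n\<close> is the field \<open>nder\<close>.\<close>

record 'a diff_ring = "'a ring" +
  der :: "nat \<Rightarrow> 'a \<Rightarrow> 'a" (\<open>\<partial>\<index>\<close>)
  nder :: nat

locale differential_ring = cring A for A :: "'a diff_ring" (structure) +
  assumes der_closed: "\<lbrakk>i < nder A; a \<in> carrier A\<rbrakk> \<Longrightarrow> \<partial> i a \<in> carrier A"
    and der_add: "\<lbrakk>i < nder A; a \<in> carrier A; b \<in> carrier A\<rbrakk> \<Longrightarrow> \<partial> i (a \<oplus> b) = \<partial> i a \<oplus> \<partial> i b"
    and der_mult: "\<lbrakk>i < nder A; a \<in> carrier A; b \<in> carrier A\<rbrakk> \<Longrightarrow>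
      \<partial> i (a \<otimes> b) = \<partial> i a \<otimes> b \<oplus> a \<otimes> \<partial> i b"
    and der_comm: "\<lbrakk>i < nder A; j < nder A; a \<in> carrier A\<rbrakk> \<Longrightarrow> \<partial> i (\<partial> j a) = \<partial> j (\<partial> i a)"

text \<open>
  An operator \<open>P = \<Sum> a\<^sup>\<mu> d\<^sub>\<mu>\<close> is the family of its coefficients, a finitely supported function of the
  multi-index \<open>\<mu>\<close>; a multi-index is a function vanishing at all \<open>i \<ge> n\<close>.
\<close>

type_synonym 'a diff_op = "(nat \<Rightarrow> nat) \<Rightarrow> 'a"

definition op_supp :: "'a diff_ring \<Rightarrow> 'a diff_op \<Rightarrow> (nat \<Rightarrow> nat) set"
  where "op_supp A P = {\<mu>. P \<mu> \<noteq> \<zero>\<^bsub>A\<^esub>}"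

text \<open>The composite \<open>(\<delta> 0)^\<mu>\<^sub>0 \<circ> \<dots> \<circ> (\<delta> (n - 1))^\<mu>\<^sub>n\<^sub>-\<^sub>1\<close>.\<close>

definition iter_ops :: "nat \<Rightarrow> (nat \<Rightarrow> 'x \<Rightarrow> 'x) \<Rightarrow> (nat \<Rightarrow> nat) \<Rightarrow> 'x \<Rightarrow> 'x"
  where "iter_ops n \<delta> \<mu> = foldr (\<lambda>i h. (\<delta> i ^^ \<mu> i) \<circ> h) [0..<n] id"

text \<open>
  The \<open>A\<close>-module \<open>M\<close> with \<open>\<Sum> a\<^sup>\<mu> d\<^sub>\<mu>\<close> acting from the left as \<open>\<Sum> a\<^sup>\<mu> \<delta>\<^sup>\<mu>\<close>, respectively from the
  right as \<open>x \<mapsto> \<Sum> \<delta>\<^sup>\<mu> (a\<^sup>\<mu> x)\<close>; this is the only possible module structure over the ring of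
  operators in which \<open>a\<close> and \<open>d\<^sub>i\<close> act as the scalar \<open>a\<close> and as \<open>\<delta> i\<close>.
\<close>

definition op_smult :: "'a diff_ring \<Rightarrow> ('a, 'x) module \<Rightarrow> (nat \<Rightarrow> 'x \<Rightarrow> 'x) \<Rightarrow> 'a diff_op \<Rightarrow> 'x \<Rightarrow> 'x"
  where "op_smult A M \<delta> P x = (\<Oplus>\<^bsub>M\<^esub>\<mu>\<in>op_supp A P. P \<mu> \<odot>\<^bsub>M\<^esub> iter_ops (nder A) \<delta> \<mu> x)"

definition left_op_module ::
    "'a diff_ring \<Rightarrow> ('a, 'x) module \<Rightarrow> (nat \<Rightarrow> 'x \<Rightarrow> 'x) \<Rightarrow> ('a diff_op, 'x) module"
  where "left_op_module A M \<delta> = with_smult M (op_smult A M \<delta>)"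

definition right_op_module ::
    "'a diff_ring \<Rightarrow> ('a, 'x) module \<Rightarrow> (nat \<Rightarrow> 'x \<Rightarrow> 'x) \<Rightarrow> ('a diff_op, 'x) rmodule"
  where "right_op_module A M \<delta> = with_rsmult M
    (\<lambda>x P. \<Oplus>\<^bsub>M\<^esub>\<mu>\<in>op_supp A P. iter_ops (nder A) \<delta> \<mu> (P \<mu> \<odot>\<^bsub>M\<^esub> x))"

definition op_free_module :: "'a diff_ring \<Rightarrow> ('a, 'a diff_op) module"
  where "op_free_module A =
    \<lparr>carrier = {P. finite (op_supp A P) \<and> (\<forall>\<mu>. P \<mu> \<in> carrier A) \<and>
                   (\<forall>\<mu>\<in>op_supp A P. \<forall>i\<ge>nder A. \<mu> i = 0)},
     mult = undefined, one = undefined,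
     ring.zero = (\<lambda>\<mu>. \<zero>\<^bsub>A\<^esub>), add = (\<lambda>P Q \<mu>. P \<mu> \<oplus>\<^bsub>A\<^esub> Q \<mu>),
     smult = (\<lambda>a P \<mu>. a \<otimes>\<^bsub>A\<^esub> P \<mu>)\<rparr>"

text \<open>Left multiplication by \<open>d\<^sub>i\<close>, as prescribed by \<open>d\<^sub>i (a d\<^sub>\<mu>) = (\<partial>\<^sub>i a) d\<^sub>\<mu> + a d\<^bsub>\<mu> + 1\<^sub>i\<^esub>\<close>.\<close>

definition op_lmult :: "'a diff_ring \<Rightarrow> nat \<Rightarrow> 'a diff_op \<Rightarrow> 'a diff_op"
  where "op_lmult A i P = (\<lambda>\<mu>. \<partial>\<^bsub>A\<^esub> i (P \<mu>) \<oplus>\<^bsub>A\<^esub> (if \<mu> i = 0 then \<zero>\<^bsub>A\<^esub> else P (\<mu>(i := \<mu> i - 1))))"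

definition op_monom :: "'a diff_ring \<Rightarrow> 'a \<Rightarrow> (nat \<Rightarrow> nat) \<Rightarrow> 'a diff_op"
  where "op_monom A a \<mu> = (\<lambda>\<nu>. if \<nu> = \<mu> then a else \<zero>\<^bsub>A\<^esub>)"

definition op_const :: "'a diff_ring \<Rightarrow> 'a \<Rightarrow> 'a diff_op"
  where "op_const A a = op_monom A a (\<lambda>_. 0)"

definition op_d :: "'a diff_ring \<Rightarrow> nat \<Rightarrow> 'a diff_op"
  where "op_d A i = op_monom A \<one>\<^bsub>A\<^esub> ((\<lambda>_. 0)(i := 1))"

definition diff_ops :: "'a diff_ring \<Rightarrow> 'a diff_op ring"
  where "diff_ops A =
    \<lparr>carrier = carrier (op_free_module A),
     mult = op_smult A (op_free_module A) (op_lmult A), one = op_const A \<one>\<^bsub>A\<^esub>,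
     ring.zero = ring.zero (op_free_module A), add = add (op_free_module A)\<rparr>"

text \<open>The first order operators \<open>\<xi> = \<xi>\<^sup>i d\<^sub>i\<close>.\<close>

definition op_T :: "'a diff_ring \<Rightarrow> 'a diff_op set"
  where "op_T A = {\<Oplus>\<^bsub>diff_ops A\<^esub>i\<in>{..<nder A}. op_const A (\<xi> i) \<otimes>\<^bsub>diff_ops A\<^esub> op_d A i | \<xi>.
    \<xi> \<in> {..<nder A} \<rightarrow> carrier A}"


section \<open>Modules over the ring of differential operators\<close>

definition left_scalars :: "'a diff_ring \<Rightarrow> ('a diff_op, 'm) module \<Rightarrow> ('a, 'm) module"
  where "left_scalars A M = with_smult M (\<lambda>a x. op_const A a \<odot>\<^bsub>M\<^esub> x)"

definition right_scalars :: "'a diff_ring \<Rightarrow> ('a diff_op, 'm) rmodule \<Rightarrow> ('a, 'm) module"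
  where "right_scalars A M = with_smult M (\<lambda>a x. x \<boxdot>\<^bsub>M\<^esub> op_const A a)"

definition base_module :: "'a diff_ring \<Rightarrow> ('a diff_op, 'a) module"
  where "base_module A = left_op_module A (with_smult A (mult A)) (der A)"

definition regular_module :: "'a diff_ring \<Rightarrow> ('a diff_op, 'a diff_op) module"
  where "regular_module A = with_smult (diff_ops A) (mult (diff_ops A))"

definition hom_module :: "'a diff_ring \<Rightarrow> ('a, 'm) module \<Rightarrow> ('a, 'n) module \<Rightarrow> ('a, 'm \<Rightarrow> 'n) module"
  where "hom_module A M N = with_smult (hom_group A M N) (\<lambda>a f. \<lambda>x\<in>carrier M. a \<odot>\<^bsub>N\<^esub> f x)"

text \<open>
  The suffixes \<open>ll\<close>, \<open>rr\<close>, \<open>lr\<close> give the sides on which the operators act on the two arguments. The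
  result of \<open>tensor_lr\<close> is a right module, the other constructions give left modules.
\<close>

definition hom_ll ::
    "'a diff_ring \<Rightarrow> ('a diff_op, 'm) module \<Rightarrow> ('a diff_op, 'n) module \<Rightarrow> ('a diff_op, 'm \<Rightarrow> 'n) module"
  where "hom_ll A M N = left_op_module A (hom_module A (left_scalars A M) (left_scalars A N))
    (\<lambda>i f. \<lambda>x\<in>carrier M. op_d A i \<odot>\<^bsub>N\<^esub> f x \<ominus>\<^bsub>N\<^esub> f (op_d A i \<odot>\<^bsub>M\<^esub> x))"

definition hom_rr ::
    "'a diff_ring \<Rightarrow> ('a diff_op, 'm) rmodule \<Rightarrow> ('a diff_op, 'n) rmodule \<Rightarrow> ('a diff_op, 'm \<Rightarrow> 'n) module"
  where "hom_rr A M N = left_op_module A (hom_module A (right_scalars A M) (right_scalars A N))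
    (\<lambda>i f. \<lambda>x\<in>carrier M. f (x \<boxdot>\<^bsub>M\<^esub> op_d A i) \<ominus>\<^bsub>N\<^esub> f x \<boxdot>\<^bsub>N\<^esub> op_d A i)"

abbreviation tens_ll ::
    "'a diff_ring \<Rightarrow> ('a diff_op, 'm) module \<Rightarrow> ('a diff_op, 'n) module
      \<Rightarrow> 'm \<Rightarrow> 'n \<Rightarrow> ('m \<times> 'n \<Rightarrow>\<^sub>0 int) set"
  where "tens_ll A M N \<equiv> pure_tensor A (left_scalars A M) (left_scalars A N)"

abbreviation tens_lr ::
    "'a diff_ring \<Rightarrow> ('a diff_op, 'm) module \<Rightarrow> ('a diff_op, 'n) rmodule
      \<Rightarrow> 'm \<Rightarrow> 'n \<Rightarrow> ('m \<times> 'n \<Rightarrow>\<^sub>0 int) set"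
  where "tens_lr A M N \<equiv> pure_tensor A (left_scalars A M) (right_scalars A N)"

definition tensor_ll ::
    "'a diff_ring \<Rightarrow> ('a diff_op, 'm) module \<Rightarrow> ('a diff_op, 'n) module
      \<Rightarrow> ('a diff_op, ('m \<times> 'n \<Rightarrow>\<^sub>0 int) set) module"
  where "tensor_ll A M N =
    (let T = tensor_module A (left_scalars A M) (left_scalars A N)
     in left_op_module A T (\<lambda>i. tensor_lift T
          (\<lambda>x y. tens_ll A M N (op_d A i \<odot>\<^bsub>M\<^esub> x) y \<oplus>\<^bsub>T\<^esub> tens_ll A M N x (op_d A i \<odot>\<^bsub>N\<^esub> y))))"

definition tensor_lr ::
    "'a diff_ring \<Rightarrow> ('a diff_op, 'm) module \<Rightarrow> ('a diff_op, 'n) rmodule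
      \<Rightarrow> ('a diff_op, ('m \<times> 'n \<Rightarrow>\<^sub>0 int) set) rmodule"
  where "tensor_lr A M N =
    (let T = tensor_module A (left_scalars A M) (right_scalars A N)
     in right_op_module A T (\<lambda>i. tensor_lift T
          (\<lambda>x y. tens_lr A M N x (y \<boxdot>\<^bsub>N\<^esub> op_d A i) \<ominus>\<^bsub>T\<^esub> tens_lr A M N (op_d A i \<odot>\<^bsub>M\<^esub> x) y)))"

abbreviation dual_ops :: "'a diff_ring \<Rightarrow> ('a diff_op, 'a diff_op \<Rightarrow> 'a) module"
  where "dual_ops A \<equiv> hom_ll A (regular_module A) (base_module A)"


section \<open>The operators form a ring with the expected commutation rules\<close>

text \<open>An \<open>A\<close>-module with operators \<open>\<delta> i\<close> satisfying the commutation rules of the \<open>d\<^sub>i\<close>.\<close>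

locale derivation_module = differential_ring A + module A M
  for A :: "'a diff_ring" (structure) and M :: "('a, 'x) module" (structure) +
  fixes \<delta> :: "nat \<Rightarrow> 'x \<Rightarrow> 'x"
  assumes \<delta>_closed: "\<lbrakk>i < nder A; x \<in> carrier M\<rbrakk> \<Longrightarrow> \<delta> i x \<in> carrier M"
    and \<delta>_add: "\<lbrakk>i < nder A; x \<in> carrier M; y \<in> carrier M\<rbrakk> \<Longrightarrow>
      \<delta> i (x \<oplus>\<^bsub>M\<^esub> y) = \<delta> i x \<oplus>\<^bsub>M\<^esub> \<delta> i y"
    and \<delta>_smult: "\<lbrakk>i < nder A; a \<in> carrier A; x \<in> carrier M\<rbrakk> \<Longrightarrow>
      \<delta> i (a \<odot>\<^bsub>M\<^esub> x) = \<partial> i a \<odot>\<^bsub>M\<^esub> x \<oplus>\<^bsub>M\<^esub> a \<odot>\<^bsub>M\<^esub> \<delta> i x"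
    and \<delta>_comm: "\<lbrakk>i < nder A; j < nder A; x \<in> carrier M\<rbrakk> \<Longrightarrow> \<delta> i (\<delta> j x) = \<delta> j (\<delta> i x)"

context abelian_group
begin

lemma additive_zero:
  assumes "abelian_group H" "h \<in> carrier G \<rightarrow> carrier H"
    and "\<And>x y. \<lbrakk>x \<in> carrier G; y \<in> carrier G\<rbrakk> \<Longrightarrow> h (x \<oplus> y) = h x \<oplus>\<^bsub>H\<^esub> h y"
  shows "h \<zero> = \<zero>\<^bsub>H\<^esub>"
proof -
  interpret H: abelian_group H by fact
  have "h \<zero> \<in> carrier H" "h \<zero> \<oplus>\<^bsub>H\<^esub> h \<zero> = h \<zero>"
    using assms(2) assms(3)[of \<zero> \<zero>] by auto
  then show ?thesis by (metis H.add.r_cancel_one')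
qed

lemma additive_finsum:
  assumes "abelian_group H" "h \<in> carrier G \<rightarrow> carrier H"
    and "\<And>x y. \<lbrakk>x \<in> carrier G; y \<in> carrier G\<rbrakk> \<Longrightarrow> h (x \<oplus> y) = h x \<oplus>\<^bsub>H\<^esub> h y"
    and "finite S" "f \<in> S \<rightarrow> carrier G"
  shows "h (finsum G f S) = finsum H (h \<circ> f) S"
proof -
  interpret H: abelian_group H by fact
  have h: "h x \<in> carrier H" if "x \<in> carrier G" for x using assms(2) that by auto
  show ?thesis
    using assms(4,5)
  proof (induction S rule: finite_induct)
    case empty then show ?case using additive_zero[OF assms(1-3)] by simp
  next
    case (insert s S)
    then show ?case
      by (subst finsum_insert, simp, simp, simp, simp)
         (subst H.finsum_insert, auto simp: assms(3) Pi_def h finsum_closed comp_def)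
  qed
qed

end

context differential_ring
begin

lemma der_zero: "i < nder A \<Longrightarrow> \<partial> i \<zero> = \<zero>"
  by (rule additive_zero[OF is_abelian_group]) (auto simp: der_closed der_add)

lemma der_one: assumes "i < nder A" shows "\<partial> i \<one> = \<zero>"
proof -
  have "\<partial> i \<one> \<in> carrier A" "\<partial> i \<one> \<oplus> \<partial> i \<one> = \<partial> i \<one>"
    using der_mult[OF assms, of \<one> \<one>] der_closed[OF assms, of \<one>] by auto
  then show ?thesis by (metis add.r_cancel_one')
qed

end

lemma op_free_moduleD:
  assumes "P \<in> carrier (op_free_module A)"
  shows "finite (op_supp A P)" "P \<mu> \<in> carrier A" "\<mu> \<in> op_supp A P \<Longrightarrow> i \<ge> nder A \<Longrightarrow> \<mu> i = 0"
  using assms by (auto simp: op_free_module_def)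

context differential_ring
begin

abbreviation "F \<equiv> op_free_module A"

lemma F_simps:
  "\<zero>\<^bsub>F\<^esub> = (\<lambda>\<mu>. \<zero>)" "P \<oplus>\<^bsub>F\<^esub> Q = (\<lambda>\<mu>. P \<mu> \<oplus> Q \<mu>)" "a \<odot>\<^bsub>F\<^esub> P = (\<lambda>\<mu>. a \<otimes> P \<mu>)"
  by (simp_all add: op_free_module_def)

lemma F_memI:
  assumes "finite S" "op_supp A P \<subseteq> S" "\<And>\<mu>. P \<mu> \<in> carrier A"
    "\<And>\<mu> i. \<mu> \<in> op_supp A P \<Longrightarrow> i \<ge> nder A \<Longrightarrow> \<mu> i = 0"
  shows "P \<in> carrier F"
  using assms finite_subset by (auto simp: op_free_module_def)

lemma module_F: "module A F"
proof (rule moduleI)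
  show "cring A" by (rule is_cring)
  have add: "P \<oplus>\<^bsub>F\<^esub> Q \<in> carrier F" if "P \<in> carrier F" "Q \<in> carrier F" for P Q
  proof (rule F_memI[where S = "op_supp A P \<union> op_supp A Q"])
    show sub: "op_supp A (P \<oplus>\<^bsub>F\<^esub> Q) \<subseteq> op_supp A P \<union> op_supp A Q"
      by (auto simp: op_supp_def F_simps)
    fix \<mu> i assume "\<mu> \<in> op_supp A (P \<oplus>\<^bsub>F\<^esub> Q)" "nder A \<le> i"
    then show "\<mu> i = 0" using sub that by (auto dest: op_free_moduleD)
  qed (use that in \<open>auto simp: F_simps dest: op_free_moduleD\<close>)
  have neg: "(\<lambda>\<mu>. \<ominus> P \<mu>) \<in> carrier F" if "P \<in> carrier F" for P
  proof (rule F_memI[where S = "op_supp A P"])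
    show sub: "op_supp A (\<lambda>\<mu>. \<ominus> P \<mu>) \<subseteq> op_supp A P" by (auto simp: op_supp_def)
    fix \<mu> i assume "\<mu> \<in> op_supp A (\<lambda>\<mu>. \<ominus> P \<mu>)" "nder A \<le> i"
    then show "\<mu> i = 0" using sub that by (auto dest: op_free_moduleD)
  qed (use that in \<open>auto dest: op_free_moduleD\<close>)
  show "abelian_group F"
  proof (rule abelian_groupI)
    show "\<zero>\<^bsub>F\<^esub> \<in> carrier F" by (rule F_memI[where S = "{}"]) (auto simp: F_simps op_supp_def)
    show "\<exists>Q\<in>carrier F. Q \<oplus>\<^bsub>F\<^esub> P = \<zero>\<^bsub>F\<^esub>" if "P \<in> carrier F" for P
      using neg[OF that] that by (intro bexI[where x = "\<lambda>\<mu>. \<ominus> P \<mu>"])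
        (use neg[OF that] op_free_moduleD(2)[OF that] in \<open>auto simp: F_simps l_neg fun_eq_iff\<close>)
  qed (use add in \<open>auto simp: F_simps fun_eq_iff a_ac op_free_moduleD(2)\<close>)
  show "a \<odot>\<^bsub>F\<^esub> P \<in> carrier F" if "a \<in> carrier A" "P \<in> carrier F" for a P
  proof (rule F_memI[where S = "op_supp A P"])
    show sub: "op_supp A (a \<odot>\<^bsub>F\<^esub> P) \<subseteq> op_supp A P" using that by (auto simp: op_supp_def F_simps)
    fix \<mu> i assume "\<mu> \<in> op_supp A (a \<odot>\<^bsub>F\<^esub> P)" "nder A \<le> i"
    then show "\<mu> i = 0" using sub that by (auto dest: op_free_moduleD)
  qed (use that in \<open>auto simp: F_simps dest: op_free_moduleD\<close>)
qed (auto simp: F_simps fun_eq_iff l_distr r_distr m_assoc op_free_moduleD(2))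

lemma op_lmult_closed:
  assumes i: "i < nder A" and P: "P \<in> carrier F"
  shows "op_lmult A i P \<in> carrier F"
proof (rule F_memI[where S = "op_supp A P \<union> (\<lambda>\<mu>. \<mu>(i := Suc (\<mu> i))) ` op_supp A P"])
  note PD = op_free_moduleD[OF P]
  show "finite (op_supp A P \<union> (\<lambda>\<mu>. \<mu>(i := Suc (\<mu> i))) ` op_supp A P)" using PD by auto
  show sub: "op_supp A (op_lmult A i P) \<subseteq> op_supp A P \<union> (\<lambda>\<mu>. \<mu>(i := Suc (\<mu> i))) ` op_supp A P"
  proof
    fix \<mu> assume m: "\<mu> \<in> op_supp A (op_lmult A i P)"
    show "\<mu> \<in> op_supp A P \<union> (\<lambda>\<mu>. \<mu>(i := Suc (\<mu> i))) ` op_supp A P"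
    proof (cases "\<mu> \<in> op_supp A P")
      case False
      then have "\<mu> i \<noteq> 0" "\<mu>(i := \<mu> i - 1) \<in> op_supp A P"
        using m der_zero[OF i] PD(2) by (auto simp: op_supp_def op_lmult_def split: if_splits)
      then show ?thesis by (intro UnI2 image_eqI[where x = "\<mu>(i := \<mu> i - 1)"]) auto
    qed simp
  qed
  show "op_lmult A i P \<mu> \<in> carrier A" for \<mu> using PD(2) der_closed[OF i] by (auto simp: op_lmult_def)
  fix \<mu> j assume "\<mu> \<in> op_supp A (op_lmult A i P)" "j \<ge> nder A"
  then show "\<mu> j = 0" using sub PD(3)[of _ j] i by fastforce
qed

lemma derivation_module_F: "derivation_module A F (op_lmult A)"
proof -
  interpret F: module A F by (rule module_F)
  show ?thesis
  proof
    fix i P Q assume i: "i < nder A" and P: "P \<in> carrier F" and Q: "Q \<in> carrier F"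
    note D = op_free_moduleD(2)[OF P] op_free_moduleD(2)[OF Q]
    show "op_lmult A i (P \<oplus>\<^bsub>F\<^esub> Q) = op_lmult A i P \<oplus>\<^bsub>F\<^esub> op_lmult A i Q"
      using D der_closed[OF i] der_add[OF i] by (auto simp: op_lmult_def F_simps fun_eq_iff a_ac)
  next
    fix i a P assume i: "i < nder A" and a: "a \<in> carrier A" and P: "P \<in> carrier F"
    note D = op_free_moduleD(2)[OF P]
    show "op_lmult A i (a \<odot>\<^bsub>F\<^esub> P) = \<partial> i a \<odot>\<^bsub>F\<^esub> P \<oplus>\<^bsub>F\<^esub> a \<odot>\<^bsub>F\<^esub> op_lmult A i P"
      using a D der_closed[OF i] der_mult[OF i]
      by (auto simp: op_lmult_def F_simps fun_eq_iff a_ac r_distr)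
  next
    fix i j P assume i: "i < nder A" and j: "j < nder A" and P: "P \<in> carrier F"
    note D = op_free_moduleD(2)[OF P]
    have "op_lmult A i (op_lmult A j P) \<mu> = op_lmult A j (op_lmult A i P) \<mu>" for \<mu>
    proof (cases "i = j")
      case False
      then have "\<mu>(j := \<mu> j - Suc 0, i := \<mu> i - Suc 0) = \<mu>(i := \<mu> i - Suc 0, j := \<mu> j - Suc 0)"
        by (simp add: fun_upd_twist)
      with False show ?thesis
        using D der_closed[OF i] der_closed[OF j] der_add[OF i] der_add[OF j]
          der_zero[OF i] der_zero[OF j]
        by (auto simp: op_lmult_def der_comm[OF i j D] a_ac)
    qed simp
    then show "op_lmult A i (op_lmult A j P) = op_lmult A j (op_lmult A i P)" ..
  qed (rule op_lmult_closed)
qed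

end

context derivation_module
begin

abbreviation "\<delta>\<delta> \<equiv> iter_ops (nder A) \<delta>"
abbreviation "act \<equiv> op_smult A M \<delta>"

lemma funpow_closed: "i < nder A \<Longrightarrow> x \<in> carrier M \<Longrightarrow> (\<delta> i ^^ k) x \<in> carrier M"
  by (induction k) (auto simp: \<delta>_closed)

lemma funpow_add: "i < nder A \<Longrightarrow> x \<in> carrier M \<Longrightarrow> y \<in> carrier M \<Longrightarrow>
    (\<delta> i ^^ k) (x \<oplus>\<^bsub>M\<^esub> y) = (\<delta> i ^^ k) x \<oplus>\<^bsub>M\<^esub> (\<delta> i ^^ k) y"
  by (induction k) (auto simp: \<delta>_add funpow_closed)

lemma funpow_comm: "i < nder A \<Longrightarrow> j < nder A \<Longrightarrow> x \<in> carrier M \<Longrightarrow>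
    (\<delta> i ^^ k) (\<delta> j x) = \<delta> j ((\<delta> i ^^ k) x)"
  by (induction k) (auto simp: \<delta>_comm funpow_closed)

lemma iter_aux:
  fixes xs :: "nat list"
  defines "h \<equiv> \<lambda>\<mu>. foldr (\<lambda>i h. (\<delta> i ^^ \<mu> i) \<circ> h) xs id"
  assumes "set xs \<subseteq> {..<nder A}" "distinct xs" "x \<in> carrier M"
  shows "h \<mu> x \<in> carrier M"
    and "y \<in> carrier M \<Longrightarrow> h \<mu> (x \<oplus>\<^bsub>M\<^esub> y) = h \<mu> x \<oplus>\<^bsub>M\<^esub> h \<mu> y"
    and "i \<notin> set xs \<Longrightarrow> h (\<mu>(i := k)) x = h \<mu> x"
    and "i \<in> set xs \<Longrightarrow> h (\<mu>(i := Suc (\<mu> i))) x = \<delta> i (h \<mu> x)"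
proof -
  have 1: "set xs \<subseteq> {..<nder A} \<Longrightarrow> x \<in> carrier M \<Longrightarrow>
      foldr (\<lambda>i h. (\<delta> i ^^ \<mu> i) \<circ> h) xs id x \<in> carrier M" for xs x
    by (induction xs) (auto simp: funpow_closed)
  show "h \<mu> x \<in> carrier M" using 1 assms by (auto simp: h_def)
  show "h \<mu> (x \<oplus>\<^bsub>M\<^esub> y) = h \<mu> x \<oplus>\<^bsub>M\<^esub> h \<mu> y" if "y \<in> carrier M"
    using assms(2,4) that unfolding h_def by (induction xs) (auto simp: 1 funpow_add)
  have 3: "i \<notin> set xs \<Longrightarrow> foldr (\<lambda>j h. (\<delta> j ^^ (\<mu>(i := k)) j) \<circ> h) xs id x
      = foldr (\<lambda>i h. (\<delta> i ^^ \<mu> i) \<circ> h) xs id x" for xs k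
    by (induction xs) auto
  show "i \<notin> set xs \<Longrightarrow> h (\<mu>(i := k)) x = h \<mu> x" using 3 by (simp add: h_def)
  show "i \<in> set xs \<Longrightarrow> h (\<mu>(i := Suc (\<mu> i))) x = \<delta> i (h \<mu> x)"
    using assms(2,3) unfolding h_def
  proof (induction xs)
    case (Cons j xs)
    show ?case
    proof (cases "i = j")
      case True
      with Cons.prems have "i \<notin> set xs" by auto
      from 3[OF this, of "Suc (\<mu> i)"] True show ?thesis
        by (simp only: foldr_Cons comp_def fun_upd_same funpow.simps)
    next
      case False
      then have i: "i \<in> set xs" "i < nder A" using Cons.prems by auto
      have IH: "foldr (\<lambda>j h. (\<delta> j ^^ (\<mu>(i := Suc (\<mu> i))) j) \<circ> h) xs id x
          = \<delta> i (foldr (\<lambda>i h. (\<delta> i ^^ \<mu> i) \<circ> h) xs id x)"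
        by (rule Cons.IH) (use Cons.prems i in auto)
      have step: "foldr (\<lambda>j h. (\<delta> j ^^ \<nu> j) \<circ> h) (j # xs) id x
          = (\<delta> j ^^ \<nu> j) (foldr (\<lambda>j h. (\<delta> j ^^ \<nu> j) \<circ> h) xs id x)" for \<nu>
        by simp
      have "(\<mu>(i := Suc (\<mu> i))) j = \<mu> j" using False by simp
      then show ?thesis
        unfolding step IH using Cons.prems i 1[OF _ assms(4), of xs] funpow_comm[of j i] by simp
    qed
  qed simp
qed

lemma \<delta>\<delta>_closed: "x \<in> carrier M \<Longrightarrow> \<delta>\<delta> \<mu> x \<in> carrier M"
  and \<delta>\<delta>_add: "x \<in> carrier M \<Longrightarrow> y \<in> carrier M \<Longrightarrow> \<delta>\<delta> \<mu> (x \<oplus>\<^bsub>M\<^esub> y) = \<delta>\<delta> \<mu> x \<oplus>\<^bsub>M\<^esub> \<delta>\<delta> \<mu> y"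
  and \<delta>\<delta>_Suc: "i < nder A \<Longrightarrow> x \<in> carrier M \<Longrightarrow> \<delta>\<delta> (\<mu>(i := Suc (\<mu> i))) x = \<delta> i (\<delta>\<delta> \<mu> x)"
  unfolding iter_ops_def
  using iter_aux[of "[0..<nder A]" x] by (auto simp: atLeast0LessThan simp del: fun_upd_apply)

lemma \<delta>\<delta>_0: "\<delta>\<delta> (\<lambda>_. 0) x = x"
proof -
  have "foldr (\<lambda>i h. (\<delta> i ^^ 0) \<circ> h) xs id x = x" for xs :: "nat list" by (induction xs) auto
  then show ?thesis by (simp add: iter_ops_def)
qed

lemma act_superset:
  assumes "P \<in> carrier F" "x \<in> carrier M" "finite S" "op_supp A P \<subseteq> S"
  shows "act P x = (\<Oplus>\<^bsub>M\<^esub>\<mu>\<in>S. P \<mu> \<odot>\<^bsub>M\<^esub> \<delta>\<delta> \<mu> x)"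
  unfolding op_smult_def
  by (rule M.add.finprod_mono_neutral_cong_left)
    (use assms in \<open>auto simp: op_supp_def \<delta>\<delta>_closed intro!: smult_closed dest: op_free_moduleD(2)\<close>)

lemma act_closed: "P \<in> carrier F \<Longrightarrow> x \<in> carrier M \<Longrightarrow> act P x \<in> carrier M"
  unfolding op_smult_def
  by (auto intro!: M.finsum_closed smult_closed \<delta>\<delta>_closed dest: op_free_moduleD(2))

lemma act_add_left:
  assumes "P \<in> carrier F" "Q \<in> carrier F" "x \<in> carrier M"
  shows "act (P \<oplus>\<^bsub>F\<^esub> Q) x = act P x \<oplus>\<^bsub>M\<^esub> act Q x"
proof -
  interpret F: module A F by (rule module_F)
  let ?S = "op_supp A P \<union> op_supp A Q"
  have S: "finite ?S" "op_supp A (P \<oplus>\<^bsub>F\<^esub> Q) \<subseteq> ?S"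
    using assms by (auto simp: op_supp_def F_simps dest: op_free_moduleD(1))
  have "act (P \<oplus>\<^bsub>F\<^esub> Q) x = (\<Oplus>\<^bsub>M\<^esub>\<mu>\<in>?S. P \<mu> \<odot>\<^bsub>M\<^esub> \<delta>\<delta> \<mu> x \<oplus>\<^bsub>M\<^esub> Q \<mu> \<odot>\<^bsub>M\<^esub> \<delta>\<delta> \<mu> x)"
    by (subst act_superset[OF F.M.a_closed[OF assms(1,2)] assms(3) S])
      (use assms in \<open>auto simp: F_simps smult_l_distr \<delta>\<delta>_closed op_free_moduleD(2) cong: M.finsum_cong\<close>)
  also have "\<dots> = act P x \<oplus>\<^bsub>M\<^esub> act Q x"
    by (subst M.finsum_addf, (use assms in \<open>auto intro!: smult_closed \<delta>\<delta>_closed dest: op_free_moduleD(2)\<close>)[2])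
      (use assms S in \<open>simp add: act_superset[where S = ?S]\<close>)
  finally show ?thesis .
qed

lemma act_add_right:
  assumes "P \<in> carrier F" "x \<in> carrier M" "y \<in> carrier M"
  shows "act P (x \<oplus>\<^bsub>M\<^esub> y) = act P x \<oplus>\<^bsub>M\<^esub> act P y"
  unfolding op_smult_def
  by (subst M.finsum_addf[symmetric])
    (use assms in \<open>auto simp: \<delta>\<delta>_add smult_r_distr \<delta>\<delta>_closed op_free_moduleD(2)
      intro!: smult_closed M.finsum_cong'\<close>)

lemma act_smult:
  assumes "a \<in> carrier A" "P \<in> carrier F" "x \<in> carrier M"
  shows "act (a \<odot>\<^bsub>F\<^esub> P) x = a \<odot>\<^bsub>M\<^esub> act P x"
proof -
  interpret F: module A F by (rule module_F)
  have S: "finite (op_supp A P)" "op_supp A (a \<odot>\<^bsub>F\<^esub> P) \<subseteq> op_supp A P"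
    using assms by (auto simp: op_supp_def F_simps dest: op_free_moduleD(1))
  have "act (a \<odot>\<^bsub>F\<^esub> P) x = (\<Oplus>\<^bsub>M\<^esub>\<mu>\<in>op_supp A P. a \<odot>\<^bsub>M\<^esub> (P \<mu> \<odot>\<^bsub>M\<^esub> \<delta>\<delta> \<mu> x))"
    by (subst act_superset[OF F.smult_closed[OF assms(1,2)] assms(3) S])
      (use assms in \<open>auto simp: F_simps smult_assoc1 \<delta>\<delta>_closed op_free_moduleD(2) cong: M.finsum_cong\<close>)
  also have "\<dots> = a \<odot>\<^bsub>M\<^esub> act P x"
    unfolding op_smult_def
    by (rule finsum_smult_ldistr[symmetric])
      (use S assms in \<open>auto simp: \<delta>\<delta>_closed op_free_moduleD(2) intro!: smult_closed\<close>)
  finally show ?thesis .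
qed

lemma act_op_monom:
  assumes "a \<in> carrier A" "x \<in> carrier M"
  shows "act (op_monom A a \<mu>) x = a \<odot>\<^bsub>M\<^esub> \<delta>\<delta> \<mu> x"
proof (cases "a = \<zero>")
  case True
  then show ?thesis using assms \<delta>\<delta>_closed by (simp add: op_smult_def op_supp_def op_monom_def)
next
  case False
  then have "op_supp A (op_monom A a \<mu>) = {\<mu>}" by (auto simp: op_supp_def op_monom_def)
  then show ?thesis using assms \<delta>\<delta>_closed
    by (simp add: op_smult_def op_monom_def M.finsum_insert[of "{}"])
qed

lemma act_op_lmult:
  assumes i: "i < nder A" and P: "P \<in> carrier F" and x: "x \<in> carrier M"
  shows "act (op_lmult A i P) x = \<delta> i (act P x)"
proof -
  note PD = op_free_moduleD[OF P]
  let ?S = "op_supp A P" and ?s = "\<lambda>\<mu>. \<mu>(i := Suc (\<mu> i))"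
  define P1 where "P1 = (\<lambda>\<mu>. \<partial> i (P \<mu>))"
  define P2 where "P2 = (\<lambda>\<mu>. if \<mu> i = 0 then \<zero> else P (\<mu>(i := \<mu> i - 1)))"
  have S1: "op_supp A P1 \<subseteq> ?S" using der_zero[OF i] by (auto simp: op_supp_def P1_def)
  have S2: "op_supp A P2 \<subseteq> ?s ` ?S"
  proof
    fix \<mu> assume "\<mu> \<in> op_supp A P2"
    then have "\<mu> i \<noteq> 0" "\<mu>(i := \<mu> i - 1) \<in> ?S" by (auto simp: op_supp_def P2_def split: if_splits)
    then show "\<mu> \<in> ?s ` ?S" by (intro image_eqI[where x = "\<mu>(i := \<mu> i - 1)"]) auto
  qed
  have F1: "P1 \<in> carrier F"
    by (rule F_memI[OF PD(1) S1]) (use S1 PD der_closed[OF i] in \<open>auto simp: P1_def\<close>)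
  have F2: "P2 \<in> carrier F"
  proof (rule F_memI[OF _ S2])
    fix \<mu> j assume "\<mu> \<in> op_supp A P2" "j \<ge> nder A"
    then show "\<mu> j = 0" using S2 PD(3)[of _ j] i by fastforce
  qed (use PD in \<open>auto simp: P2_def\<close>)
  have inj: "inj_on ?s ?S"
  proof (rule inj_on_inverseI[where g = "\<lambda>\<mu>. \<mu>(i := \<mu> i - 1)"])
  qed simp
  have "op_lmult A i P = P1 \<oplus>\<^bsub>F\<^esub> P2" by (simp add: op_lmult_def P1_def P2_def F_simps)
  then have "act (op_lmult A i P) x = act P1 x \<oplus>\<^bsub>M\<^esub> act P2 x" using act_add_left F1 F2 x by simp
  also have "act P1 x = (\<Oplus>\<^bsub>M\<^esub>\<mu>\<in>?S. \<partial> i (P \<mu>) \<odot>\<^bsub>M\<^esub> \<delta>\<delta> \<mu> x)"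
    using act_superset[OF F1 x PD(1) S1] by (simp add: P1_def)
  also have "act P2 x = (\<Oplus>\<^bsub>M\<^esub>\<mu>\<in>?s ` ?S. P2 \<mu> \<odot>\<^bsub>M\<^esub> \<delta>\<delta> \<mu> x)"
    by (rule act_superset[OF F2 x _ S2]) (use PD in simp)
  also have "\<dots> = (\<Oplus>\<^bsub>M\<^esub>\<mu>\<in>?S. P2 (?s \<mu>) \<odot>\<^bsub>M\<^esub> \<delta>\<delta> (?s \<mu>) x)"
    by (rule M.finsum_reindex[OF _ inj])
      (use F2 x in \<open>auto intro!: smult_closed \<delta>\<delta>_closed dest: op_free_moduleD(2)\<close>)
  also have "\<dots> = (\<Oplus>\<^bsub>M\<^esub>\<mu>\<in>?S. P \<mu> \<odot>\<^bsub>M\<^esub> \<delta> i (\<delta>\<delta> \<mu> x))"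
    by (rule M.finsum_cong')
      (use PD i x in \<open>auto simp: P2_def \<delta>\<delta>_Suc intro!: smult_closed \<delta>\<delta>_closed \<delta>_closed\<close>)
  also have "(\<Oplus>\<^bsub>M\<^esub>\<mu>\<in>?S. \<partial> i (P \<mu>) \<odot>\<^bsub>M\<^esub> \<delta>\<delta> \<mu> x) \<oplus>\<^bsub>M\<^esub> \<dots>
      = (\<Oplus>\<^bsub>M\<^esub>\<mu>\<in>?S. \<partial> i (P \<mu>) \<odot>\<^bsub>M\<^esub> \<delta>\<delta> \<mu> x \<oplus>\<^bsub>M\<^esub> P \<mu> \<odot>\<^bsub>M\<^esub> \<delta> i (\<delta>\<delta> \<mu> x))"
    by (rule M.finsum_addf[symmetric])
      (use PD i x in \<open>auto intro!: smult_closed \<delta>\<delta>_closed \<delta>_closed der_closed\<close>)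
  also have "\<dots> = finsum M (\<delta> i \<circ> (\<lambda>\<mu>. P \<mu> \<odot>\<^bsub>M\<^esub> \<delta>\<delta> \<mu> x)) ?S"
    by (rule M.finsum_cong')
      (use PD i x in \<open>auto simp: \<delta>_smult \<delta>\<delta>_closed intro!: smult_closed \<delta>\<delta>_closed \<delta>_closed der_closed M.a_closed\<close>)
  also have "\<dots> = \<delta> i (act P x)"
    unfolding op_smult_def
    by (rule M.additive_finsum[OF M.abelian_group_axioms, symmetric])
      (use PD i x in \<open>auto simp: \<delta>_add intro!: \<delta>_closed smult_closed \<delta>\<delta>_closed\<close>)
  finally show ?thesis .
qed

lemma act_op_const: "a \<in> carrier A \<Longrightarrow> x \<in> carrier M \<Longrightarrow> act (op_const A a) x = a \<odot>\<^bsub>M\<^esub> x"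
  by (simp add: op_const_def act_op_monom \<delta>\<delta>_0)

lemma act_op_d: "i < nder A \<Longrightarrow> x \<in> carrier M \<Longrightarrow> act (op_d A i) x = \<delta> i x"
  using \<delta>\<delta>_Suc[of i x "\<lambda>_. 0"] \<delta>_closed by (simp add: op_d_def act_op_monom \<delta>\<delta>_0)

lemma act_iter_lmult:
  assumes P: "P \<in> carrier F" and x: "x \<in> carrier M"
  shows "act (iter_ops (nder A) (op_lmult A) \<mu> P) x = \<delta>\<delta> \<mu> (act P x)"
proof -
  interpret FF: derivation_module A F "op_lmult A" by (rule derivation_module_F)
  have 1: "act ((op_lmult A i ^^ k) Q) x = (\<delta> i ^^ k) (act Q x)"
    if "i < nder A" "Q \<in> carrier F" for i k Q
    using that by (induction k) (auto simp: act_op_lmult FF.funpow_closed x)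
  have "act (foldr (\<lambda>i h. (op_lmult A i ^^ \<mu> i) \<circ> h) xs id P) x
      = foldr (\<lambda>i h. (\<delta> i ^^ \<mu> i) \<circ> h) xs id (act P x)
    \<and> foldr (\<lambda>i h. (op_lmult A i ^^ \<mu> i) \<circ> h) xs id P \<in> carrier F"
    if "set xs \<subseteq> {..<nder A}" for xs
    using that by (induction xs) (auto simp: P 1 FF.funpow_closed)
  from this[of "[0..<nder A]"] show ?thesis
    by (auto simp: iter_ops_def atLeast0LessThan)
qed

lemma act_mult:
  assumes P: "P \<in> carrier F" and Q: "Q \<in> carrier F" and x: "x \<in> carrier M"
  shows "act (op_smult A F (op_lmult A) P Q) x = act P (act Q x)"
proof -
  interpret FF: derivation_module A F "op_lmult A" by (rule derivation_module_F)
  note PD = op_free_moduleD[OF P]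
  have "act (op_smult A F (op_lmult A) P Q) x
      = finsum M ((\<lambda>R. act R x) \<circ> (\<lambda>\<mu>. P \<mu> \<odot>\<^bsub>F\<^esub> FF.\<delta>\<delta> \<mu> Q)) (op_supp A P)"
    unfolding op_smult_def[of A F]
    by (rule FF.M.additive_finsum[OF M.abelian_group_axioms])
      (use PD Q x in \<open>auto simp: act_add_left act_closed intro!: FF.smult_closed FF.\<delta>\<delta>_closed\<close>)
  also have "\<dots> = act P (act Q x)"
    unfolding op_smult_def[of A M \<delta> P]
    by (rule M.finsum_cong')
      (use PD Q x in \<open>auto simp: act_smult act_iter_lmult FF.\<delta>\<delta>_closed
        intro!: smult_closed \<delta>\<delta>_closed act_closed\<close>)
  finally show ?thesis .
qed

end

context differential_ring
begin

lemma op_monom_closed: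
  assumes "a \<in> carrier A" "\<And>i. i \<ge> nder A \<Longrightarrow> \<mu> i = 0"
  shows "op_monom A a \<mu> \<in> carrier F"
  by (rule F_memI[where S = "{\<mu>}"]) (use assms in \<open>auto simp: op_supp_def op_monom_def split: if_splits\<close>)

lemma op_lmult_monom:
  assumes i: "i < nder A" and a: "a \<in> carrier A"
  shows "op_lmult A i (op_monom A a \<mu>)
    = op_monom A (\<partial> i a) \<mu> \<oplus>\<^bsub>F\<^esub> op_monom A a (\<mu>(i := Suc (\<mu> i)))"
proof
  fix \<nu>
  have "\<nu> i \<noteq> 0 \<and> \<nu>(i := \<nu> i - 1) = \<mu> \<longleftrightarrow> \<nu> = \<mu>(i := Suc (\<mu> i))" by (auto simp: fun_eq_iff)
  then show "op_lmult A i (op_monom A a \<mu>) \<nu>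
      = (op_monom A (\<partial> i a) \<mu> \<oplus>\<^bsub>F\<^esub> op_monom A a (\<mu>(i := Suc (\<mu> i)))) \<nu>"
    using der_zero[OF i] a by (auto simp: op_lmult_def op_monom_def F_simps)
qed

lemma iter_lmult_one:
  assumes "\<And>i. i \<ge> nder A \<Longrightarrow> \<mu> i = 0"
  shows "iter_ops (nder A) (op_lmult A) \<mu> (op_const A \<one>) = op_monom A \<one> \<mu>"
proof -
  interpret FF: derivation_module A F "op_lmult A" by (rule derivation_module_F)
  have one: "op_const A \<one> \<in> carrier F" by (simp add: op_const_def op_monom_closed)
  show ?thesis
    using assms
  proof (induction "sum \<mu> {..<nder A}" arbitrary: \<mu>)
    case 0
    then have "\<mu> = (\<lambda>_. 0)" by (metis finite_lessThan lessThan_iff not_le sum_eq_0_iff ext)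
    then show ?case by (simp add: FF.\<delta>\<delta>_0 op_const_def)
  next
    case (Suc k)
    then obtain i where i: "i < nder A" "\<mu> i \<noteq> 0"
      by (metis Zero_not_Suc lessThan_iff sum.neutral)
    define \<nu> where "\<nu> = \<mu>(i := \<mu> i - 1)"
    have \<mu>: "\<mu> = \<nu>(i := Suc (\<nu> i))" using i by (auto simp: \<nu>_def)
    have "sum \<mu> {..<nder A} = Suc (sum \<nu> {..<nder A})"
      using i by (subst (1 2) sum.remove[of _ i]) (auto simp: \<nu>_def intro: sum.cong)
    then have IH: "iter_ops (nder A) (op_lmult A) \<nu> (op_const A \<one>) = op_monom A \<one> \<nu>"
      using Suc.hyps Suc.prems by (intro Suc.hyps(1)) (auto simp: \<nu>_def)
    have "iter_ops (nder A) (op_lmult A) \<mu> (op_const A \<one>) = op_lmult A i (op_monom A \<one> \<nu>)"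
      unfolding \<mu> FF.\<delta>\<delta>_Suc[OF i(1) one] IH ..
    also have "\<dots> = op_monom A \<one> \<mu>"
      unfolding op_lmult_monom[OF i(1) one_closed] \<mu>[symmetric]
      by (auto simp: F_simps op_monom_def der_one i)
    finally show ?case .
  qed
qed

lemma finsum_F_apply:
  assumes "finite S" "f \<in> S \<rightarrow> carrier F"
  shows "finsum F f S \<mu> = (\<Oplus>s\<in>S. f s \<mu>)"
proof -
  interpret F: module A F by (rule module_F)
  have "finsum F f S \<mu> = finsum A ((\<lambda>P. P \<mu>) \<circ> f) S"
    by (rule F.M.additive_finsum[OF is_abelian_group])
      (use assms in \<open>auto simp: F_simps op_free_moduleD(2)\<close>)
  then show ?thesis by (simp add: comp_def)
qed

lemma op_normal_form:
  assumes P: "P \<in> carrier F"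
  shows "P = (\<Oplus>\<^bsub>F\<^esub>\<mu>\<in>op_supp A P. op_monom A (P \<mu>) \<mu>)"
proof
  fix \<nu>
  note PD = op_free_moduleD[OF P]
  have "(\<Oplus>\<^bsub>F\<^esub>\<mu>\<in>op_supp A P. op_monom A (P \<mu>) \<mu>) \<nu> = (\<Oplus>\<mu>\<in>op_supp A P. op_monom A (P \<mu>) \<mu> \<nu>)"
    by (rule finsum_F_apply) (use PD in \<open>auto intro!: op_monom_closed\<close>)
  also have "\<dots> = (\<Oplus>\<mu>\<in>op_supp A P. if \<nu> = \<mu> then P \<mu> else \<zero>)" by (simp add: op_monom_def)
  also have "\<dots> = P \<nu>"
  proof (cases "\<nu> \<in> op_supp A P")
    case True
    then show ?thesis using PD(1,2) finsum_singleton[of \<nu> "op_supp A P" P] by blast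
  next
    case False
    then have "(\<Oplus>\<mu>\<in>op_supp A P. if \<nu> = \<mu> then P \<mu> else \<zero>) = (\<Oplus>\<mu>\<in>op_supp A P. \<zero>)"
      by (intro finsum_cong') auto
    with False show ?thesis by (simp add: op_supp_def)
  qed
  finally show "P \<nu> = (\<Oplus>\<^bsub>F\<^esub>\<mu>\<in>op_supp A P. op_monom A (P \<mu>) \<mu>) \<nu>" ..
qed

lemma diff_ops_simps:
  "carrier (diff_ops A) = carrier F" "\<zero>\<^bsub>diff_ops A\<^esub> = \<zero>\<^bsub>F\<^esub>" "P \<oplus>\<^bsub>diff_ops A\<^esub> Q = P \<oplus>\<^bsub>F\<^esub> Q"
  "\<one>\<^bsub>diff_ops A\<^esub> = op_const A \<one>" "P \<otimes>\<^bsub>diff_ops A\<^esub> Q = op_smult A F (op_lmult A) P Q"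
  by (simp_all add: diff_ops_def)

theorem ring_diff_ops: "ring (diff_ops A)"
proof -
  interpret FF: derivation_module A F "op_lmult A" by (rule derivation_module_F)
  have one: "op_const A \<one> \<in> carrier F" by (simp add: op_const_def op_monom_closed)
  show ?thesis
  proof (rule ringI)
    show "abelian_group (diff_ops A)"
      by (rule abelian_groupI)
        (auto simp: diff_ops_simps FF.M.a_ac intro: FF.M.add.l_inv_ex)
    show "Group.monoid (diff_ops A)"
    proof (rule monoidI)
      fix P assume P: "P \<in> carrier (diff_ops A)"
      then show "\<one>\<^bsub>diff_ops A\<^esub> \<otimes>\<^bsub>diff_ops A\<^esub> P = P"
        by (simp add: diff_ops_simps FF.act_op_const)
      have "op_smult A F (op_lmult A) P (op_const A \<one>) = (\<Oplus>\<^bsub>F\<^esub>\<mu>\<in>op_supp A P. op_monom A (P \<mu>) \<mu>)"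
        unfolding op_smult_def
      proof (rule FF.M.finsum_cong')
        fix \<mu> assume "\<mu> \<in> op_supp A P"
        with P have "\<mu> i = 0" if "i \<ge> nder A" for i using that op_free_moduleD(3) diff_ops_simps by metis
        then have "iter_ops (nder A) (op_lmult A) \<mu> (op_const A \<one>) = op_monom A \<one> \<mu>"
          by (rule iter_lmult_one)
        then show "P \<mu> \<odot>\<^bsub>F\<^esub> iter_ops (nder A) (op_lmult A) \<mu> (op_const A \<one>) = op_monom A (P \<mu>) \<mu>"
          using P op_free_moduleD(2)[of P A \<mu>] by (auto simp: diff_ops_simps F_simps op_monom_def)
      qed (use P in \<open>auto simp: diff_ops_simps intro!: op_monom_closed dest: op_free_moduleD\<close>)
      also have "\<dots> = P"
        by (rule op_normal_form[symmetric]) (use P in \<open>simp add: diff_ops_simps\<close>)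
      finally show "P \<otimes>\<^bsub>diff_ops A\<^esub> \<one>\<^bsub>diff_ops A\<^esub> = P" by (simp add: diff_ops_simps)
    qed (auto simp: diff_ops_simps FF.act_closed FF.act_mult one)
  qed (auto simp: diff_ops_simps FF.act_add_left FF.act_add_right)
qed

lemma op_d_comm:
  assumes "i < nder A" "j < nder A"
  shows "op_d A i \<otimes>\<^bsub>diff_ops A\<^esub> op_d A j = op_d A j \<otimes>\<^bsub>diff_ops A\<^esub> op_d A i"
proof -
  interpret FF: derivation_module A F "op_lmult A" by (rule derivation_module_F)
  have one: "op_const A \<one> \<in> carrier F" by (simp add: op_const_def op_monom_closed)
  have d: "op_d A k = op_lmult A k (op_const A \<one>)" "op_d A k \<in> carrier F" if "k < nder A" for k
  proof -
    have "op_d A k = iter_ops (nder A) (op_lmult A) ((\<lambda>_. 0)(k := Suc 0)) (op_const A \<one>)"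
      unfolding op_d_def One_nat_def by (rule iter_lmult_one[symmetric]) (use that in simp)
    then show "op_d A k = op_lmult A k (op_const A \<one>)"
      using FF.\<delta>\<delta>_Suc[OF that one, of "\<lambda>_. 0"] by (simp only: FF.\<delta>\<delta>_0)
    then show "op_d A k \<in> carrier F" using FF.\<delta>_closed[OF that one] by (simp only:)
  qed
  have "op_d A i \<otimes>\<^bsub>diff_ops A\<^esub> op_d A j = op_lmult A i (op_lmult A j (op_const A \<one>))"
    if "i < nder A" "j < nder A" for i j
    using FF.act_op_d[OF that(1) d(2)[OF that(2)]] d(1)[OF that(2)] by (simp only: diff_ops_simps)
  from this[OF assms] this[OF assms(2,1)] FF.\<delta>_comm[OF assms one] show ?thesis by (simp only:)
qed

lemma op_d_const:
  assumes i: "i < nder A" and a: "a \<in> carrier A"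
  shows "op_d A i \<otimes>\<^bsub>diff_ops A\<^esub> op_const A a
    = op_const A a \<otimes>\<^bsub>diff_ops A\<^esub> op_d A i \<oplus>\<^bsub>diff_ops A\<^esub> op_const A (\<partial> i a)"
proof -
  interpret FF: derivation_module A F "op_lmult A" by (rule derivation_module_F)
  have c: "op_d A i \<in> carrier F" "op_const A a \<in> carrier F"
    "op_const A (\<partial> i a) \<in> carrier F" "op_monom A a ((\<lambda>_. 0)(i := 1)) \<in> carrier F"
    using i a der_closed[OF i a] by (auto simp: op_d_def op_const_def intro!: op_monom_closed)
  have "op_const A a \<otimes>\<^bsub>diff_ops A\<^esub> op_d A i = op_monom A a ((\<lambda>_. 0)(i := 1))"
    using a c by (simp add: diff_ops_simps FF.act_op_const) (auto simp: F_simps op_d_def op_monom_def)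
  moreover have "op_d A i \<otimes>\<^bsub>diff_ops A\<^esub> op_const A a
      = op_const A (\<partial> i a) \<oplus>\<^bsub>F\<^esub> op_monom A a ((\<lambda>_. 0)(i := 1))"
    using i a c op_lmult_monom[OF i a, of "\<lambda>_. 0"]
    by (simp add: diff_ops_simps FF.act_op_d) (simp add: op_const_def)
  ultimately show ?thesis using c by (simp add: diff_ops_simps FF.M.a_comm)
qed

end

theorem (in derivation_module) left_module_left_op_module:
  "left_module (diff_ops A) (left_op_module A M \<delta>)"
proof -
  interpret D: ring "diff_ops A" by (rule ring_diff_ops)
  have "abelian_group (left_op_module A M \<delta>)"
    by (rule abelian_groupI)
      (auto simp: left_op_module_def with_smult_def M.a_ac intro: M.add.l_inv_ex)
  then show ?thesis
    by (intro left_module.intro left_module_axioms.intro D.ring_axioms)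
      (auto simp: left_op_module_def with_smult_def diff_ops_simps act_closed act_add_left
        act_add_right act_mult act_op_const)
qed

lemma (in differential_ring) left_module_base: "left_module (diff_ops A) (base_module A)"
proof -
  have "abelian_group (with_smult A (monoid.mult A))"
    by (rule abelian_groupI) (auto simp: with_smult_def a_ac intro: add.l_inv_ex)
  then have "module A (with_smult A (monoid.mult A))"
    by (rule moduleI[OF is_cring]) (auto simp: with_smult_def l_distr r_distr m_assoc)
  then interpret derivation_module A "with_smult A (monoid.mult A)" "der A"
    by (intro derivation_module.intro derivation_module_axioms.intro differential_ring_axioms)
      (auto simp: with_smult_def der_closed der_add der_mult der_comm a_ac)
  show ?thesis
    using left_module_left_op_module by (simp add: base_module_def)
qed

end

theory Submission
  imports Defs
begin

text \<open>
  Since \<open>A\<close> and the \<open>d\<^sub>i\<close> generate the ring \<open>D\<close> of operators, subject to \<open>d\<^sub>i a = a d\<^sub>i + \<partial>\<^sub>i a\<close> and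
  \<open>d\<^sub>i d\<^sub>j = d\<^sub>j d\<^sub>i\<close>, a left \<open>D\<close>-module is the same as an \<open>A\<close>-module with \<open>n\<close> commuting additive maps that
  satisfy the Leibniz rule (\<open>derivation_module_left_scalars\<close> and \<open>left_module_left_op_module\<close>). It
  therefore suffices to exhibit such maps on \<open>hom\<^sub>A(M, N)\<close> and \<open>M \<otimes>\<^sub>A N\<close>. On homomorphisms
  \<open>f \<mapsto> d\<^sub>i \<circ> f - f \<circ> d\<^sub>i\<close> is \<open>A\<close>-linear because the Leibniz defects of the two terms cancel
  (\<open>derivation_module_hom\<close>), and for the same reason \<open>x \<otimes> y \<mapsto> d\<^sub>i x \<otimes> y + x \<otimes> d\<^sub>i y\<close> is well defined on the
  tensor product (\<open>derivation_module_tensor\<close>); the remaining rules are verified on elements and on pure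
  tensors. The formulas for \<open>\<xi> \<in> T\<close> follow from those for the \<open>d\<^sub>i\<close>, whose \<open>A\<close>-span is \<open>T\<close>.

  Right modules obey the same pattern for \<open>x \<mapsto> - x d\<^sub>i\<close>, which satisfies the Leibniz rule
  (\<open>derivation_module_right_scalars\<close>). The structures on the homomorphisms between two right modules,
  and on the tensor product of a left with a right module, are thus obtained from the constructions
  above, up to a sign. For the latter, commuting derivations have to be turned back into a right
  action (\<open>right_module_right_op_module\<close>).

  A map between left modules is \<open>D\<close>-linear as soon as it is additive and commutes with \<open>A\<close> and the \<open>d\<^sub>i\<close>
  (\<open>linear_over_operators\<close>). For the adjunction this leaves the comparison of
  \<open>d\<^sub>i (m \<otimes> n) = d\<^sub>i m \<otimes> n + m \<otimes> d\<^sub>i n\<close> with the definition of \<open>d\<^sub>i\<close> on \<open>hom\<^sub>A(N, L)\<close>.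

  Finally, a \<open>D\<close>-linear \<open>h : M \<rightarrow> D\<^sup>*\<close> is determined by \<open>f x = h x 1\<close>: linearity reads
  \<open>h x (d\<^sub>i P) = \<partial>\<^sub>i (h x P) - h (d\<^sub>i x) P\<close>, so that \<open>h x P = (P f) x\<close> for the action of \<open>P\<close> on
  \<open>f \<in> hom\<^sub>A(M, A)\<close> generated by the Spencer operator. Conversely this formula defines a \<open>D\<close>-linear map for
  every \<open>f\<close> (\<open>hom_dual_iso\<close>).
\<close>


section \<open>Generators of the ring of operators\<close>

context differential_ring
begin

abbreviation "D \<equiv> diff_ops A"

lemma op_const_closed [intro, simp]: "a \<in> carrier A \<Longrightarrow> op_const A a \<in> carrier D"
  by (simp add: diff_ops_simps op_const_def op_monom_closed)

lemma op_d_closed [intro, simp]: "i < nder A \<Longrightarrow> op_d A i \<in> carrier D"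
  by (auto simp add: diff_ops_simps op_d_def intro!: op_monom_closed)

lemma op_const_add:
  "a \<in> carrier A \<Longrightarrow> b \<in> carrier A \<Longrightarrow> op_const A (a \<oplus> b) = op_const A a \<oplus>\<^bsub>D\<^esub> op_const A b"
  by (auto simp: diff_ops_simps F_simps op_const_def op_monom_def)

lemma op_const_zero: "op_const A \<zero> = \<zero>\<^bsub>D\<^esub>"
  by (auto simp: diff_ops_simps F_simps op_const_def op_monom_def)

lemma op_const_one: "op_const A \<one> = \<one>\<^bsub>D\<^esub>"
  by (simp add: diff_ops_simps)

lemma op_const_times:
  assumes "a \<in> carrier A" "P \<in> carrier D"
  shows "op_const A a \<otimes>\<^bsub>D\<^esub> P = (\<lambda>\<mu>. a \<otimes> P \<mu>)"
proof -
  interpret FF: derivation_module A F "op_lmult A" by (rule derivation_module_F)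
  show ?thesis using assms by (simp add: diff_ops_simps FF.act_op_const F_simps)
qed

lemma op_const_mult:
  assumes "a \<in> carrier A" "b \<in> carrier A"
  shows "op_const A (a \<otimes> b) = op_const A a \<otimes>\<^bsub>D\<^esub> op_const A b"
  unfolding op_const_times[OF assms(1) op_const_closed[OF assms(2)]]
  using assms by (auto simp: op_const_def op_monom_def)

lemma op_d_times:
  assumes "i < nder A" "P \<in> carrier D"
  shows "op_d A i \<otimes>\<^bsub>D\<^esub> P = op_lmult A i P"
proof -
  interpret FF: derivation_module A F "op_lmult A" by (rule derivation_module_F)
  show ?thesis using assms by (simp add: diff_ops_simps FF.act_op_d)
qed

text \<open>
  In the normal form \<open>P = \<Sum> a\<^sup>\<mu> d\<^sub>\<mu>\<close> every \<open>d\<^sub>\<mu>\<close> is a product of the \<open>d\<^sub>i\<close>, so that the elements of \<open>A\<close> and the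
  \<open>d\<^sub>i\<close> generate the ring. Identities that are stable under sums and products of operators, such as
  linearity of a map over the operators, need to be verified for these generators only.
\<close>

lemma diff_ops_induct [consumes 1, case_names const deriv add mult]:
  assumes P: "P \<in> carrier D"
    and const: "\<And>a. a \<in> carrier A \<Longrightarrow> Q (op_const A a)"
    and deriv: "\<And>i. i < nder A \<Longrightarrow> Q (op_d A i)"
    and add: "\<And>P R. \<lbrakk>P \<in> carrier D; R \<in> carrier D; Q P; Q R\<rbrakk> \<Longrightarrow> Q (P \<oplus>\<^bsub>D\<^esub> R)"
    and mult: "\<And>P R. \<lbrakk>P \<in> carrier D; R \<in> carrier D; Q P; Q R\<rbrakk> \<Longrightarrow> Q (P \<otimes>\<^bsub>D\<^esub> R)"
  shows "Q P"
proof -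
  interpret D: ring D by (rule ring_diff_ops)
  interpret F: module A F by (rule module_F)
  have monom_one: "Q (op_monom A \<one> \<mu>)" if "\<And>i. i \<ge> nder A \<Longrightarrow> \<mu> i = 0" for \<mu>
    using that
  proof (induction "sum \<mu> {..<nder A}" arbitrary: \<mu>)
    case 0
    then have "\<mu> = (\<lambda>_. 0)" by (metis finite_lessThan lessThan_iff not_le sum_eq_0_iff ext)
    then show ?case using const[of \<one>] by (simp add: op_const_def)
  next
    case (Suc k)
    then obtain i where i: "i < nder A" "\<mu> i \<noteq> 0"
      by (metis Zero_not_Suc lessThan_iff sum.neutral)
    define \<nu> where "\<nu> = \<mu>(i := \<mu> i - 1)"
    have \<mu>: "\<mu> = \<nu>(i := Suc (\<nu> i))" using i by (auto simp: \<nu>_def)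
    have \<nu>: "\<And>i. i \<ge> nder A \<Longrightarrow> \<nu> i = 0" using Suc.prems by (auto simp: \<nu>_def)
    have "sum \<mu> {..<nder A} = Suc (sum \<nu> {..<nder A})"
      using i by (subst (1 2) sum.remove[of _ i]) (auto simp: \<nu>_def intro: sum.cong)
    then have IH: "Q (op_monom A \<one> \<nu>)" using Suc.hyps \<nu> by auto
    have c: "op_monom A \<one> \<nu> \<in> carrier D" using \<nu> by (simp add: diff_ops_simps op_monom_closed)
    have "op_d A i \<otimes>\<^bsub>D\<^esub> op_monom A \<one> \<nu> = op_monom A \<one> \<mu>"
      unfolding op_d_times[OF i(1) c] op_lmult_monom[OF i(1) one_closed] \<mu>[symmetric]
      by (auto simp: F_simps op_monom_def der_one i)
    then show ?case using mult[OF op_d_closed[OF i(1)] c deriv[OF i(1)] IH] by simp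
  qed
  have monom: "Q (op_monom A a \<mu>) \<and> op_monom A a \<mu> \<in> carrier D"
    if "a \<in> carrier A" "\<And>i. i \<ge> nder A \<Longrightarrow> \<mu> i = 0" for a \<mu>
  proof -
    have c: "op_monom A \<one> \<mu> \<in> carrier D" using that by (simp add: diff_ops_simps op_monom_closed)
    have "op_const A a \<otimes>\<^bsub>D\<^esub> op_monom A \<one> \<mu> = op_monom A a \<mu>"
      using that by (auto simp: op_const_times c) (auto simp: op_monom_def)
    then show ?thesis
      using mult[OF op_const_closed[OF that(1)] c const[OF that(1)] monom_one[OF that(2)]]
      by (metis D.m_closed c op_const_closed that(1))
  qed
  have sums: "Q (finsum D f S) \<and> finsum D f S \<in> carrier D"
    if "finite S" "\<And>s. s \<in> S \<Longrightarrow> Q (f s) \<and> f s \<in> carrier D" for S and f :: "_ \<Rightarrow> 'a diff_op"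
    using that
  proof (induction S rule: finite_induct)
    case empty
    then show ?case using const[of \<zero>] by (simp add: op_const_zero)
  next
    case (insert s S)
    then have "f \<in> S \<rightarrow> carrier D" "f s \<in> carrier D" by auto
    with insert show ?case by (simp add: D.finsum_insert add)
  qed
  have "(\<Oplus>\<^bsub>F\<^esub>\<mu>\<in>op_supp A P. op_monom A (P \<mu>) \<mu>) = (\<Oplus>\<^bsub>D\<^esub>\<mu>\<in>op_supp A P. op_monom A (P \<mu>) \<mu>)"
    using F.M.additive_finsum[OF D.abelian_group_axioms, of "\<lambda>x. x" "op_supp A P" "\<lambda>\<mu>. op_monom A (P \<mu>) \<mu>"]
      monom P op_free_moduleD[of P A] by (auto simp: diff_ops_simps comp_def)
  then have "P = (\<Oplus>\<^bsub>D\<^esub>\<mu>\<in>op_supp A P. op_monom A (P \<mu>) \<mu>)"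
    using op_normal_form[of P] P by (simp add: diff_ops_simps)
  moreover have "Q (\<Oplus>\<^bsub>D\<^esub>\<mu>\<in>op_supp A P. op_monom A (P \<mu>) \<mu>)"
    using sums[of "op_supp A P" "\<lambda>\<mu>. op_monom A (P \<mu>) \<mu>"] monom P
      op_free_moduleD[of P A] unfolding diff_ops_simps by blast
  ultimately show ?thesis by simp
qed

lemma op_T_induct [consumes 1, case_names zero monom add]:
  assumes \<xi>: "\<xi> \<in> op_T A"
    and zero: "Q \<zero>\<^bsub>D\<^esub>"
    and monom: "\<And>a i. \<lbrakk>a \<in> carrier A; i < nder A\<rbrakk> \<Longrightarrow> Q (op_const A a \<otimes>\<^bsub>D\<^esub> op_d A i)"
    and add: "\<And>P R. \<lbrakk>P \<in> carrier D; R \<in> carrier D; Q P; Q R\<rbrakk> \<Longrightarrow> Q (P \<oplus>\<^bsub>D\<^esub> R)"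
  shows "Q \<xi>"
proof -
  interpret D: ring D by (rule ring_diff_ops)
  obtain c where c: "c \<in> {..<nder A} \<rightarrow> carrier A"
    "\<xi> = (\<Oplus>\<^bsub>D\<^esub>i\<in>{..<nder A}. op_const A (c i) \<otimes>\<^bsub>D\<^esub> op_d A i)"
    using \<xi> unfolding op_T_def by auto
  have "Q (\<Oplus>\<^bsub>D\<^esub>i\<in>S. op_const A (c i) \<otimes>\<^bsub>D\<^esub> op_d A i)" if "finite S" "S \<subseteq> {..<nder A}" for S
    using that
  proof (induction S rule: finite_induct)
    case empty
    then show ?case by (simp add: zero)
  next
    case (insert i S)
    then have "(\<lambda>i. op_const A (c i) \<otimes>\<^bsub>D\<^esub> op_d A i) \<in> insert i S \<rightarrow> carrier D"
      using c(1) by auto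
    with insert c(1) show ?case by (subst D.finsum_insert) (auto simp: add monom Pi_iff)
  qed
  then show ?thesis by (simp add: c(2))
qed

end


section \<open>Modules over the ring of operators as modules with derivations\<close>

lemma with_smult_simps [simp]:
  "carrier (with_smult M s) = carrier M" "\<zero>\<^bsub>with_smult M s\<^esub> = \<zero>\<^bsub>M\<^esub>"
  "add (with_smult M s) = add M" "smult (with_smult M s) = s"
  by (simp_all add: with_smult_def)

lemma with_rsmult_simps [simp]:
  "carrier (with_rsmult M s) = carrier M" "\<zero>\<^bsub>with_rsmult M s\<^esub> = \<zero>\<^bsub>M\<^esub>"
  "add (with_rsmult M s) = add M" "rsmult (with_rsmult M s) = s"
  by (simp_all add: with_rsmult_def)

lemma a_inv_cong:
  "carrier M = carrier N \<Longrightarrow> add M = add N \<Longrightarrow> \<zero>\<^bsub>M\<^esub> = \<zero>\<^bsub>N\<^esub> \<Longrightarrow> a_inv M = a_inv N"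
  by (simp add: a_inv_def m_inv_def fun_eq_iff)

lemma with_smult_minus [simp]:
  "a_inv (with_smult M s) = a_inv M" "a_minus (with_smult M s) = a_minus M"
proof -
  show "a_inv (with_smult M s) = a_inv M" by (rule a_inv_cong) simp_all
  then show "a_minus (with_smult M s) = a_minus M" by (simp add: a_minus_def fun_eq_iff)
qed

lemma with_rsmult_minus [simp]:
  "a_inv (with_rsmult M s) = a_inv M" "a_minus (with_rsmult M s) = a_minus M"
proof -
  show "a_inv (with_rsmult M s) = a_inv M" by (rule a_inv_cong) simp_all
  then show "a_minus (with_rsmult M s) = a_minus M" by (simp add: a_minus_def fun_eq_iff)
qed

lemma abelian_group_cong:
  assumes "abelian_group M" "carrier N = carrier M" "add N = add M" "\<zero>\<^bsub>N\<^esub> = \<zero>\<^bsub>M\<^esub>"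
  shows "abelian_group N"
proof -
  interpret M: abelian_group M by fact
  show ?thesis
    by (rule abelian_groupI) (auto simp: assms(2-4) M.a_ac intro: M.add.l_inv_ex)
qed

lemma left_op_module_simps [simp]:
  "carrier (left_op_module A M \<delta>) = carrier M" "\<zero>\<^bsub>left_op_module A M \<delta>\<^esub> = \<zero>\<^bsub>M\<^esub>"
  "add (left_op_module A M \<delta>) = add M" "smult (left_op_module A M \<delta>) = op_smult A M \<delta>"
  "a_inv (left_op_module A M \<delta>) = a_inv M" "a_minus (left_op_module A M \<delta>) = a_minus M"
  by (simp_all add: left_op_module_def)

lemma left_scalars_simps [simp]:
  "carrier (left_scalars A M) = carrier M" "\<zero>\<^bsub>left_scalars A M\<^esub> = \<zero>\<^bsub>M\<^esub>"
  "add (left_scalars A M) = add M" "a \<odot>\<^bsub>left_scalars A M\<^esub> x = op_const A a \<odot>\<^bsub>M\<^esub> x"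
  "a_inv (left_scalars A M) = a_inv M" "a_minus (left_scalars A M) = a_minus M"
  by (simp_all add: left_scalars_def)

lemma right_scalars_simps [simp]:
  "carrier (right_scalars A M) = carrier M" "\<zero>\<^bsub>right_scalars A M\<^esub> = \<zero>\<^bsub>M\<^esub>"
  "add (right_scalars A M) = add M" "a \<odot>\<^bsub>right_scalars A M\<^esub> x = x \<boxdot>\<^bsub>M\<^esub> op_const A a"
  "a_inv (right_scalars A M) = a_inv M" "a_minus (right_scalars A M) = a_minus M"
  by (simp_all add: right_scalars_def)

lemma (in left_module) smult_l_zero:
  "x \<in> carrier M \<Longrightarrow> \<zero>\<^bsub>R\<^esub> \<odot>\<^bsub>M\<^esub> x = \<zero>\<^bsub>M\<^esub>"
  by (rule R.additive_zero[OF M.abelian_group_axioms]) (auto simp: smult_closed smult_l_distr)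

lemma (in right_module) rsmult_r_zero:
  "x \<in> carrier M \<Longrightarrow> x \<boxdot>\<^bsub>M\<^esub> \<zero>\<^bsub>R\<^esub> = \<zero>\<^bsub>M\<^esub>"
  by (rule R.additive_zero[OF M.abelian_group_axioms]) (auto simp: rsmult_closed rsmult_r_distr)

lemma (in abelian_group) additive_minus:
  assumes "abelian_group H" "h \<in> carrier G \<rightarrow> carrier H"
    and add: "\<And>x y. \<lbrakk>x \<in> carrier G; y \<in> carrier G\<rbrakk> \<Longrightarrow> h (x \<oplus> y) = h x \<oplus>\<^bsub>H\<^esub> h y"
  shows "x \<in> carrier G \<Longrightarrow> h (\<ominus> x) = \<ominus>\<^bsub>H\<^esub> h x"
    and "x \<in> carrier G \<Longrightarrow> y \<in> carrier G \<Longrightarrow> h (x \<ominus> y) = h x \<ominus>\<^bsub>H\<^esub> h y"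
proof -
  interpret H: abelian_group H by fact
  have h: "h x \<in> carrier H" if "x \<in> carrier G" for x using assms(2) that by auto
  show inv: "h (\<ominus> x) = \<ominus>\<^bsub>H\<^esub> h x" if "x \<in> carrier G" for x
  proof -
    have "h (\<ominus> x) \<oplus>\<^bsub>H\<^esub> h x = \<zero>\<^bsub>H\<^esub>"
      using add[of "\<ominus> x" x] that additive_zero[OF assms] by (simp add: l_neg)
    then show ?thesis using that h by (intro H.minus_equality[symmetric]) auto
  qed
  show "x \<in> carrier G \<Longrightarrow> y \<in> carrier G \<Longrightarrow> h (x \<ominus> y) = h x \<ominus>\<^bsub>H\<^esub> h y"
    by (simp add: minus_eq H.minus_eq add inv)
qed

context differential_ring
begin

text \<open>
  Restricted to the generators, a left module over the operators is an \<open>A\<close>-module with commuting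
  derivations: this is what \<open>d\<^sub>i a = a d\<^sub>i + \<partial>\<^sub>i a\<close> and \<open>d\<^sub>i d\<^sub>j = d\<^sub>j d\<^sub>i\<close> say about the action. Together with
  the passage back from derivations to the action of all operators, it allows module structures to
  be constructed without computing with operators of higher order.
\<close>

lemma derivation_module_left_scalars:
  assumes "left_module D M"
  shows "derivation_module A (left_scalars A M) (\<lambda>i x. op_d A i \<odot>\<^bsub>M\<^esub> x)"
proof -
  interpret M: left_module D M by fact
  have "module A (left_scalars A M)"
    by (rule moduleI[OF is_cring abelian_group_cong[OF M.M.abelian_group_axioms]])
      (auto simp: M.smult_closed M.smult_l_distr M.smult_r_distr M.smult_assoc1
        op_const_add op_const_mult op_const_one M.smult_one)
  then show ?thesis
  proof (intro derivation_module.intro derivation_module_axioms.intro differential_ring_axioms)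
    fix i a x
    assume h: "i < nder A" "a \<in> carrier A" "x \<in> carrier (left_scalars A M)"
    then have "op_d A i \<odot>\<^bsub>M\<^esub> (op_const A a \<odot>\<^bsub>M\<^esub> x)
      = (op_const A a \<otimes>\<^bsub>D\<^esub> op_d A i \<oplus>\<^bsub>D\<^esub> op_const A (\<partial> i a)) \<odot>\<^bsub>M\<^esub> x"
      by (simp add: M.smult_assoc1[symmetric] op_d_const)
    with h show "op_d A i \<odot>\<^bsub>M\<^esub> (a \<odot>\<^bsub>left_scalars A M\<^esub> x) = \<partial> i a \<odot>\<^bsub>left_scalars A M\<^esub> x
        \<oplus>\<^bsub>left_scalars A M\<^esub> a \<odot>\<^bsub>left_scalars A M\<^esub> (op_d A i \<odot>\<^bsub>M\<^esub> x)"
      by (simp add: M.smult_l_distr M.smult_assoc1 der_closed M.smult_closed M.M.a_comm)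
  next
    fix i j x
    assume h: "i < nder A" "j < nder A" "x \<in> carrier (left_scalars A M)"
    then show "op_d A i \<odot>\<^bsub>M\<^esub> (op_d A j \<odot>\<^bsub>M\<^esub> x) = op_d A j \<odot>\<^bsub>M\<^esub> (op_d A i \<odot>\<^bsub>M\<^esub> x)"
      by (simp add: M.smult_assoc1[symmetric] op_d_comm)
  qed (simp_all add: M.smult_closed M.smult_r_distr)
qed

text \<open>
  On a right module \<open>x \<mapsto> x d\<^sub>i\<close> violates the Leibniz rule by a sign, because
  \<open>(a x) d\<^sub>i = x (a d\<^sub>i) = x (d\<^sub>i a - \<partial>\<^sub>i a) = a (x d\<^sub>i) - (\<partial>\<^sub>i a) x\<close>. The sign disappears for
  \<open>x \<mapsto> - x d\<^sub>i\<close>, so that right modules reduce to modules with derivations as well.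
\<close>

lemma derivation_module_right_scalars:
  assumes "right_module D M"
  shows "derivation_module A (right_scalars A M) (\<lambda>i x. \<ominus>\<^bsub>M\<^esub> (x \<boxdot>\<^bsub>M\<^esub> op_d A i))"
proof -
  interpret M: right_module D M by fact
  have minus: "(\<ominus>\<^bsub>M\<^esub> x) \<boxdot>\<^bsub>M\<^esub> P = \<ominus>\<^bsub>M\<^esub> (x \<boxdot>\<^bsub>M\<^esub> P)" if "x \<in> carrier M" "P \<in> carrier D" for x P
    using M.M.additive_minus(1)[OF M.M.abelian_group_axioms, of "\<lambda>x. x \<boxdot>\<^bsub>M\<^esub> P"] that
    by (auto simp: M.rsmult_closed M.rsmult_l_distr)
  have "module A (right_scalars A M)"
  proof (rule moduleI[OF is_cring abelian_group_cong[OF M.M.abelian_group_axioms]])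
    fix a b x assume "a \<in> carrier A" "b \<in> carrier A" "x \<in> carrier (right_scalars A M)"
    then show "(a \<otimes> b) \<odot>\<^bsub>right_scalars A M\<^esub> x = a \<odot>\<^bsub>right_scalars A M\<^esub> (b \<odot>\<^bsub>right_scalars A M\<^esub> x)"
      using op_const_mult[of b a] by (simp add: M.rsmult_assoc1 m_comm[of a b])
  qed (auto simp: M.rsmult_closed M.rsmult_l_distr M.rsmult_r_distr
        op_const_add op_const_one M.rsmult_one)
  then show ?thesis
  proof (intro derivation_module.intro derivation_module_axioms.intro differential_ring_axioms)
    fix i a x
    assume "i < nder A" "a \<in> carrier A" "x \<in> carrier (right_scalars A M)"
    then have h: "i < nder A" "a \<in> carrier A" "x \<in> carrier M" by simp_all
    have "(x \<boxdot>\<^bsub>M\<^esub> op_d A i) \<boxdot>\<^bsub>M\<^esub> op_const A a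
      = (x \<boxdot>\<^bsub>M\<^esub> op_const A a) \<boxdot>\<^bsub>M\<^esub> op_d A i \<oplus>\<^bsub>M\<^esub> x \<boxdot>\<^bsub>M\<^esub> op_const A (\<partial> i a)"
      using h by (simp add: M.rsmult_assoc1[symmetric] M.rsmult_r_distr[symmetric] der_closed op_d_const)
    with h show "\<ominus>\<^bsub>M\<^esub> ((a \<odot>\<^bsub>right_scalars A M\<^esub> x) \<boxdot>\<^bsub>M\<^esub> op_d A i) = \<partial> i a \<odot>\<^bsub>right_scalars A M\<^esub> x
        \<oplus>\<^bsub>right_scalars A M\<^esub> a \<odot>\<^bsub>right_scalars A M\<^esub> (\<ominus>\<^bsub>M\<^esub> (x \<boxdot>\<^bsub>M\<^esub> op_d A i))"
      by (simp add: minus M.rsmult_closed der_closed M.M.minus_add M.M.a_ac M.M.r_neg1 M.M.r_neg2)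
  next
    fix i j x
    assume "i < nder A" "j < nder A" "x \<in> carrier (right_scalars A M)"
    then show "\<ominus>\<^bsub>M\<^esub> ((\<ominus>\<^bsub>M\<^esub> (x \<boxdot>\<^bsub>M\<^esub> op_d A j)) \<boxdot>\<^bsub>M\<^esub> op_d A i)
        = \<ominus>\<^bsub>M\<^esub> ((\<ominus>\<^bsub>M\<^esub> (x \<boxdot>\<^bsub>M\<^esub> op_d A i)) \<boxdot>\<^bsub>M\<^esub> op_d A j)"
      by (simp add: minus M.rsmult_closed M.rsmult_assoc1[symmetric] op_d_comm)
  qed (simp_all add: M.rsmult_closed M.rsmult_l_distr M.M.minus_add)
qed

end

text \<open>
  Formulas for the same derivation that differ by junk values outside the carrier, or by a sign that
  has been pulled out, are exchanged with this rule.
\<close>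

lemma derivation_module_cong:
  assumes "derivation_module A M \<delta>"
    and eq: "\<And>i x. \<lbrakk>i < nder A; x \<in> carrier M\<rbrakk> \<Longrightarrow> \<delta>' i x = \<delta> i x"
  shows "derivation_module A M \<delta>'"
proof -
  interpret derivation_module A M \<delta> by fact
  show ?thesis
    by (intro derivation_module.intro derivation_module_axioms.intro
        differential_ring_axioms module_axioms)
      (simp_all add: eq \<delta>_closed \<delta>_add \<delta>_smult \<delta>_comm)
qed


section \<open>Right modules over the ring of operators from derivations\<close>

lemma (in derivation_module) \<delta>\<delta>_commute:
  assumes i: "i < nder A" and x: "x \<in> carrier M"
  shows "\<delta>\<delta> \<mu> (\<delta> i x) = \<delta> i (\<delta>\<delta> \<mu> x)"
proof -
  have "foldr (\<lambda>i h. (\<delta> i ^^ \<mu> i) \<circ> h) js id (\<delta> i x) = \<delta> i (foldr (\<lambda>i h. (\<delta> i ^^ \<mu> i) \<circ> h) js id x)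
      \<and> foldr (\<lambda>i h. (\<delta> i ^^ \<mu> i) \<circ> h) js id x \<in> carrier M"
    if "set js \<subseteq> {..<nder A}" for js
    using that by (induction js) (auto simp: x i funpow_closed funpow_comm)
  from this[of "[0..<nder A]"] show ?thesis by (simp add: iter_ops_def atLeast0LessThan)
qed

text \<open>
  Iterating commuting additive maps involves no scalars. The facts about iterated derivations
  therefore carry over to any commuting additive maps on an abelian group, regarded as a module over
  the differential ring \<open>\<int>\<close> with zero derivations.
\<close>

definition int_diff_ring :: "nat \<Rightarrow> int diff_ring"
  where "int_diff_ring n = \<lparr>carrier = UNIV, mult = (*), one = 1, ring.zero = 0, add = (+),
    der = (\<lambda>_ _. 0), nder = n\<rparr>"

lemma derivation_module_int:
  assumes "abelian_group M"
    and closed: "\<And>i x. \<lbrakk>i < n; x \<in> carrier M\<rbrakk> \<Longrightarrow> \<delta> i x \<in> carrier M"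
    and add: "\<And>i x y. \<lbrakk>i < n; x \<in> carrier M; y \<in> carrier M\<rbrakk> \<Longrightarrow> \<delta> i (x \<oplus>\<^bsub>M\<^esub> y) = \<delta> i x \<oplus>\<^bsub>M\<^esub> \<delta> i y"
    and comm: "\<And>i j x. \<lbrakk>i < n; j < n; x \<in> carrier M\<rbrakk> \<Longrightarrow> \<delta> i (\<delta> j x) = \<delta> j (\<delta> i x)"
  shows "derivation_module (int_diff_ring n) (with_smult M (\<lambda>k x. [k] \<cdot>\<^bsub>M\<^esub> x)) \<delta>"
proof -
  interpret M: abelian_group M by fact
  have ring: "cring (int_diff_ring n)"
  proof (rule cringI)
    show "abelian_group (int_diff_ring n)"
    proof (rule abelian_groupI)
      fix x assume "x \<in> carrier (int_diff_ring n)"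
      then show "\<exists>y\<in>carrier (int_diff_ring n). y \<oplus>\<^bsub>int_diff_ring n\<^esub> x = \<zero>\<^bsub>int_diff_ring n\<^esub>"
        by (intro bexI[of _ "- x"]) (simp_all add: int_diff_ring_def)
    qed (simp_all add: int_diff_ring_def)
    show "comm_monoid (int_diff_ring n)"
      by (rule comm_monoidI) (simp_all add: int_diff_ring_def)
  qed (simp add: int_diff_ring_def distrib_right)
  then have diff_ring: "differential_ring (int_diff_ring n)"
    by (intro differential_ring.intro differential_ring_axioms.intro)
      (simp_all add: int_diff_ring_def)
  have "module (int_diff_ring n) (with_smult M (\<lambda>k x. [k] \<cdot>\<^bsub>M\<^esub> x))"
    by (rule moduleI[OF ring abelian_group_cong[OF assms(1)]])
      (auto simp: int_diff_ring_def M.add.int_pow_mult M.add.int_pow_distrib M.add.int_pow_pow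
        M.add.int_pow_1 mult.commute)
  moreover have "\<delta> i ([k] \<cdot>\<^bsub>M\<^esub> x) = [k] \<cdot>\<^bsub>M\<^esub> \<delta> i x" if "i < n" "x \<in> carrier M" for i x and k :: int
  proof -
    interpret group_hom "add_monoid M" "add_monoid M" "\<delta> i"
      by (intro group_hom.intro group_hom_axioms.intro M.a_group)
        (use that closed add in \<open>auto simp: hom_def\<close>)
    show ?thesis using hom_int_pow[of x k] that by (simp add: add_pow_def)
  qed
  moreover have "[(0 :: int)] \<cdot>\<^bsub>M\<^esub> x = \<zero>\<^bsub>M\<^esub>" for x by (simp add: add_pow_def)
  ultimately show ?thesis
    by (intro derivation_module.intro derivation_module_axioms.intro diff_ring)
      (simp_all add: int_diff_ring_def closed add comm)
qed

text \<open>
  Here \<open>\<delta> i\<close> plays the part of \<open>x \<mapsto> x d\<^sub>i\<close>, so that its negative is the derivation.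
\<close>

locale right_derivation_module = derivation_module A M "\<lambda>i x. \<ominus>\<^bsub>M\<^esub> \<delta> i x"
  for A :: "'a diff_ring" (structure) and M :: "('a, 'x) module" (structure) and \<delta> +
  assumes r\<delta>_closed: "\<lbrakk>i < nder A; x \<in> carrier M\<rbrakk> \<Longrightarrow> \<delta> i x \<in> carrier M"
begin

lemma r\<delta>_add: "\<lbrakk>i < nder A; x \<in> carrier M; y \<in> carrier M\<rbrakk> \<Longrightarrow> \<delta> i (x \<oplus>\<^bsub>M\<^esub> y) = \<delta> i x \<oplus>\<^bsub>M\<^esub> \<delta> i y"
  using \<delta>_add[of i x y] by (metis M.add.inv_mult_group M.a_comm M.minus_minus M.a_closed r\<delta>_closed)

lemma r\<delta>_smult:
  assumes "i < nder A" "a \<in> carrier A" "x \<in> carrier M"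
  shows "\<partial> i a \<odot>\<^bsub>M\<^esub> x \<oplus>\<^bsub>M\<^esub> \<delta> i (a \<odot>\<^bsub>M\<^esub> x) = a \<odot>\<^bsub>M\<^esub> \<delta> i x"
proof -
  have eq: "\<delta> i (a \<odot>\<^bsub>M\<^esub> x) = \<ominus>\<^bsub>M\<^esub> (\<partial> i a \<odot>\<^bsub>M\<^esub> x \<oplus>\<^bsub>M\<^esub> a \<odot>\<^bsub>M\<^esub> (\<ominus>\<^bsub>M\<^esub> \<delta> i x))"
    using \<delta>_smult[OF assms] assms by (metis M.minus_minus r\<delta>_closed smult_closed)
  show ?thesis
    unfolding eq using assms
    by (simp add: smult_r_minus smult_closed r\<delta>_closed der_closed M.minus_add M.r_neg2)
qed

lemma r\<delta>_comm:
  assumes "i < nder A" "j < nder A" "x \<in> carrier M"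
  shows "\<delta> i (\<delta> j x) = \<delta> j (\<delta> i x)"
proof -
  have neg: "\<delta> i (\<ominus>\<^bsub>M\<^esub> y) = \<ominus>\<^bsub>M\<^esub> \<delta> i y" if "i < nder A" "y \<in> carrier M" for i y
    using M.additive_minus(1)[OF M.abelian_group_axioms, of "\<delta> i"] that by (auto simp: r\<delta>_add r\<delta>_closed)
  show ?thesis using \<delta>_comm[OF assms] assms by (simp add: neg r\<delta>_closed)
qed

sublocale Z: derivation_module "int_diff_ring (nder A)" "with_smult M (\<lambda>k x. [k] \<cdot>\<^bsub>M\<^esub> x)" \<delta>
  by (rule derivation_module_int) (simp_all add: M.abelian_group_axioms r\<delta>_closed r\<delta>_add r\<delta>_comm)

abbreviation "r\<delta>\<delta> \<equiv> iter_ops (nder A) \<delta>"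

lemma nder_int_diff_ring [simp]: "nder (int_diff_ring n) = n"
  by (simp add: int_diff_ring_def)

lemmas r\<delta>\<delta>_facts =
  Z.\<delta>\<delta>_closed[unfolded nder_int_diff_ring with_smult_simps]
  Z.\<delta>\<delta>_add[unfolded nder_int_diff_ring with_smult_simps]
  Z.\<delta>\<delta>_Suc[unfolded nder_int_diff_ring with_smult_simps]
  Z.\<delta>\<delta>_commute[unfolded nder_int_diff_ring with_smult_simps]
  Z.\<delta>\<delta>_0[unfolded nder_int_diff_ring with_smult_simps]

lemma r\<delta>\<delta>_zero: "r\<delta>\<delta> \<mu> \<zero>\<^bsub>M\<^esub> = \<zero>\<^bsub>M\<^esub>"
  by (rule M.additive_zero[OF M.abelian_group_axioms]) (auto simp: r\<delta>\<delta>_facts)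

abbreviation "ract x P \<equiv> (\<Oplus>\<^bsub>M\<^esub>\<mu>\<in>op_supp A P. r\<delta>\<delta> \<mu> (P \<mu> \<odot>\<^bsub>M\<^esub> x))"

lemma ract_closed: "P \<in> carrier F \<Longrightarrow> x \<in> carrier M \<Longrightarrow> ract x P \<in> carrier M"
  by (auto intro!: M.finsum_closed smult_closed r\<delta>\<delta>_facts dest: op_free_moduleD(2))

lemma ract_superset:
  assumes "P \<in> carrier F" "x \<in> carrier M" "finite S" "op_supp A P \<subseteq> S"
  shows "ract x P = (\<Oplus>\<^bsub>M\<^esub>\<mu>\<in>S. r\<delta>\<delta> \<mu> (P \<mu> \<odot>\<^bsub>M\<^esub> x))"
  by (rule M.add.finprod_mono_neutral_cong_left)
    (use assms in \<open>auto simp: op_supp_def r\<delta>\<delta>_facts r\<delta>\<delta>_zero intro!: smult_closed r\<delta>\<delta>_facts(1) dest: op_free_moduleD(2)\<close>)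

lemma ract_add_op:
  assumes P: "P \<in> carrier F" and Q: "Q \<in> carrier F" and x: "x \<in> carrier M"
  shows "ract x (P \<oplus>\<^bsub>F\<^esub> Q) = ract x P \<oplus>\<^bsub>M\<^esub> ract x Q"
proof -
  interpret F: module A F by (rule module_F)
  note D = op_free_moduleD[OF P] op_free_moduleD[OF Q]
  let ?S = "op_supp A P \<union> op_supp A Q"
  have S: "finite ?S" "op_supp A (P \<oplus>\<^bsub>F\<^esub> Q) \<subseteq> ?S"
    using D by (auto simp: op_supp_def F_simps)
  have "ract x (P \<oplus>\<^bsub>F\<^esub> Q)
      = (\<Oplus>\<^bsub>M\<^esub>\<mu>\<in>?S. r\<delta>\<delta> \<mu> (P \<mu> \<odot>\<^bsub>M\<^esub> x) \<oplus>\<^bsub>M\<^esub> r\<delta>\<delta> \<mu> (Q \<mu> \<odot>\<^bsub>M\<^esub> x))"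
    unfolding ract_superset[OF F.M.a_closed[OF P Q] x S]
    by (rule M.finsum_cong')
      (use D x in \<open>auto simp: F_simps smult_l_distr r\<delta>\<delta>_facts smult_closed\<close>)
  also have "\<dots> = ract x P \<oplus>\<^bsub>M\<^esub> ract x Q"
    by (subst M.finsum_addf, (use D x in \<open>auto intro!: smult_closed r\<delta>\<delta>_facts\<close>)[2])
      (use S P Q x in \<open>simp add: ract_superset[where S = ?S]\<close>)
  finally show ?thesis .
qed

lemma ract_add:
  assumes P: "P \<in> carrier F" and x: "x \<in> carrier M" and y: "y \<in> carrier M"
  shows "ract (x \<oplus>\<^bsub>M\<^esub> y) P = ract x P \<oplus>\<^bsub>M\<^esub> ract y P"
  by (subst M.finsum_addf[symmetric])
    (use op_free_moduleD[OF P] x y in \<open>auto simp: smult_r_distr r\<delta>\<delta>_facts smult_closed intro!: M.finsum_cong'\<close>)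

lemma ract_smult:
  assumes a: "a \<in> carrier A" and P: "P \<in> carrier F" and x: "x \<in> carrier M"
  shows "ract x (a \<odot>\<^bsub>F\<^esub> P) = ract (a \<odot>\<^bsub>M\<^esub> x) P"
proof -
  interpret F: module A F by (rule module_F)
  note D = op_free_moduleD[OF P]
  have S: "finite (op_supp A P)" "op_supp A (a \<odot>\<^bsub>F\<^esub> P) \<subseteq> op_supp A P"
    using D a by (auto simp: op_supp_def F_simps)
  show ?thesis
    unfolding ract_superset[OF F.smult_closed[OF a P] x S]
    by (rule M.finsum_cong')
      (use D a x in \<open>auto simp: F_simps smult_assoc1[symmetric] m_comm r\<delta>\<delta>_facts smult_closed\<close>)
qed

text \<open>
  Multiplying \<open>P = \<Sum> a\<^sup>\<mu> d\<^sub>\<mu>\<close> by \<open>d\<^sub>i\<close> from the left gives \<open>\<Sum> (\<partial>\<^sub>i a\<^sup>\<mu>) d\<^sub>\<mu> + a\<^sup>\<mu> d\<^bsub>\<mu> + 1\<^sub>i\<^esub>\<close>, and the sign in the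
  Leibniz rule of \<open>\<delta> i\<close> is the one for which the two resulting sums combine to \<open>P\<close> acting on \<open>\<delta> i x\<close>.
\<close>

lemma ract_op_lmult:
  assumes i: "i < nder A" and P: "P \<in> carrier F" and x: "x \<in> carrier M"
  shows "ract x (op_lmult A i P) = ract (\<delta> i x) P"
proof -
  note PD = op_free_moduleD[OF P]
  let ?S = "op_supp A P" and ?s = "\<lambda>\<mu>. \<mu>(i := Suc (\<mu> i))"
  define P1 where "P1 = (\<lambda>\<mu>. \<partial> i (P \<mu>))"
  define P2 where "P2 = (\<lambda>\<mu>. if \<mu> i = 0 then \<zero> else P (\<mu>(i := \<mu> i - 1)))"
  have S1: "op_supp A P1 \<subseteq> ?S" using der_zero[OF i] by (auto simp: op_supp_def P1_def)
  have S2: "op_supp A P2 \<subseteq> ?s ` ?S"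
  proof
    fix \<mu> assume "\<mu> \<in> op_supp A P2"
    then have "\<mu> i \<noteq> 0" "\<mu>(i := \<mu> i - 1) \<in> ?S" by (auto simp: op_supp_def P2_def split: if_splits)
    then show "\<mu> \<in> ?s ` ?S" by (intro image_eqI[where x = "\<mu>(i := \<mu> i - 1)"]) auto
  qed
  have F1: "P1 \<in> carrier F"
    by (rule F_memI[OF PD(1) S1]) (use S1 PD der_closed[OF i] in \<open>auto simp: P1_def\<close>)
  have F2: "P2 \<in> carrier F"
  proof (rule F_memI[OF _ S2])
    fix \<mu> j assume "\<mu> \<in> op_supp A P2" "j \<ge> nder A"
    then show "\<mu> j = 0" using S2 PD(3)[of _ j] i by fastforce
  qed (use PD in \<open>auto simp: P2_def\<close>)
  have inj: "inj_on ?s ?S"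
    by (rule inj_on_inverseI[where g = "\<lambda>\<mu>. \<mu>(i := \<mu> i - 1)"]) simp
  have "op_lmult A i P = P1 \<oplus>\<^bsub>F\<^esub> P2" by (simp add: op_lmult_def P1_def P2_def F_simps)
  then have "ract x (op_lmult A i P) = ract x P1 \<oplus>\<^bsub>M\<^esub> ract x P2" using ract_add_op F1 F2 x by simp
  also have "ract x P1 = (\<Oplus>\<^bsub>M\<^esub>\<mu>\<in>?S. r\<delta>\<delta> \<mu> (\<partial> i (P \<mu>) \<odot>\<^bsub>M\<^esub> x))"
    using ract_superset[OF F1 x PD(1) S1] by (simp add: P1_def)
  also have "ract x P2 = (\<Oplus>\<^bsub>M\<^esub>\<mu>\<in>?s ` ?S. r\<delta>\<delta> \<mu> (P2 \<mu> \<odot>\<^bsub>M\<^esub> x))"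
    by (rule ract_superset[OF F2 x _ S2]) (use PD in simp)
  also have "\<dots> = (\<Oplus>\<^bsub>M\<^esub>\<mu>\<in>?S. r\<delta>\<delta> (?s \<mu>) (P2 (?s \<mu>) \<odot>\<^bsub>M\<^esub> x))"
    by (rule M.finsum_reindex[OF _ inj])
      (use F2 x in \<open>auto intro!: smult_closed r\<delta>\<delta>_facts dest: op_free_moduleD(2)\<close>)
  also have "\<dots> = (\<Oplus>\<^bsub>M\<^esub>\<mu>\<in>?S. r\<delta>\<delta> \<mu> (\<delta> i (P \<mu> \<odot>\<^bsub>M\<^esub> x)))"
    by (rule M.finsum_cong')
      (use PD i x in \<open>auto simp: P2_def r\<delta>\<delta>_facts intro!: smult_closed r\<delta>_closed\<close>)
  also have "(\<Oplus>\<^bsub>M\<^esub>\<mu>\<in>?S. r\<delta>\<delta> \<mu> (\<partial> i (P \<mu>) \<odot>\<^bsub>M\<^esub> x)) \<oplus>\<^bsub>M\<^esub> \<dots>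
      = (\<Oplus>\<^bsub>M\<^esub>\<mu>\<in>?S. r\<delta>\<delta> \<mu> (\<partial> i (P \<mu>) \<odot>\<^bsub>M\<^esub> x) \<oplus>\<^bsub>M\<^esub> r\<delta>\<delta> \<mu> (\<delta> i (P \<mu> \<odot>\<^bsub>M\<^esub> x)))"
    by (rule M.finsum_addf[symmetric])
      (use PD i x in \<open>auto intro!: smult_closed r\<delta>\<delta>_facts(1) r\<delta>_closed der_closed\<close>)
  also have "\<dots> = ract (\<delta> i x) P"
    by (rule M.finsum_cong')
      (use PD i x in \<open>auto simp: r\<delta>\<delta>_facts(2)[symmetric] r\<delta>_smult r\<delta>_closed smult_closed
        der_closed intro!: r\<delta>\<delta>_facts(1)\<close>)
  finally show ?thesis .
qed

lemma ract_one: "x \<in> carrier M \<Longrightarrow> ract x (op_const A \<one>) = x"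
proof -
  assume x: "x \<in> carrier M"
  have c: "op_const A \<one> \<in> carrier F" by (simp add: op_const_def op_monom_closed)
  have "ract x (op_const A \<one>) = (\<Oplus>\<^bsub>M\<^esub>\<mu>\<in>{\<lambda>_. 0}. r\<delta>\<delta> \<mu> (op_const A \<one> \<mu> \<odot>\<^bsub>M\<^esub> x))"
    by (rule ract_superset[OF c x]) (auto simp: op_supp_def op_const_def op_monom_def)
  then show ?thesis
    using x by (simp add: M.finsum_insert[of "{}"] r\<delta>\<delta>_facts op_const_def op_monom_def)
qed

text \<open>
  For a scalar or some \<open>d\<^sub>i\<close> as left factor this is the preceding rule for that generator. The general
  case follows by induction over the left factor, with \<open>R\<close> and \<open>x\<close> arbitrary.
\<close>

lemma ract_mult:
  assumes P: "P \<in> carrier D" and R: "R \<in> carrier D" and x: "x \<in> carrier M"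
  shows "ract x (P \<otimes>\<^bsub>D\<^esub> R) = ract (ract x P) R"
proof -
  interpret D: ring D by (rule ring_diff_ops)
  interpret F: module A F by (rule module_F)
  have ract_const: "ract x (op_const A a \<otimes>\<^bsub>D\<^esub> R) = ract (a \<odot>\<^bsub>M\<^esub> x) R"
    if "a \<in> carrier A" "R \<in> carrier D" "x \<in> carrier M" for a R x
    using ract_smult[of a R x] that by (simp add: op_const_times F_simps diff_ops_simps(1))
  have ract_deriv: "ract x (op_d A i \<otimes>\<^bsub>D\<^esub> R) = ract (\<delta> i x) R"
    if "i < nder A" "R \<in> carrier D" "x \<in> carrier M" for i R x
    using ract_op_lmult[of i R x] that by (simp add: op_d_times diff_ops_simps(1))
  show ?thesis
    using P R x
  proof (induction P arbitrary: R x rule: diff_ops_induct)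
    case (const a)
    have "ract x (op_const A a) = a \<odot>\<^bsub>M\<^esub> x"
      using ract_const[of a "\<one>\<^bsub>D\<^esub>" x] const
      by (simp add: ract_one[unfolded op_const_one] smult_closed)
    then show ?case
      using ract_const[of a R x] const by simp
  next
    case (deriv i)
    have "ract x (op_d A i) = \<delta> i x"
      using ract_deriv[of i "\<one>\<^bsub>D\<^esub>" x] deriv
      by (simp add: ract_one[unfolded op_const_one] r\<delta>_closed)
    then show ?case
      using ract_deriv[of i R x] deriv by simp
  next
    case (add P Q)
    note c = add.hyps(1,2) add.prems D.m_closed[OF add.hyps(1) add.prems(1)]
      D.m_closed[OF add.hyps(2) add.prems(1)]
    show ?case
      using c ract_add_op[of "P \<otimes>\<^bsub>D\<^esub> R" "Q \<otimes>\<^bsub>D\<^esub> R" x] ract_add_op[of P Q x]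
        ract_add[of R "ract x P" "ract x Q"] ract_closed[of P x] ract_closed[of Q x]
      unfolding D.l_distr[OF c(1,2,3)] unfolding diff_ops_simps(1,3)
      by (simp add: add.IH[unfolded diff_ops_simps(1)])
  next
    case (mult P Q)
    then show ?case
      using ract_closed[of P x] by (simp add: D.m_assoc diff_ops_simps(1)[symmetric])
  qed
qed

theorem right_module_right_op_module: "right_module D (right_op_module A M \<delta>)"
proof -
  interpret D: ring D by (rule ring_diff_ops)
  have "abelian_group (right_op_module A M \<delta>)"
    by (rule abelian_group_cong[OF M.abelian_group_axioms]) (simp_all add: right_op_module_def)
  then show ?thesis
  proof (intro right_module.intro right_module_axioms.intro D.ring_axioms)
    fix P Q x assume "P \<in> carrier D" "Q \<in> carrier D" "x \<in> carrier (right_op_module A M \<delta>)"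
    then show "x \<boxdot>\<^bsub>right_op_module A M \<delta>\<^esub> (P \<otimes>\<^bsub>D\<^esub> Q)
        = x \<boxdot>\<^bsub>right_op_module A M \<delta>\<^esub> P \<boxdot>\<^bsub>right_op_module A M \<delta>\<^esub> Q"
      using ract_mult by (simp add: right_op_module_def)
  qed (simp_all add: right_op_module_def diff_ops_simps ract_closed ract_add ract_add_op ract_one)
qed

lemma right_op_module_generators:
  assumes "x \<in> carrier M"
  shows "a \<in> carrier A \<Longrightarrow> x \<boxdot>\<^bsub>right_op_module A M \<delta>\<^esub> op_const A a = a \<odot>\<^bsub>M\<^esub> x"
    and "i < nder A \<Longrightarrow> x \<boxdot>\<^bsub>right_op_module A M \<delta>\<^esub> op_d A i = \<delta> i x"
proof -
  interpret D: ring D by (rule ring_diff_ops)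
  have one: "op_const A \<one> \<in> carrier F" using op_const_closed[of \<one>] by (simp add: diff_ops_simps)
  show "x \<boxdot>\<^bsub>right_op_module A M \<delta>\<^esub> op_const A a = a \<odot>\<^bsub>M\<^esub> x" if "a \<in> carrier A"
    using ract_smult[OF that one assms] op_const_times[of a "op_const A \<one>"] D.r_one[of "op_const A a"]
      that assms
    by (simp add: right_op_module_def F_simps ract_one[unfolded op_const_one] smult_closed op_const_one)
  show "x \<boxdot>\<^bsub>right_op_module A M \<delta>\<^esub> op_d A i = \<delta> i x" if "i < nder A"
    using ract_op_lmult[OF that one assms] op_d_times[of i "op_const A \<one>"] D.r_one[of "op_d A i"]
      that assms
    by (simp add: right_op_module_def ract_one[unfolded op_const_one] r\<delta>_closed op_const_one)
qed

end


section \<open>The tensor product over a commutative ring\<close>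

locale module_pair = M: module R M + N: module R N
  for R :: "('r, 'e) ring_scheme" (structure)
    and M :: "('r, 'm, 'f) module_scheme" and N :: "('r, 'n, 'g) module_scheme"
begin

abbreviation "S \<equiv> carrier M \<times> carrier N"
abbreviation "FG \<equiv> free_Abelian_group S"
abbreviation "K \<equiv> tensor_kernel R M N"
abbreviation "T \<equiv> tensor_group R M N"
abbreviation "pure \<equiv> pure_tensor R M N"

definition balanced :: "('h, 'k) ring_scheme \<Rightarrow> ('m \<Rightarrow> 'n \<Rightarrow> 'h) \<Rightarrow> bool"
  where "balanced H g \<longleftrightarrow>
    (\<forall>x\<in>carrier M. \<forall>y\<in>carrier N. g x y \<in> carrier H) \<and>
    (\<forall>x\<in>carrier M. \<forall>x'\<in>carrier M. \<forall>y\<in>carrier N. g (x \<oplus>\<^bsub>M\<^esub> x') y = g x y \<oplus>\<^bsub>H\<^esub> g x' y) \<and>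
    (\<forall>x\<in>carrier M. \<forall>y\<in>carrier N. \<forall>y'\<in>carrier N. g x (y \<oplus>\<^bsub>N\<^esub> y') = g x y \<oplus>\<^bsub>H\<^esub> g x y') \<and>
    (\<forall>a\<in>carrier R. \<forall>x\<in>carrier M. \<forall>y\<in>carrier N. g (a \<odot>\<^bsub>M\<^esub> x) y = g x (a \<odot>\<^bsub>N\<^esub> y))"

interpretation FG: comm_group FG by (rule abelian_free_Abelian_group)

lemma relators_closed: "tensor_relators R M N \<subseteq> carrier FG"
proof -
  have diff: "a - b \<in> carrier FG" if "a \<in> carrier FG" "b \<in> carrier FG" for a b
    using that keys_diff[of a b] by auto
  show ?thesis
    unfolding tensor_relators_def
    by (auto intro!: diff simp del: carrier_free_Abelian_group_iff)
qed

lemma kernel_subgroup: "subgroup K FG"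
  unfolding tensor_kernel_def by (rule FG.generate_is_subgroup[OF relators_closed])

lemma kernel_normal: "K \<lhd> FG"
  using FG.normal_iff_subgroup kernel_subgroup by blast

lemma tensor_carrier: "carrier T = (\<lambda>c. K #>\<^bsub>FG\<^esub> c) ` carrier FG"
  by (simp add: tensor_group_def Let_def carrier_FactGroup)

lemma tensor_add_coset:
  "a \<in> carrier FG \<Longrightarrow> b \<in> carrier FG \<Longrightarrow> (K #>\<^bsub>FG\<^esub> a) \<oplus>\<^bsub>T\<^esub> (K #>\<^bsub>FG\<^esub> b) = K #>\<^bsub>FG\<^esub> (a + b)"
  using normal.rcos_sum[OF kernel_normal, of a b]
  by (simp add: tensor_group_def Let_def del: carrier_free_Abelian_group_iff)

lemma tensor_abelian_group: "abelian_group T"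
proof -
  interpret Q: comm_group "FG Mod K" by (rule FG.abelian_FactGroup[OF kernel_subgroup])
  have eq: "carrier T = carrier (FG Mod K)" "add T = mult (FG Mod K)" "\<zero>\<^bsub>T\<^esub> = \<one>\<^bsub>FG Mod K\<^esub>"
    by (simp_all add: tensor_group_def Let_def)
  show ?thesis
    by (rule abelian_groupI; unfold eq)
      (rule Q.m_closed Q.one_closed Q.m_assoc Q.m_comm Q.l_one Q.l_inv_ex; assumption)+
qed

sublocale T: abelian_group T by (rule tensor_abelian_group)

lemma coset_eqI:
  assumes "a \<in> carrier FG" "b \<in> carrier FG" "a - b \<in> K"
  shows "K #>\<^bsub>FG\<^esub> a = K #>\<^bsub>FG\<^esub> b"
proof -
  have "a = (a - b) \<otimes>\<^bsub>FG\<^esub> b" by simp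
  then have "a \<in> K #>\<^bsub>FG\<^esub> b" using assms(3) unfolding r_coset_def by blast
  then show ?thesis using FG.repr_independence[OF _ assms(2) kernel_subgroup] by blast
qed

lemma pure_closed [simp, intro]: "x \<in> carrier M \<Longrightarrow> y \<in> carrier N \<Longrightarrow> pure x y \<in> carrier T"
  unfolding tensor_carrier pure_tensor_def by (intro image_eqI[OF refl]) simp

lemma relator_in_kernel: "r \<in> tensor_relators R M N \<Longrightarrow> r \<in> K"
  unfolding tensor_kernel_def by (rule generate.incl)

lemma balanced_pure: "balanced T pure"
  unfolding balanced_def
proof (intro conjI ballI)
  have plus: "a + b \<in> carrier FG" if "a \<in> carrier FG" "b \<in> carrier FG" for a b
    using FG.m_closed[OF that] by (simp del: carrier_free_Abelian_group_iff)
  fix x y assume x: "x \<in> carrier M" and y: "y \<in> carrier N"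
  have of: "frag_of p \<in> carrier FG" if "p \<in> S" for p
    using that by simp
  show "pure (x \<oplus>\<^bsub>M\<^esub> x') y = pure x y \<oplus>\<^bsub>T\<^esub> pure x' y" if x': "x' \<in> carrier M" for x'
  proof -
    have "frag_of (x \<oplus>\<^bsub>M\<^esub> x', y) - (frag_of (x, y) + frag_of (x', y)) \<in> K"
      by (rule relator_in_kernel) (use x x' y in \<open>auto simp: tensor_relators_def diff_diff_eq\<close>)
    then have "K #>\<^bsub>FG\<^esub> frag_of (x \<oplus>\<^bsub>M\<^esub> x', y) = K #>\<^bsub>FG\<^esub> (frag_of (x, y) + frag_of (x', y))"
      by (rule coset_eqI[rotated 2]) (auto intro!: of plus simp: x x' y simp del: carrier_free_Abelian_group_iff)
    then show ?thesis
      unfolding pure_tensor_def using x x' y by (subst tensor_add_coset) auto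
  qed
  show "pure x (y \<oplus>\<^bsub>N\<^esub> y') = pure x y \<oplus>\<^bsub>T\<^esub> pure x y'" if y': "y' \<in> carrier N" for y'
  proof -
    have "frag_of (x, y \<oplus>\<^bsub>N\<^esub> y') - (frag_of (x, y) + frag_of (x, y')) \<in> K"
      by (rule relator_in_kernel) (use x y y' in \<open>auto simp: tensor_relators_def diff_diff_eq\<close>)
    then have "K #>\<^bsub>FG\<^esub> frag_of (x, y \<oplus>\<^bsub>N\<^esub> y') = K #>\<^bsub>FG\<^esub> (frag_of (x, y) + frag_of (x, y'))"
      by (rule coset_eqI[rotated 2]) (auto intro!: of plus simp: x y' y simp del: carrier_free_Abelian_group_iff)
    then show ?thesis
      unfolding pure_tensor_def using x y' y by (subst tensor_add_coset) auto
  qed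
  show "pure (a \<odot>\<^bsub>M\<^esub> x) y = pure x (a \<odot>\<^bsub>N\<^esub> y)" if a: "a \<in> carrier R" for a
    unfolding pure_tensor_def
    by (rule coset_eqI) (use x y a in \<open>auto intro!: of relator_in_kernel simp: tensor_relators_def\<close>)
qed (rule pure_closed)

lemmas pure_add_left = balanced_pure[unfolded balanced_def, THEN conjunct2, THEN conjunct1, rule_format]
lemmas pure_add_right =
  balanced_pure[unfolded balanced_def, THEN conjunct2, THEN conjunct2, THEN conjunct1, rule_format]
lemmas pure_smult =
  balanced_pure[unfolded balanced_def, THEN conjunct2, THEN conjunct2, THEN conjunct2, rule_format]

text \<open>
  The free abelian group is generated by the pairs. Hence equations between additive maps on the
  tensor product, among them all module axioms and commutation rules below, reduce to pure tensors.
\<close>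

lemma tensor_ext:
  assumes H: "abelian_group H"
    and f: "f \<in> hom (add_monoid T) (add_monoid H)" and g: "g \<in> hom (add_monoid T) (add_monoid H)"
    and eq: "\<And>x y. x \<in> carrier M \<Longrightarrow> y \<in> carrier N \<Longrightarrow> f (pure x y) = g (pure x y)"
    and X: "X \<in> carrier T"
  shows "f X = g X"
proof -
  interpret H: abelian_group H by fact
  have f': "f \<in> carrier T \<rightarrow> carrier H" "\<And>x y. \<lbrakk>x \<in> carrier T; y \<in> carrier T\<rbrakk> \<Longrightarrow> f (x \<oplus>\<^bsub>T\<^esub> y) = f x \<oplus>\<^bsub>H\<^esub> f y"
    using f by (auto simp: hom_def)
  have g': "g \<in> carrier T \<rightarrow> carrier H" "\<And>x y. \<lbrakk>x \<in> carrier T; y \<in> carrier T\<rbrakk> \<Longrightarrow> g (x \<oplus>\<^bsub>T\<^esub> y) = g x \<oplus>\<^bsub>H\<^esub> g y"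
    using g by (auto simp: hom_def)
  obtain c where c: "Poly_Mapping.keys c \<subseteq> S" "X = K #>\<^bsub>FG\<^esub> c" using X by (auto simp: tensor_carrier)
  have "Poly_Mapping.keys c \<subseteq> S \<and> f (K #>\<^bsub>FG\<^esub> c) = g (K #>\<^bsub>FG\<^esub> c)"
    using c(1)
  proof (induction c rule: frag_induction)
    case zero
    have "K #>\<^bsub>FG\<^esub> 0 = \<zero>\<^bsub>T\<^esub>"
      using FG.coset_mult_one[OF subgroup.subset[OF kernel_subgroup]]
      by (simp add: tensor_group_def Let_def)
    then show ?case
      using T.additive_zero[OF H f'] T.additive_zero[OF H g'] by simp
  next
    case (one p)
    then show ?case using eq[of "fst p" "snd p"] by (auto simp: pure_tensor_def)
  next
    case (diff a b)
    let ?q = "\<lambda>c. K #>\<^bsub>FG\<^esub> c"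
    have ab: "a \<in> carrier FG" "b \<in> carrier FG" "a - b \<in> carrier FG"
      using diff keys_diff[of a b] by auto
    then have mem: "?q a \<in> carrier T" "?q b \<in> carrier T" "?q (a - b) \<in> carrier T"
      unfolding tensor_carrier by blast+
    have "?q (a - b) \<oplus>\<^bsub>T\<^esub> ?q b = ?q a" using tensor_add_coset[OF ab(3,2)] by simp
    then have "f (?q (a - b)) \<oplus>\<^bsub>H\<^esub> f (?q b) = f (?q a)" "g (?q (a - b)) \<oplus>\<^bsub>H\<^esub> g (?q b) = g (?q a)"
      using f'(2)[OF mem(3,2)] g'(2)[OF mem(3,2)] by simp_all
    moreover have "f (?q (a - b)) \<in> carrier H" "g (?q (a - b)) \<in> carrier H" "g (?q b) \<in> carrier H"
      using f'(1) g'(1) mem by auto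
    ultimately show ?case
      using diff ab H.add.right_cancel[of "g (?q b)" "f (?q (a - b))" "g (?q (a - b))"] by simp
  qed
  then show ?thesis by (simp add: c(2))
qed

text \<open>
  The \<open>\<int>\<close>-linear extension \<open>E\<close> of a balanced map vanishes on the three kinds of relators, hence on the
  subgroup generated by them. It is therefore constant on each coset, and the element picked by the
  definition of the lift is this constant.
\<close>

lemma tensor_lift_universal:
  assumes H: "abelian_group H" and g: "balanced H g"
  shows "tensor_lift H g \<in> hom (add_monoid T) (add_monoid H)"
    and "x \<in> carrier M \<Longrightarrow> y \<in> carrier N \<Longrightarrow> tensor_lift H g (pure x y) = g x y"
proof -
  interpret H: abelian_group H by fact
  define E where "E c = (\<Oplus>\<^bsub>H\<^esub>p\<in>Poly_Mapping.keys c. [Poly_Mapping.lookup c p] \<cdot>\<^bsub>H\<^esub> g (fst p) (snd p))" for c :: "'m \<times> 'n \<Rightarrow>\<^sub>0 int"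
  have gc: "g (fst p) (snd p) \<in> carrier H" if "p \<in> S" for p
    using g that by (auto simp: balanced_def)
  have pow_zero: "[(0 :: int)] \<cdot>\<^bsub>H\<^esub> h = \<zero>\<^bsub>H\<^esub>" for h by (simp add: add_pow_def)
  have superset: "E c = (\<Oplus>\<^bsub>H\<^esub>p\<in>Z. [Poly_Mapping.lookup c p] \<cdot>\<^bsub>H\<^esub> g (fst p) (snd p))"
    if "Poly_Mapping.keys c \<subseteq> Z" "finite Z" "Z \<subseteq> S" for c Z
    unfolding E_def
    by (rule H.add.finprod_mono_neutral_cong_left)
      (use that gc in \<open>auto simp: in_keys_iff pow_zero subset_iff\<close>)
  have E_closed: "E c \<in> carrier H" if "c \<in> carrier FG" for c
    unfolding E_def using that gc by (intro H.finsum_closed) auto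
  have E_add: "E (b + c) = E b \<oplus>\<^bsub>H\<^esub> E c" if "b \<in> carrier FG" "c \<in> carrier FG" for b c
  proof -
    let ?Z = "Poly_Mapping.keys b \<union> Poly_Mapping.keys c"
    have Z: "finite ?Z" "?Z \<subseteq> S" "Poly_Mapping.keys (b + c) \<subseteq> ?Z" using that keys_add[of b c] by auto
    have "E (b + c) = (\<Oplus>\<^bsub>H\<^esub>p\<in>?Z. [Poly_Mapping.lookup b p] \<cdot>\<^bsub>H\<^esub> g (fst p) (snd p)
        \<oplus>\<^bsub>H\<^esub> [Poly_Mapping.lookup c p] \<cdot>\<^bsub>H\<^esub> g (fst p) (snd p))"
      unfolding superset[OF Z(3,1,2)]
      by (rule H.finsum_cong') (use Z gc in \<open>auto simp: lookup_add H.add.int_pow_mult subset_iff\<close>)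
    also have "\<dots> = E b \<oplus>\<^bsub>H\<^esub> E c"
      by (subst H.finsum_addf, (use Z gc in \<open>auto simp: subset_iff\<close>)[2])
        (use Z in \<open>simp add: superset[OF _ Z(1,2)]\<close>)
    finally show ?thesis .
  qed
  have E_diff: "E (b - c) = E b \<ominus>\<^bsub>H\<^esub> E c" if "b \<in> carrier FG" "c \<in> carrier FG" for b c
  proof -
    have bc: "b - c \<in> carrier FG" using that keys_diff[of b c] by auto
    have "E (b - c) \<oplus>\<^bsub>H\<^esub> E c = E b" using E_add[OF bc that(2)] by simp
    then show ?thesis
      using E_closed[OF bc] E_closed[OF that(1)] E_closed[OF that(2)]
      by (metis H.add.inv_solve_right' H.minus_eq)
  qed
  have E_of: "E (frag_of p) = g (fst p) (snd p)" if "p \<in> S" for p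
    unfolding E_def using gc[OF that] by (simp add: H.finsum_insert[of "{}"] H.add.int_pow_1)
  have diff_closed: "b - c \<in> carrier FG" if "b \<in> carrier FG" "c \<in> carrier FG" for b c
    using that keys_diff[of b c] by auto
  have of: "frag_of p \<in> carrier FG" if "p \<in> S" for p
    using that by simp
  have self: "h \<ominus>\<^bsub>H\<^esub> h = \<zero>\<^bsub>H\<^esub>" if "h \<in> carrier H" for h using that by (simp add: H.minus_eq H.r_neg)
  have cancel: "u \<oplus>\<^bsub>H\<^esub> v \<ominus>\<^bsub>H\<^esub> u \<ominus>\<^bsub>H\<^esub> v = \<zero>\<^bsub>H\<^esub>" if "u \<in> carrier H" "v \<in> carrier H" for u v
  proof -
    have "u \<oplus>\<^bsub>H\<^esub> v \<ominus>\<^bsub>H\<^esub> u \<ominus>\<^bsub>H\<^esub> v = (u \<oplus>\<^bsub>H\<^esub> v) \<oplus>\<^bsub>H\<^esub> \<ominus>\<^bsub>H\<^esub> (u \<oplus>\<^bsub>H\<^esub> v)"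
      using that by (simp add: H.minus_eq H.minus_add H.a_assoc)
    then show ?thesis using that by (simp add: H.r_neg)
  qed
  have rel: "E r = \<zero>\<^bsub>H\<^esub>" if "r \<in> tensor_relators R M N" for r
    using that unfolding tensor_relators_def
  proof (elim UnE CollectE exE conjE)
    fix x x' y
    assume h: "r = frag_of (x \<oplus>\<^bsub>M\<^esub> x', y) - frag_of (x, y) - frag_of (x', y)"
      "x \<in> carrier M" "x' \<in> carrier M" "y \<in> carrier N"
    then have "E r = g x y \<oplus>\<^bsub>H\<^esub> g x' y \<ominus>\<^bsub>H\<^esub> g x y \<ominus>\<^bsub>H\<^esub> g x' y"
      using g by (simp add: E_diff of diff_closed E_of balanced_def del: carrier_free_Abelian_group_iff)
    then show ?thesis using cancel gc[of "(x, y)"] gc[of "(x', y)"] h by simp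
  next
    fix x y y'
    assume h: "r = frag_of (x, y \<oplus>\<^bsub>N\<^esub> y') - frag_of (x, y) - frag_of (x, y')"
      "x \<in> carrier M" "y \<in> carrier N" "y' \<in> carrier N"
    then have "E r = g x y \<oplus>\<^bsub>H\<^esub> g x y' \<ominus>\<^bsub>H\<^esub> g x y \<ominus>\<^bsub>H\<^esub> g x y'"
      using g by (simp add: E_diff of diff_closed E_of balanced_def del: carrier_free_Abelian_group_iff)
    then show ?thesis using cancel gc[of "(x, y)"] gc[of "(x, y')"] h by simp
  next
    fix a x y
    assume h: "r = frag_of (a \<odot>\<^bsub>M\<^esub> x, y) - frag_of (x, a \<odot>\<^bsub>N\<^esub> y)"
      "a \<in> carrier R" "x \<in> carrier M" "y \<in> carrier N"
    then have "E r = g x (a \<odot>\<^bsub>N\<^esub> y) \<ominus>\<^bsub>H\<^esub> g x (a \<odot>\<^bsub>N\<^esub> y)"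
      using g by (simp add: E_diff of diff_closed E_of balanced_def del: carrier_free_Abelian_group_iff)
    then show ?thesis using self gc[of "(x, a \<odot>\<^bsub>N\<^esub> y)"] h by simp
  qed
  have kernel: "k \<in> carrier FG \<and> E k = \<zero>\<^bsub>H\<^esub>" if "k \<in> K" for k
    using that unfolding tensor_kernel_def
  proof (induction k rule: generate.induct)
    case one
    then show ?case by (simp add: E_def)
  next
    case (incl r)
    then show ?case using subsetD[OF relators_closed incl] rel by simp
  next
    case (inv r)
    have r: "r \<in> carrier FG" "0 \<in> carrier FG" using subsetD[OF relators_closed inv] by simp_all
    then have "E (- r) = \<zero>\<^bsub>H\<^esub>" using E_diff[OF r(2,1)] rel[OF inv] by (simp add: E_def H.minus_eq)
    then show ?case using r by simp
  next
    case (eng h k)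
    then show ?case using E_add[of h k] FG.m_closed[of h k] by (simp del: carrier_free_Abelian_group_iff)
  qed
  have lift: "tensor_lift H g (K #>\<^bsub>FG\<^esub> c) = E c" if c: "c \<in> carrier FG" for c
  proof -
    have "E ` (K #>\<^bsub>FG\<^esub> c) = {E c}"
    proof
      show "E ` (K #>\<^bsub>FG\<^esub> c) \<subseteq> {E c}"
      proof
        fix h assume "h \<in> E ` (K #>\<^bsub>FG\<^esub> c)"
        then obtain k where "k \<in> K" "h = E (k + c)" by (auto simp: r_coset_def)
        then show "h \<in> {E c}" using kernel[of k] E_add[OF _ c, of k] E_closed[OF c] by simp
      qed
      show "{E c} \<subseteq> E ` (K #>\<^bsub>FG\<^esub> c)"
        using FG.rcos_self[OF c kernel_subgroup] by blast
    qed
    then show ?thesis unfolding tensor_lift_def E_def[abs_def] by simp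
  qed
  show "tensor_lift H g (pure x y) = g x y" if "x \<in> carrier M" "y \<in> carrier N"
    unfolding pure_tensor_def using that lift[of "frag_of (x, y)"] E_of[of "(x, y)"] by simp
  show "tensor_lift H g \<in> hom (add_monoid T) (add_monoid H)"
  proof (rule homI)
    fix X assume "X \<in> carrier (add_monoid T)"
    then obtain c where c: "c \<in> carrier FG" "X = K #>\<^bsub>FG\<^esub> c"
      unfolding partial_object.simps tensor_carrier by blast
    then show "tensor_lift H g X \<in> carrier (add_monoid H)"
      using E_closed[OF c(1)] lift[OF c(1)] by simp
  next
    fix X Y assume "X \<in> carrier (add_monoid T)" "Y \<in> carrier (add_monoid T)"
    then obtain b c where h: "b \<in> carrier FG" "c \<in> carrier FG" "X = K #>\<^bsub>FG\<^esub> b" "Y = K #>\<^bsub>FG\<^esub> c"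
      unfolding partial_object.simps tensor_carrier by blast
    then show "tensor_lift H g (X \<otimes>\<^bsub>add_monoid T\<^esub> Y) = tensor_lift H g X \<otimes>\<^bsub>add_monoid H\<^esub> tensor_lift H g Y"
      using FG.m_closed[OF h(1,2)] lift[OF h(1)] lift[OF h(2)] lift[of "b + c"] E_add[OF h(1,2)]
      by (simp only: monoid.simps h(3,4) tensor_add_coset[OF h(1,2)] mult_free_Abelian_group)
  qed
qed

abbreviation "TM \<equiv> tensor_module R M N"

lemma tensor_module_simps [simp]:
  "carrier TM = carrier T" "\<zero>\<^bsub>TM\<^esub> = \<zero>\<^bsub>T\<^esub>" "add TM = add T" "a_inv TM = a_inv T" "a_minus TM = a_minus T"
  by (simp_all add: tensor_module_def)

lemma balanced_smult: "a \<in> carrier R \<Longrightarrow> balanced T (\<lambda>x y. pure (a \<odot>\<^bsub>M\<^esub> x) y)"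
  unfolding balanced_def
  by (auto simp: M.smult_r_distr pure_add_left pure_add_right pure_smult[symmetric]
      M.smult_assoc1[symmetric] M.R.m_comm)

lemma tensor_smult:
  assumes "a \<in> carrier R"
  shows "(\<lambda>X. a \<odot>\<^bsub>TM\<^esub> X) \<in> hom (add_monoid T) (add_monoid T)"
    and "x \<in> carrier M \<Longrightarrow> y \<in> carrier N \<Longrightarrow> a \<odot>\<^bsub>TM\<^esub> pure x y = pure (a \<odot>\<^bsub>M\<^esub> x) y"
  using tensor_lift_universal[OF tensor_abelian_group balanced_smult[OF assms]]
  by (simp_all add: tensor_module_def)

lemma tensor_smult_closed: "a \<in> carrier R \<Longrightarrow> X \<in> carrier T \<Longrightarrow> a \<odot>\<^bsub>TM\<^esub> X \<in> carrier T"
  and tensor_smult_add: "a \<in> carrier R \<Longrightarrow> X \<in> carrier T \<Longrightarrow> Y \<in> carrier T \<Longrightarrow>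
    a \<odot>\<^bsub>TM\<^esub> (X \<oplus>\<^bsub>T\<^esub> Y) = a \<odot>\<^bsub>TM\<^esub> X \<oplus>\<^bsub>T\<^esub> a \<odot>\<^bsub>TM\<^esub> Y"
  using tensor_smult(1)[of a] by (auto simp: hom_def)

lemma tensor_is_module: "module R TM"
proof (rule moduleI[OF M.R.is_cring abelian_group_cong[OF tensor_abelian_group]])
  note ext = tensor_ext[OF tensor_abelian_group]
  fix a b X assume ab: "a \<in> carrier R" "b \<in> carrier R" and X: "X \<in> carrier TM"
  show "(a \<oplus> b) \<odot>\<^bsub>TM\<^esub> X = a \<odot>\<^bsub>TM\<^esub> X \<oplus>\<^bsub>TM\<^esub> b \<odot>\<^bsub>TM\<^esub> X"
    unfolding tensor_module_simps
    by (rule ext[where X = X and f = "\<lambda>X. (a \<oplus> b) \<odot>\<^bsub>TM\<^esub> X"])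
      (use ab X in \<open>auto simp: hom_def tensor_smult_closed tensor_smult_add tensor_smult(2)
        M.smult_l_distr pure_add_left T.a_ac\<close>)
  show "(a \<otimes> b) \<odot>\<^bsub>TM\<^esub> X = a \<odot>\<^bsub>TM\<^esub> (b \<odot>\<^bsub>TM\<^esub> X)"
    by (rule ext[where X = X and f = "\<lambda>X. (a \<otimes> b) \<odot>\<^bsub>TM\<^esub> X"])
      (use ab X in \<open>auto simp: hom_def tensor_smult_closed tensor_smult_add tensor_smult(2)
        M.smult_assoc1\<close>)
next
  fix X assume X: "X \<in> carrier TM"
  show "\<one> \<odot>\<^bsub>TM\<^esub> X = X"
    by (rule tensor_ext[OF tensor_abelian_group, where X = X and f = "\<lambda>X. \<one> \<odot>\<^bsub>TM\<^esub> X"])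
      (use X in \<open>auto simp: hom_def tensor_smult_closed tensor_smult_add tensor_smult(2)\<close>)
qed (auto simp: tensor_smult_closed tensor_smult_add)

end


section \<open>Derivations on homomorphisms and on tensor products\<close>

lemma (in abelian_group) cancel_middle:
  "u \<in> carrier G \<Longrightarrow> v \<in> carrier G \<Longrightarrow> u \<oplus> (v \<oplus> \<ominus> u) = v"
  by (simp add: a_lcomm[of u v] r_neg)

lemma (in abelian_group) a_inv_zero: "\<ominus> \<zero> = \<zero>"
  by (rule minus_equality) simp_all

lemma mod_homD:
  assumes "f \<in> mod_hom R M N"
  shows "x \<in> carrier M \<Longrightarrow> f x \<in> carrier N"
    and "x \<in> carrier M \<Longrightarrow> y \<in> carrier M \<Longrightarrow> f (x \<oplus>\<^bsub>M\<^esub> y) = f x \<oplus>\<^bsub>N\<^esub> f y"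
    and "a \<in> carrier R \<Longrightarrow> x \<in> carrier M \<Longrightarrow> f (a \<odot>\<^bsub>M\<^esub> x) = a \<odot>\<^bsub>N\<^esub> f x"
    and "f \<in> extensional (carrier M)"
  using assms by (auto simp: mod_hom_def PiE_def)

locale derivation_pair = M: derivation_module A M \<delta> + N: derivation_module A N \<epsilon>
  for A :: "'a diff_ring" (structure)
    and M :: "('a, 'm) module" and \<delta> and N :: "('a, 'n) module" and \<epsilon>
begin

sublocale module_pair A M N
  by (intro module_pair.intro M.module_axioms N.module_axioms)

abbreviation "HM \<equiv> hom_module A M N"

definition "hom_der i f = (\<lambda>x\<in>carrier M. \<epsilon> i (f x) \<ominus>\<^bsub>N\<^esub> f (\<delta> i x))"

lemma hom_module_simps [simp]:
  "carrier HM = mod_hom A M N" "\<zero>\<^bsub>HM\<^esub> = (\<lambda>x\<in>carrier M. \<zero>\<^bsub>N\<^esub>)"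
  "f \<oplus>\<^bsub>HM\<^esub> g = (\<lambda>x\<in>carrier M. f x \<oplus>\<^bsub>N\<^esub> g x)"
  "a \<odot>\<^bsub>HM\<^esub> f = (\<lambda>x\<in>carrier M. a \<odot>\<^bsub>N\<^esub> f x)"
  by (simp_all add: hom_module_def hom_group_def)

lemmas hom_memD = mod_homD[where R = A and M = M and N = N]

lemma mod_homI:
  assumes "\<And>x. x \<in> carrier M \<Longrightarrow> f x \<in> carrier N"
    and "\<And>x y. x \<in> carrier M \<Longrightarrow> y \<in> carrier M \<Longrightarrow> f (x \<oplus>\<^bsub>M\<^esub> y) = f x \<oplus>\<^bsub>N\<^esub> f y"
    and "\<And>a x. a \<in> carrier A \<Longrightarrow> x \<in> carrier M \<Longrightarrow> f (a \<odot>\<^bsub>M\<^esub> x) = a \<odot>\<^bsub>N\<^esub> f x"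
  shows "(\<lambda>x\<in>carrier M. f x) \<in> mod_hom A M N"
  using assms by (auto simp: mod_hom_def M.smult_closed)

lemma mod_hom_eqI:
  "\<lbrakk>f \<in> mod_hom A M N; g \<in> mod_hom A M N; \<And>x. x \<in> carrier M \<Longrightarrow> f x = g x\<rbrakk> \<Longrightarrow> f = g"
  by (auto dest: hom_memD(4) intro: extensionalityI)

lemma hom_is_module: "module A HM"
proof (rule moduleI)
  note D = hom_memD(1)
  have add: "f \<oplus>\<^bsub>HM\<^esub> g \<in> mod_hom A M N" if f: "f \<in> mod_hom A M N" and g: "g \<in> mod_hom A M N" for f g
    unfolding hom_module_simps
    by (rule mod_homI)
      (simp_all add: hom_memD[OF f] hom_memD[OF g] N.M.a_ac N.smult_r_distr)
  have neg: "(\<lambda>x\<in>carrier M. \<ominus>\<^bsub>N\<^esub> f x) \<in> mod_hom A M N" if f: "f \<in> mod_hom A M N" for f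
    by (rule mod_homI) (simp_all add: hom_memD[OF f] N.M.minus_add N.smult_r_minus)
  have smult: "a \<odot>\<^bsub>HM\<^esub> f \<in> mod_hom A M N" if f: "f \<in> mod_hom A M N" and a: "a \<in> carrier A" for a f
    unfolding hom_module_simps
    by (rule mod_homI)
      (simp_all add: hom_memD[OF f] a N.smult_r_distr N.smult_assoc1[symmetric] M.m_comm)
  show "cring A" by (rule M.is_cring)
  show "abelian_group HM"
  proof (rule abelian_groupI)
    show "\<zero>\<^bsub>HM\<^esub> \<in> carrier HM"
      unfolding hom_module_simps by (rule mod_homI) simp_all
    fix f assume "f \<in> carrier HM"
    then have f: "f \<in> mod_hom A M N" by simp
    show "\<zero>\<^bsub>HM\<^esub> \<oplus>\<^bsub>HM\<^esub> f = f"
      using hom_memD(4)[OF f] by (auto simp: D[OF f] extensional_def fun_eq_iff restrict_def)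
    show "\<exists>g\<in>carrier HM. g \<oplus>\<^bsub>HM\<^esub> f = \<zero>\<^bsub>HM\<^esub>"
      using neg[OF f]
      by (intro bexI[of _ "\<lambda>x\<in>carrier M. \<ominus>\<^bsub>N\<^esub> f x"])
        (auto simp: D[OF f] N.M.l_neg restrict_def fun_eq_iff)
    fix g assume "g \<in> carrier HM"
    then have g: "g \<in> mod_hom A M N" by simp
    show "f \<oplus>\<^bsub>HM\<^esub> g \<in> carrier HM" using add[OF f g] by simp
    show "f \<oplus>\<^bsub>HM\<^esub> g = g \<oplus>\<^bsub>HM\<^esub> f"
      by (auto simp: restrict_def fun_eq_iff D[OF f] D[OF g] N.M.a_ac)
    fix h assume "h \<in> carrier HM"
    then have h: "h \<in> mod_hom A M N" by simp
    show "f \<oplus>\<^bsub>HM\<^esub> g \<oplus>\<^bsub>HM\<^esub> h = f \<oplus>\<^bsub>HM\<^esub> (g \<oplus>\<^bsub>HM\<^esub> h)"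
      by (auto simp: restrict_def fun_eq_iff D[OF f] D[OF g] D[OF h] N.M.a_ac)
  qed
  show "\<one> \<odot>\<^bsub>HM\<^esub> f = f" if "f \<in> carrier HM" for f
    using hom_memD[of f] that by (auto simp: extensional_def fun_eq_iff restrict_def)
  show "a \<odot>\<^bsub>HM\<^esub> f \<in> carrier HM" if "a \<in> carrier A" "f \<in> carrier HM" for a f
    using smult[of f a] that by simp
qed (auto simp: restrict_def fun_eq_iff hom_memD(1) N.smult_l_distr N.smult_r_distr N.smult_assoc1)

text \<open>
  Neither \<open>\<epsilon> \<circ> f\<close> nor \<open>f \<circ> \<delta>\<close> is \<open>A\<close>-linear, but both fail by the same term: on \<open>a x\<close> the Leibniz rules
  contribute \<open>(\<partial> a) f x\<close> to each, so that their difference is linear. Replacing \<open>f\<close> by \<open>a f\<close> changes only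
  the first of them by such a term, which gives the Leibniz rule for the difference.
\<close>

lemma derivation_module_hom: "derivation_module A HM hom_der"
proof (intro derivation_module.intro derivation_module_axioms.intro M.differential_ring_axioms
    hom_is_module)
  fix i f assume i: "i < nder A" and "f \<in> carrier HM"
  then have f: "f \<in> mod_hom A M N" by simp
  note D = hom_memD[OF f] M.\<delta>_closed[OF i] N.\<delta>_closed[OF i] M.der_closed[OF i]
  note D2 = M.\<delta>_add[OF i] N.\<delta>_add[OF i] M.\<delta>_smult[OF i] N.\<delta>_smult[OF i]
  have "(\<lambda>x\<in>carrier M. \<epsilon> i (f x) \<ominus>\<^bsub>N\<^esub> f (\<delta> i x)) \<in> mod_hom A M N"
  proof (rule mod_homI)
    show "\<epsilon> i (f (a \<odot>\<^bsub>M\<^esub> x)) \<ominus>\<^bsub>N\<^esub> f (\<delta> i (a \<odot>\<^bsub>M\<^esub> x)) = a \<odot>\<^bsub>N\<^esub> (\<epsilon> i (f x) \<ominus>\<^bsub>N\<^esub> f (\<delta> i x))"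
      if "a \<in> carrier A" "x \<in> carrier M" for a x
      using that
      by (simp add: D D2 N.smult_r_distr N.smult_r_minus N.M.minus_eq N.M.minus_add N.M.a_ac
          N.M.cancel_middle)
  qed (simp_all add: D D2 N.M.minus_eq N.M.minus_add N.M.a_ac)
  then show "hom_der i f \<in> carrier HM" by (simp add: hom_der_def)
  show "hom_der i (a \<odot>\<^bsub>HM\<^esub> f) = \<partial> i a \<odot>\<^bsub>HM\<^esub> f \<oplus>\<^bsub>HM\<^esub> a \<odot>\<^bsub>HM\<^esub> hom_der i f" if "a \<in> carrier A" for a
    using that by (auto simp: hom_der_def restrict_def fun_eq_iff D D2 N.M.minus_eq N.M.a_ac
        N.smult_r_distr N.smult_r_minus)
  show "hom_der i (f \<oplus>\<^bsub>HM\<^esub> g) = hom_der i f \<oplus>\<^bsub>HM\<^esub> hom_der i g" if "g \<in> carrier HM" for g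
    using that hom_memD[of g]
    by (auto simp: hom_der_def restrict_def fun_eq_iff D D2 N.M.minus_eq N.M.minus_add N.M.a_ac)
next
  fix i j f assume i: "i < nder A" and j: "j < nder A" and "f \<in> carrier HM"
  then have f: "f \<in> mod_hom A M N" by simp
  have minus: "\<epsilon> i (y \<ominus>\<^bsub>N\<^esub> z) = \<epsilon> i y \<ominus>\<^bsub>N\<^esub> \<epsilon> i z"
    if "i < nder A" "y \<in> carrier N" "z \<in> carrier N" for i y z
    using N.M.additive_minus(2)[OF N.M.abelian_group_axioms, of "\<epsilon> i" y z] that
    by (auto simp: N.\<delta>_add N.\<delta>_closed)
  show "hom_der i (hom_der j f) = hom_der j (hom_der i f)"
    using i j by (auto simp: hom_der_def restrict_def fun_eq_iff hom_memD[OF f] M.\<delta>_closed N.\<delta>_closed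
        minus[unfolded N.M.minus_eq] N.M.minus_eq N.M.minus_add N.M.a_ac M.\<delta>_comm[of i j] N.\<delta>_comm[of i j])
qed

definition "tensor_der i = tensor_lift TM (\<lambda>x y. pure (\<delta> i x) y \<oplus>\<^bsub>TM\<^esub> pure x (\<epsilon> i y))"

text \<open>
  The two summands are not balanced separately: moving \<open>a\<close> from the first factor to the second changes
  them by \<open>- (\<partial> a) x \<otimes> y\<close> and \<open>x \<otimes> (\<partial> a) y\<close>, which cancel.
\<close>

lemma balanced_tensor_der:
  assumes i: "i < nder A"
  shows "balanced TM (\<lambda>x y. pure (\<delta> i x) y \<oplus>\<^bsub>TM\<^esub> pure x (\<epsilon> i y))"
  unfolding balanced_def tensor_module_simps
proof (intro conjI ballI)
  note c = M.\<delta>_closed[OF i] N.\<delta>_closed[OF i] M.der_closed[OF i]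
  show "pure (\<delta> i (a \<odot>\<^bsub>M\<^esub> x)) y \<oplus>\<^bsub>T\<^esub> pure (a \<odot>\<^bsub>M\<^esub> x) (\<epsilon> i y)
      = pure (\<delta> i x) (a \<odot>\<^bsub>N\<^esub> y) \<oplus>\<^bsub>T\<^esub> pure x (\<epsilon> i (a \<odot>\<^bsub>N\<^esub> y))"
    if "a \<in> carrier A" "x \<in> carrier M" "y \<in> carrier N" for a x y
    using that by (simp add: c M.\<delta>_smult[OF i] N.\<delta>_smult[OF i] pure_add_left pure_add_right
        pure_smult T.a_ac)
qed (simp_all add: M.\<delta>_closed[OF i] N.\<delta>_closed[OF i] M.\<delta>_add[OF i] N.\<delta>_add[OF i]
    pure_add_left pure_add_right T.a_ac)

lemma tensor_module_abelian: "abelian_group TM"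
  by (rule abelian_group_cong[OF tensor_abelian_group]) simp_all

lemma tensor_der:
  assumes "i < nder A"
  shows "X \<in> carrier T \<Longrightarrow> tensor_der i X \<in> carrier T"
    and "X \<in> carrier T \<Longrightarrow> Y \<in> carrier T \<Longrightarrow> tensor_der i (X \<oplus>\<^bsub>T\<^esub> Y) = tensor_der i X \<oplus>\<^bsub>T\<^esub> tensor_der i Y"
    and "x \<in> carrier M \<Longrightarrow> y \<in> carrier N \<Longrightarrow>
      tensor_der i (pure x y) = pure (\<delta> i x) y \<oplus>\<^bsub>T\<^esub> pure x (\<epsilon> i y)"
  using tensor_lift_universal[OF tensor_module_abelian balanced_tensor_der[OF assms]]
  by (auto simp: tensor_der_def hom_def)

lemma derivation_module_tensor: "derivation_module A TM tensor_der"
proof (intro derivation_module.intro derivation_module_axioms.intro M.differential_ring_axioms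
    tensor_is_module)
  fix i X assume i: "i < nder A" and X: "X \<in> carrier TM"
  show "tensor_der i X \<in> carrier TM" using tensor_der(1)[OF i] X by simp
  show "tensor_der i (X \<oplus>\<^bsub>TM\<^esub> Y) = tensor_der i X \<oplus>\<^bsub>TM\<^esub> tensor_der i Y" if "Y \<in> carrier TM" for Y
    using tensor_der(2)[OF i] X that by simp
  show "tensor_der i (a \<odot>\<^bsub>TM\<^esub> X) = \<partial> i a \<odot>\<^bsub>TM\<^esub> X \<oplus>\<^bsub>TM\<^esub> a \<odot>\<^bsub>TM\<^esub> tensor_der i X"
    if a: "a \<in> carrier A" for a
    unfolding tensor_module_simps
    by (rule tensor_ext[OF tensor_abelian_group, where X = X
          and f = "\<lambda>X. tensor_der i (a \<odot>\<^bsub>TM\<^esub> X)"])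
      (use X a in \<open>auto simp: hom_def tensor_smult_closed tensor_smult_add tensor_der[OF i] T.a_ac
        tensor_smult(2) M.\<delta>_smult[OF i] pure_add_left M.der_closed[OF i] M.\<delta>_closed[OF i]
        N.\<delta>_closed[OF i]\<close>)
next
  fix i j X assume i: "i < nder A" and j: "j < nder A" and X: "X \<in> carrier TM"
  show "tensor_der i (tensor_der j X) = tensor_der j (tensor_der i X)"
    by (rule tensor_ext[OF tensor_abelian_group, where X = X
          and f = "\<lambda>X. tensor_der i (tensor_der j X)"])
      (use X in \<open>auto simp: hom_def tensor_der[OF i] tensor_der[OF j] T.a_ac
        M.\<delta>_closed[OF i] M.\<delta>_closed[OF j] N.\<delta>_closed[OF i] N.\<delta>_closed[OF j]
        M.\<delta>_comm[OF i j] N.\<delta>_comm[OF i j]\<close>)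
qed

end


section \<open>Homomorphisms and tensor products of modules over the ring of operators\<close>

lemma (in derivation_module) left_op_module_generators:
  assumes "x \<in> carrier M"
  shows "a \<in> carrier A \<Longrightarrow> op_const A a \<odot>\<^bsub>left_op_module A M \<delta>\<^esub> x = a \<odot>\<^bsub>M\<^esub> x"
    and "i < nder A \<Longrightarrow> op_d A i \<odot>\<^bsub>left_op_module A M \<delta>\<^esub> x = \<delta> i x"
  using assms by (simp_all add: act_op_const act_op_d)

locale left_pair = differential_ring A + M: left_module "diff_ops A" M + N: left_module "diff_ops A" N
  for A :: "'a diff_ring" (structure)
    and M :: "('a diff_op, 'm) module" and N :: "('a diff_op, 'n) module"
begin

sublocale P: derivation_pair A "left_scalars A M" "\<lambda>i x. op_d A i \<odot>\<^bsub>M\<^esub> x"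
    "left_scalars A N" "\<lambda>i x. op_d A i \<odot>\<^bsub>N\<^esub> x"
  by (intro derivation_pair.intro derivation_module_left_scalars M.left_module_axioms N.left_module_axioms)

lemma hom_ll_eq: "hom_ll A M N = left_op_module A P.HM P.hom_der"
  by (simp add: hom_ll_def P.hom_der_def[abs_def])

sublocale H: derivation_module A P.HM P.hom_der by (rule P.derivation_module_hom)

lemma left_module_hom: "left_module D (hom_ll A M N)"
  unfolding hom_ll_eq by (rule H.left_module_left_op_module)

sublocale HL: left_module D "hom_ll A M N" by (rule left_module_hom)

lemma hom_ll_simps [simp]:
  "carrier (hom_ll A M N) = mod_hom A (left_scalars A M) (left_scalars A N)"
  "\<zero>\<^bsub>hom_ll A M N\<^esub> = (\<lambda>x\<in>carrier M. \<zero>\<^bsub>N\<^esub>)"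
  "f \<oplus>\<^bsub>hom_ll A M N\<^esub> g = (\<lambda>x\<in>carrier M. f x \<oplus>\<^bsub>N\<^esub> g x)"
  by (simp_all add: hom_ll_eq)

lemmas hom_llD = P.hom_memD[unfolded left_scalars_simps]
lemmas hom_llI = P.mod_homI[unfolded left_scalars_simps]

lemma hom_ll_const:
  assumes "f \<in> carrier (hom_ll A M N)" "x \<in> carrier M" "a \<in> carrier A"
  shows "(op_const A a \<odot>\<^bsub>hom_ll A M N\<^esub> f) x = op_const A a \<odot>\<^bsub>N\<^esub> f x"
  using assms H.left_op_module_generators(1)[of f a] by (simp add: hom_ll_eq del: left_op_module_simps(4))

lemma hom_ll_d:
  assumes "f \<in> carrier (hom_ll A M N)" "x \<in> carrier M" "i < nder A"
  shows "(op_d A i \<odot>\<^bsub>hom_ll A M N\<^esub> f) x = op_d A i \<odot>\<^bsub>N\<^esub> f x \<ominus>\<^bsub>N\<^esub> f (op_d A i \<odot>\<^bsub>M\<^esub> x)"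
  using assms H.left_op_module_generators(2)[of f i]
  by (simp add: hom_ll_eq P.hom_der_def del: left_op_module_simps(4))

text \<open>
  The formula for \<open>d\<^sub>i\<close> extends to \<open>T\<close>, the \<open>A\<close>-span of the \<open>d\<^sub>i\<close>, because both of its terms are linear in
  \<open>\<xi>\<close>; for the second one this uses the linearity of \<open>f\<close>.
\<close>

lemma hom_ll_T:
  assumes f: "f \<in> carrier (hom_ll A M N)" and x: "x \<in> carrier M" and \<xi>: "\<xi> \<in> op_T A"
  shows "(\<xi> \<odot>\<^bsub>hom_ll A M N\<^esub> f) x = \<xi> \<odot>\<^bsub>N\<^esub> f x \<ominus>\<^bsub>N\<^esub> f (\<xi> \<odot>\<^bsub>M\<^esub> x)"
  using \<xi>
proof (induction rule: op_T_induct)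
  case zero
  have "f \<zero>\<^bsub>M\<^esub> = \<zero>\<^bsub>N\<^esub>"
    by (rule M.M.additive_zero[OF N.M.abelian_group_axioms]) (use f in \<open>auto simp: hom_llD\<close>)
  then show ?case
    using f x
    by (simp add: N.M.a_inv_zero HL.smult_l_zero M.smult_l_zero N.smult_l_zero hom_llD N.M.minus_eq)
next
  case (monom a i)
  have d: "op_d A i \<odot>\<^bsub>hom_ll A M N\<^esub> f \<in> carrier (hom_ll A M N)"
    using HL.smult_closed[OF op_d_closed f] monom by simp
  have "((op_const A a \<otimes>\<^bsub>D\<^esub> op_d A i) \<odot>\<^bsub>hom_ll A M N\<^esub> f) x
      = op_const A a \<odot>\<^bsub>N\<^esub> (op_d A i \<odot>\<^bsub>N\<^esub> f x \<ominus>\<^bsub>N\<^esub> f (op_d A i \<odot>\<^bsub>M\<^esub> x))"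
    using HL.smult_assoc1[OF op_const_closed[OF monom(1)] op_d_closed[OF monom(2)] f]
      hom_ll_const[OF d x monom(1)] hom_ll_d[OF f x monom(2)] by simp
  also have "\<dots> = (op_const A a \<otimes>\<^bsub>D\<^esub> op_d A i) \<odot>\<^bsub>N\<^esub> f x \<ominus>\<^bsub>N\<^esub> f ((op_const A a \<otimes>\<^bsub>D\<^esub> op_d A i) \<odot>\<^bsub>M\<^esub> x)"
    using f x monom P.N.smult_r_minus[of a "f (op_d A i \<odot>\<^bsub>M\<^esub> x)"]
    by (simp add: hom_llD M.smult_assoc1 N.smult_assoc1 M.smult_closed N.smult_closed N.M.minus_eq
        N.smult_r_distr)
  finally show ?case .
next
  case (add P Q)
  have c: "P \<odot>\<^bsub>M\<^esub> x \<in> carrier M" "Q \<odot>\<^bsub>M\<^esub> x \<in> carrier M" "P \<odot>\<^bsub>N\<^esub> f x \<in> carrier N" "Q \<odot>\<^bsub>N\<^esub> f x \<in> carrier N"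
    "f x \<in> carrier N"
    using f x add.hyps by (auto simp: hom_llD M.smult_closed N.smult_closed)
  have "((P \<oplus>\<^bsub>D\<^esub> Q) \<odot>\<^bsub>hom_ll A M N\<^esub> f) x = (P \<odot>\<^bsub>hom_ll A M N\<^esub> f) x \<oplus>\<^bsub>N\<^esub> (Q \<odot>\<^bsub>hom_ll A M N\<^esub> f) x"
    using HL.smult_l_distr[OF add.hyps f] x by simp
  then show ?case
    using f x c add
    by (simp add: M.smult_l_distr N.smult_l_distr hom_llD N.M.minus_eq N.M.minus_add N.M.a_ac)
qed

lemma tensor_ll_eq: "tensor_ll A M N = left_op_module A P.TM P.tensor_der"
  by (simp add: tensor_ll_def Let_def P.tensor_der_def[abs_def])

sublocale T: derivation_module A P.TM P.tensor_der by (rule P.derivation_module_tensor)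

lemma left_module_tensor: "left_module D (tensor_ll A M N)"
  unfolding tensor_ll_eq by (rule T.left_module_left_op_module)

sublocale TL: left_module D "tensor_ll A M N" by (rule left_module_tensor)

lemma tensor_ll_simps [simp]:
  "carrier (tensor_ll A M N) = carrier P.T" "\<zero>\<^bsub>tensor_ll A M N\<^esub> = \<zero>\<^bsub>P.T\<^esub>" "add (tensor_ll A M N) = add P.T"
  by (simp_all add: tensor_ll_eq)

lemmas tens_ll_closed = P.pure_closed[unfolded left_scalars_simps]
lemmas tens_ll_add_left = P.pure_add_left[unfolded left_scalars_simps]
lemmas tens_ll_add_right = P.pure_add_right[unfolded left_scalars_simps]
lemmas tens_ll_smult = P.pure_smult[unfolded left_scalars_simps]

lemma tensor_ll_const:
  assumes "x \<in> carrier M" "y \<in> carrier N" "a \<in> carrier A"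
  shows "op_const A a \<odot>\<^bsub>tensor_ll A M N\<^esub> tens_ll A M N x y = tens_ll A M N (op_const A a \<odot>\<^bsub>M\<^esub> x) y"
  using assms T.left_op_module_generators(1)[of "tens_ll A M N x y" a] P.tensor_smult(2)[of a x y]
  by (simp add: tensor_ll_eq tens_ll_closed del: left_op_module_simps(4))

lemma tensor_ll_d:
  assumes "x \<in> carrier M" "y \<in> carrier N" "i < nder A"
  shows "op_d A i \<odot>\<^bsub>tensor_ll A M N\<^esub> tens_ll A M N x y
    = tens_ll A M N (op_d A i \<odot>\<^bsub>M\<^esub> x) y \<oplus>\<^bsub>tensor_ll A M N\<^esub> tens_ll A M N x (op_d A i \<odot>\<^bsub>N\<^esub> y)"
  using assms T.left_op_module_generators(2)[of "tens_ll A M N x y" i] P.tensor_der(3)[of i x y]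
  by (simp add: tensor_ll_eq tens_ll_closed del: left_op_module_simps(4))

lemma tens_ll_zero:
  "y \<in> carrier N \<Longrightarrow> tens_ll A M N \<zero>\<^bsub>M\<^esub> y = \<zero>\<^bsub>P.T\<^esub>"
  "x \<in> carrier M \<Longrightarrow> tens_ll A M N x \<zero>\<^bsub>N\<^esub> = \<zero>\<^bsub>P.T\<^esub>"
  using M.M.additive_zero[OF P.tensor_abelian_group, of "\<lambda>x. tens_ll A M N x y"]
    N.M.additive_zero[OF P.tensor_abelian_group, of "\<lambda>y. tens_ll A M N x y"]
  by (simp_all add: tens_ll_closed tens_ll_add_left tens_ll_add_right)

lemma tensor_ll_T:
  assumes x: "x \<in> carrier M" and y: "y \<in> carrier N" and \<xi>: "\<xi> \<in> op_T A"
  shows "\<xi> \<odot>\<^bsub>tensor_ll A M N\<^esub> tens_ll A M N x y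
    = tens_ll A M N (\<xi> \<odot>\<^bsub>M\<^esub> x) y \<oplus>\<^bsub>tensor_ll A M N\<^esub> tens_ll A M N x (\<xi> \<odot>\<^bsub>N\<^esub> y)"
  using \<xi>
proof (induction rule: op_T_induct)
  case zero
  show ?case
    using x y TL.smult_l_zero[of "tens_ll A M N x y"]
    by (simp add: M.smult_l_zero N.smult_l_zero tens_ll_zero tens_ll_closed)
next
  case (monom a i)
  have "(op_const A a \<otimes>\<^bsub>D\<^esub> op_d A i) \<odot>\<^bsub>tensor_ll A M N\<^esub> tens_ll A M N x y
      = op_const A a \<odot>\<^bsub>tensor_ll A M N\<^esub>
        (tens_ll A M N (op_d A i \<odot>\<^bsub>M\<^esub> x) y \<oplus>\<^bsub>tensor_ll A M N\<^esub> tens_ll A M N x (op_d A i \<odot>\<^bsub>N\<^esub> y))"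
    using TL.smult_assoc1[of "op_const A a" "op_d A i" "tens_ll A M N x y"] tensor_ll_d[OF x y monom(2)]
      monom x y by (simp add: tens_ll_closed)
  also have "\<dots> = op_const A a \<odot>\<^bsub>tensor_ll A M N\<^esub> tens_ll A M N (op_d A i \<odot>\<^bsub>M\<^esub> x) y
      \<oplus>\<^bsub>tensor_ll A M N\<^esub> op_const A a \<odot>\<^bsub>tensor_ll A M N\<^esub> tens_ll A M N x (op_d A i \<odot>\<^bsub>N\<^esub> y)"
    by (rule TL.smult_r_distr) (use monom x y in \<open>simp_all add: tens_ll_closed M.smult_closed N.smult_closed\<close>)
  also have "\<dots> = tens_ll A M N ((op_const A a \<otimes>\<^bsub>D\<^esub> op_d A i) \<odot>\<^bsub>M\<^esub> x) y
      \<oplus>\<^bsub>tensor_ll A M N\<^esub> tens_ll A M N x ((op_const A a \<otimes>\<^bsub>D\<^esub> op_d A i) \<odot>\<^bsub>N\<^esub> y)"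
    using monom x y
    by (simp add: tensor_ll_const M.smult_assoc1 N.smult_assoc1 M.smult_closed N.smult_closed tens_ll_smult)
  finally show ?case .
next
  case (add P Q)
  then show ?case
    using x y TL.smult_l_distr[of P Q "tens_ll A M N x y"]
    by (simp add: M.smult_l_distr N.smult_l_distr tens_ll_closed M.smult_closed N.smult_closed
        tens_ll_add_left tens_ll_add_right P.T.a_ac)
qed

end

lemma (in differential_ring) base_module_simps [simp]:
  "carrier (base_module A) = carrier A" "\<zero>\<^bsub>base_module A\<^esub> = \<zero>" "add (base_module A) = add A"
  "a_minus (base_module A) = a_minus A"
  by (simp_all add: base_module_def)

lemma (in differential_ring) derivation_module_base:
  "derivation_module A (with_smult A (monoid.mult A)) (der A)"
proof -
  have "module A (with_smult A (monoid.mult A))"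
    by (rule moduleI[OF is_cring abelian_group_cong[OF is_abelian_group]])
      (auto simp: l_distr r_distr m_assoc)
  then show ?thesis
    by (intro derivation_module.intro derivation_module_axioms.intro differential_ring_axioms)
      (auto simp: der_closed der_add der_mult der_comm)
qed

lemma (in differential_ring) base_module_generators:
  assumes "x \<in> carrier A"
  shows "a \<in> carrier A \<Longrightarrow> op_const A a \<odot>\<^bsub>base_module A\<^esub> x = a \<otimes> x"
    and "i < nder A \<Longrightarrow> op_d A i \<odot>\<^bsub>base_module A\<^esub> x = \<partial> i x"
proof -
  interpret B: derivation_module A "with_smult A (monoid.mult A)" "der A"
    by (rule derivation_module_base)
  show "a \<in> carrier A \<Longrightarrow> op_const A a \<odot>\<^bsub>base_module A\<^esub> x = a \<otimes> x"
    and "i < nder A \<Longrightarrow> op_d A i \<odot>\<^bsub>base_module A\<^esub> x = \<partial> i x"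
    using B.left_op_module_generators[of x] assms by (simp_all add: base_module_def)
qed


section \<open>Constructions involving right modules\<close>

text \<open>
  The operators below are those already constructed for \<open>x \<mapsto> - x d\<^sub>i\<close> on right modules, up to a sign in
  the case of the tensor product: \<open>f (x d\<^sub>i) - (f x) d\<^sub>i\<close> equals \<open>- (f x) d\<^sub>i - f (- x d\<^sub>i)\<close>, and
  \<open>x \<otimes> y d\<^sub>i - d\<^sub>i x \<otimes> y\<close> is the negative of \<open>d\<^sub>i x \<otimes> y + x \<otimes> (- y d\<^sub>i)\<close>.
\<close>

locale right_pair = differential_ring A + M: right_module "diff_ops A" M + N: right_module "diff_ops A" N
  for A :: "'a diff_ring" (structure)
    and M :: "('a diff_op, 'm) rmodule" and N :: "('a diff_op, 'n) rmodule"
begin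

sublocale P: derivation_pair A "right_scalars A M" "\<lambda>i x. \<ominus>\<^bsub>M\<^esub> (x \<boxdot>\<^bsub>M\<^esub> op_d A i)"
    "right_scalars A N" "\<lambda>i x. \<ominus>\<^bsub>N\<^esub> (x \<boxdot>\<^bsub>N\<^esub> op_d A i)"
  by (intro derivation_pair.intro derivation_module_right_scalars M.right_module_axioms N.right_module_axioms)

definition "hom_rr_der i f = (\<lambda>x\<in>carrier M. f (x \<boxdot>\<^bsub>M\<^esub> op_d A i) \<ominus>\<^bsub>N\<^esub> f x \<boxdot>\<^bsub>N\<^esub> op_d A i)"

lemma hom_rr_eq: "hom_rr A M N = left_op_module A P.HM hom_rr_der"
  by (simp add: hom_rr_def hom_rr_der_def[abs_def])

lemmas hom_rrD = P.hom_memD[unfolded right_scalars_simps]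

lemma hom_rr_minus:
  assumes "f \<in> mod_hom A (right_scalars A M) (right_scalars A N)" "x \<in> carrier M"
  shows "f (\<ominus>\<^bsub>M\<^esub> x) = \<ominus>\<^bsub>N\<^esub> f x"
  using M.M.additive_minus(1)[OF N.M.abelian_group_axioms, of f x] assms by (auto simp: hom_rrD)

sublocale H: derivation_module A P.HM hom_rr_der
proof (rule derivation_module_cong[OF P.derivation_module_hom])
  fix i f assume "i < nder A" "f \<in> carrier P.HM"
  then show "hom_rr_der i f = P.hom_der i f"
    by (auto simp: hom_rr_der_def P.hom_der_def restrict_def fun_eq_iff hom_rrD hom_rr_minus
        M.rsmult_closed N.rsmult_closed N.M.minus_eq N.M.a_ac)
qed

lemma left_module_hom_rr: "left_module D (hom_rr A M N)"
  unfolding hom_rr_eq by (rule H.left_module_left_op_module)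

sublocale HR: left_module D "hom_rr A M N" by (rule left_module_hom_rr)

lemma hom_rr_simps [simp]:
  "carrier (hom_rr A M N) = mod_hom A (right_scalars A M) (right_scalars A N)"
  "\<zero>\<^bsub>hom_rr A M N\<^esub> = (\<lambda>x\<in>carrier M. \<zero>\<^bsub>N\<^esub>)"
  "f \<oplus>\<^bsub>hom_rr A M N\<^esub> g = (\<lambda>x\<in>carrier M. f x \<oplus>\<^bsub>N\<^esub> g x)"
  by (simp_all add: hom_rr_eq)

lemma hom_rr_const:
  assumes "f \<in> carrier (hom_rr A M N)" "x \<in> carrier M" "a \<in> carrier A"
  shows "(op_const A a \<odot>\<^bsub>hom_rr A M N\<^esub> f) x = f x \<boxdot>\<^bsub>N\<^esub> op_const A a"
  using assms H.left_op_module_generators(1)[of f a] by (simp add: hom_rr_eq del: left_op_module_simps(4))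

lemma hom_rr_d:
  assumes "f \<in> carrier (hom_rr A M N)" "x \<in> carrier M" "i < nder A"
  shows "(op_d A i \<odot>\<^bsub>hom_rr A M N\<^esub> f) x = f (x \<boxdot>\<^bsub>M\<^esub> op_d A i) \<ominus>\<^bsub>N\<^esub> f x \<boxdot>\<^bsub>N\<^esub> op_d A i"
  using assms H.left_op_module_generators(2)[of f i]
  by (simp add: hom_rr_eq hom_rr_der_def del: left_op_module_simps(4))

lemma hom_rr_T:
  assumes f: "f \<in> carrier (hom_rr A M N)" and x: "x \<in> carrier M" and \<xi>: "\<xi> \<in> op_T A"
  shows "(\<xi> \<odot>\<^bsub>hom_rr A M N\<^esub> f) x = f (x \<boxdot>\<^bsub>M\<^esub> \<xi>) \<ominus>\<^bsub>N\<^esub> f x \<boxdot>\<^bsub>N\<^esub> \<xi>"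
  using \<xi>
proof (induction rule: op_T_induct)
  case zero
  have "f \<zero>\<^bsub>M\<^esub> = \<zero>\<^bsub>N\<^esub>"
    by (rule M.M.additive_zero[OF N.M.abelian_group_axioms]) (use f in \<open>auto simp: hom_rrD\<close>)
  then show ?case
    using f x
    by (simp add: N.M.a_inv_zero HR.smult_l_zero M.rsmult_r_zero N.rsmult_r_zero hom_rrD N.M.minus_eq)
next
  case (monom a i)
  have d: "op_d A i \<odot>\<^bsub>hom_rr A M N\<^esub> f \<in> carrier (hom_rr A M N)"
    using HR.smult_closed[OF op_d_closed f] monom by simp
  have xa: "x \<boxdot>\<^bsub>M\<^esub> op_const A a \<in> carrier M" using x monom by (simp add: M.rsmult_closed)
  \<comment> \<open>As \<open>d\<^sub>i f\<close> is \<open>A\<close>-linear, the scalar can be moved from its value to its argument.\<close>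
  have "((op_const A a \<otimes>\<^bsub>D\<^esub> op_d A i) \<odot>\<^bsub>hom_rr A M N\<^esub> f) x
      = (op_d A i \<odot>\<^bsub>hom_rr A M N\<^esub> f) (x \<boxdot>\<^bsub>M\<^esub> op_const A a)"
    using HR.smult_assoc1[OF op_const_closed[OF monom(1)] op_d_closed[OF monom(2)] f]
      hom_rr_const[OF d x monom(1)] hom_rrD(3)[of "op_d A i \<odot>\<^bsub>hom_rr A M N\<^esub> f" a x] d monom x by simp
  also have "\<dots> = f (x \<boxdot>\<^bsub>M\<^esub> (op_const A a \<otimes>\<^bsub>D\<^esub> op_d A i)) \<ominus>\<^bsub>N\<^esub> f x \<boxdot>\<^bsub>N\<^esub> (op_const A a \<otimes>\<^bsub>D\<^esub> op_d A i)"
    using hom_rr_d[OF f xa monom(2)] f x monom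
    by (simp add: hom_rrD M.rsmult_assoc1 N.rsmult_assoc1)
  finally show ?case .
next
  case (add P Q)
  have c: "x \<boxdot>\<^bsub>M\<^esub> P \<in> carrier M" "x \<boxdot>\<^bsub>M\<^esub> Q \<in> carrier M" "f x \<boxdot>\<^bsub>N\<^esub> P \<in> carrier N" "f x \<boxdot>\<^bsub>N\<^esub> Q \<in> carrier N"
    "f x \<in> carrier N"
    using f x add.hyps by (auto simp: hom_rrD M.rsmult_closed N.rsmult_closed)
  have "((P \<oplus>\<^bsub>D\<^esub> Q) \<odot>\<^bsub>hom_rr A M N\<^esub> f) x = (P \<odot>\<^bsub>hom_rr A M N\<^esub> f) x \<oplus>\<^bsub>N\<^esub> (Q \<odot>\<^bsub>hom_rr A M N\<^esub> f) x"
    using HR.smult_l_distr[OF add.hyps f] x by simp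
  then show ?case
    using f x c add
    by (simp add: M.rsmult_r_distr N.rsmult_r_distr hom_rrD N.M.minus_eq N.M.minus_add N.M.a_ac)
qed

end

locale left_right_pair =
  differential_ring A + M: left_module "diff_ops A" M + N: right_module "diff_ops A" N
  for A :: "'a diff_ring" (structure)
    and M :: "('a diff_op, 'm) module" and N :: "('a diff_op, 'n) rmodule"
begin

sublocale P: derivation_pair A "left_scalars A M" "\<lambda>i x. op_d A i \<odot>\<^bsub>M\<^esub> x"
    "right_scalars A N" "\<lambda>i x. \<ominus>\<^bsub>N\<^esub> (x \<boxdot>\<^bsub>N\<^esub> op_d A i)"
  by (intro derivation_pair.intro derivation_module_left_scalars derivation_module_right_scalars
      M.left_module_axioms N.right_module_axioms)

definition "tensor_lr_der i = tensor_lift P.TM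
  (\<lambda>x y. tens_lr A M N x (y \<boxdot>\<^bsub>N\<^esub> op_d A i) \<ominus>\<^bsub>P.TM\<^esub> tens_lr A M N (op_d A i \<odot>\<^bsub>M\<^esub> x) y)"

lemma tensor_lr_eq: "tensor_lr A M N = right_op_module A P.TM tensor_lr_der"
  by (simp add: tensor_lr_def Let_def tensor_lr_der_def[abs_def])

lemmas tens_lr_closed = P.pure_closed[unfolded left_scalars_simps right_scalars_simps]
lemmas tens_lr_add_left = P.pure_add_left[unfolded left_scalars_simps right_scalars_simps]
lemmas tens_lr_add_right = P.pure_add_right[unfolded left_scalars_simps right_scalars_simps]
lemmas tens_lr_smult = P.pure_smult[unfolded left_scalars_simps right_scalars_simps]

lemma tens_lr_minus:
  assumes "x \<in> carrier M" "y \<in> carrier N"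
  shows "tens_lr A M N x (\<ominus>\<^bsub>N\<^esub> y) = \<ominus>\<^bsub>P.T\<^esub> tens_lr A M N x y"
  using N.M.additive_minus(1)[OF P.tensor_abelian_group, of "\<lambda>y. tens_lr A M N x y" y] assms
  by (auto simp: tens_lr_closed tens_lr_add_right)

lemma balanced_tensor_lr:
  assumes i: "i < nder A"
  shows "P.balanced P.TM
    (\<lambda>x y. tens_lr A M N x (y \<boxdot>\<^bsub>N\<^esub> op_d A i) \<ominus>\<^bsub>P.TM\<^esub> tens_lr A M N (op_d A i \<odot>\<^bsub>M\<^esub> x) y)"
proof -
  let ?g = "\<lambda>x y. tens_lr A M N (op_d A i \<odot>\<^bsub>M\<^esub> x) y \<oplus>\<^bsub>P.TM\<^esub> tens_lr A M N x (\<ominus>\<^bsub>N\<^esub> (y \<boxdot>\<^bsub>N\<^esub> op_d A i))"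
  let ?h = "\<lambda>x y. tens_lr A M N x (y \<boxdot>\<^bsub>N\<^esub> op_d A i) \<ominus>\<^bsub>P.TM\<^esub> tens_lr A M N (op_d A i \<odot>\<^bsub>M\<^esub> x) y"
  have h: "?h x y = \<ominus>\<^bsub>P.T\<^esub> ?g x y" if "x \<in> carrier M" "y \<in> carrier N" for x y
    using that i by (simp add: tens_lr_minus tens_lr_closed M.smult_closed N.rsmult_closed P.T.minus_eq
        P.T.minus_add P.T.a_ac)
  have g: "P.balanced P.TM ?g" using P.balanced_tensor_der[OF i] by simp
  have gc: "?g x y \<in> carrier P.T" if "x \<in> carrier M" "y \<in> carrier N" for x y
    using g that by (simp add: P.balanced_def)
  have neg: "P.balanced P.TM (\<lambda>x y. \<ominus>\<^bsub>P.T\<^esub> ?g x y)"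
    using g gc unfolding P.balanced_def
    by (simp add: P.T.minus_add del: P.T.minus_add[symmetric])
  show ?thesis
    using neg unfolding P.balanced_def
    by (simp add: h M.smult_closed N.rsmult_closed del: P.tensor_module_simps(5))
qed

lemma tensor_lr_der:
  assumes "i < nder A"
  shows "X \<in> carrier P.T \<Longrightarrow> tensor_lr_der i X \<in> carrier P.T"
    and "X \<in> carrier P.T \<Longrightarrow> Y \<in> carrier P.T \<Longrightarrow>
      tensor_lr_der i (X \<oplus>\<^bsub>P.T\<^esub> Y) = tensor_lr_der i X \<oplus>\<^bsub>P.T\<^esub> tensor_lr_der i Y"
    and "x \<in> carrier M \<Longrightarrow> y \<in> carrier N \<Longrightarrow> tensor_lr_der i (tens_lr A M N x y)
      = tens_lr A M N x (y \<boxdot>\<^bsub>N\<^esub> op_d A i) \<ominus>\<^bsub>P.T\<^esub> tens_lr A M N (op_d A i \<odot>\<^bsub>M\<^esub> x) y"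
  using P.tensor_lift_universal[OF P.tensor_module_abelian balanced_tensor_lr[OF assms]]
  by (auto simp: tensor_lr_der_def hom_def)

sublocale T: right_derivation_module A P.TM tensor_lr_der
proof (intro right_derivation_module.intro right_derivation_module_axioms.intro
    derivation_module_cong[OF P.derivation_module_tensor])
  fix i X assume i: "i < nder A" and X: "X \<in> carrier P.TM"
  show "\<ominus>\<^bsub>P.TM\<^esub> tensor_lr_der i X = P.tensor_der i X"
    unfolding P.tensor_module_simps
    by (rule P.tensor_ext[OF P.tensor_abelian_group, where X = X and f = "\<lambda>X. \<ominus>\<^bsub>P.T\<^esub> tensor_lr_der i X"])
      (use i X in \<open>auto simp: hom_def tensor_lr_der P.tensor_der tens_lr_minus tens_lr_closed
        M.smult_closed N.rsmult_closed P.T.minus_eq P.T.minus_add P.T.a_ac\<close>)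
  show "tensor_lr_der i X \<in> carrier P.TM" using tensor_lr_der(1)[OF i] X by simp
qed

lemma right_module_tensor_lr: "right_module D (tensor_lr A M N)"
  unfolding tensor_lr_eq by (rule T.right_module_right_op_module)

sublocale TR: right_module D "tensor_lr A M N" by (rule right_module_tensor_lr)

lemma tensor_lr_simps [simp]:
  "carrier (tensor_lr A M N) = carrier P.T" "\<zero>\<^bsub>tensor_lr A M N\<^esub> = \<zero>\<^bsub>P.T\<^esub>"
  "add (tensor_lr A M N) = add P.T" "a_minus (tensor_lr A M N) = a_minus P.T"
  by (simp_all add: tensor_lr_eq right_op_module_def)

lemma tensor_lr_const:
  assumes "x \<in> carrier M" "y \<in> carrier N" "a \<in> carrier A"
  shows "tens_lr A M N x y \<boxdot>\<^bsub>tensor_lr A M N\<^esub> op_const A a = tens_lr A M N (op_const A a \<odot>\<^bsub>M\<^esub> x) y"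
  using assms T.right_op_module_generators(1)[of "tens_lr A M N x y" a] P.tensor_smult(2)[of a x y]
  by (simp add: tensor_lr_eq tens_lr_closed)

lemma tensor_lr_d:
  assumes "x \<in> carrier M" "y \<in> carrier N" "i < nder A"
  shows "tens_lr A M N x y \<boxdot>\<^bsub>tensor_lr A M N\<^esub> op_d A i
    = tens_lr A M N x (y \<boxdot>\<^bsub>N\<^esub> op_d A i) \<ominus>\<^bsub>tensor_lr A M N\<^esub> tens_lr A M N (op_d A i \<odot>\<^bsub>M\<^esub> x) y"
  using assms T.right_op_module_generators(2)[of "tens_lr A M N x y" i] tensor_lr_der(3)[of i x y]
  unfolding tensor_lr_simps by (simp add: tensor_lr_eq tens_lr_closed)

lemma tens_lr_zero:
  "y \<in> carrier N \<Longrightarrow> tens_lr A M N \<zero>\<^bsub>M\<^esub> y = \<zero>\<^bsub>P.T\<^esub>"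
  "x \<in> carrier M \<Longrightarrow> tens_lr A M N x \<zero>\<^bsub>N\<^esub> = \<zero>\<^bsub>P.T\<^esub>"
  using M.M.additive_zero[OF P.tensor_abelian_group, of "\<lambda>x. tens_lr A M N x y"]
    N.M.additive_zero[OF P.tensor_abelian_group, of "\<lambda>y. tens_lr A M N x y"]
  by (simp_all add: tens_lr_closed tens_lr_add_left tens_lr_add_right)

lemma tensor_lr_T:
  assumes x: "x \<in> carrier M" and y: "y \<in> carrier N" and \<xi>: "\<xi> \<in> op_T A"
  shows "tens_lr A M N x y \<boxdot>\<^bsub>tensor_lr A M N\<^esub> \<xi>
    = tens_lr A M N x (y \<boxdot>\<^bsub>N\<^esub> \<xi>) \<ominus>\<^bsub>tensor_lr A M N\<^esub> tens_lr A M N (\<xi> \<odot>\<^bsub>M\<^esub> x) y"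
  using \<xi>
proof (induction rule: op_T_induct)
  case zero
  show ?case
    using x y TR.rsmult_r_zero[of "tens_lr A M N x y"]
    by (simp add: P.T.a_inv_zero M.smult_l_zero N.rsmult_r_zero tens_lr_zero tens_lr_closed P.T.minus_eq)
next
  case (monom a i)
  have ya: "y \<boxdot>\<^bsub>N\<^esub> op_const A a \<in> carrier N" using y monom by (simp add: N.rsmult_closed)
  \<comment> \<open>The scalar acts on the second factor here, so that \<open>d\<^sub>i\<close> is not applied to \<open>a x\<close>.\<close>
  have "tens_lr A M N x y \<boxdot>\<^bsub>tensor_lr A M N\<^esub> (op_const A a \<otimes>\<^bsub>D\<^esub> op_d A i)
      = tens_lr A M N x (y \<boxdot>\<^bsub>N\<^esub> op_const A a) \<boxdot>\<^bsub>tensor_lr A M N\<^esub> op_d A i"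
    using TR.rsmult_assoc1[of "op_const A a" "op_d A i" "tens_lr A M N x y"]
      tensor_lr_const[OF x y monom(1)] monom x y by (simp add: tens_lr_closed tens_lr_smult)
  also have "\<dots> = tens_lr A M N x (y \<boxdot>\<^bsub>N\<^esub> (op_const A a \<otimes>\<^bsub>D\<^esub> op_d A i))
      \<ominus>\<^bsub>tensor_lr A M N\<^esub> tens_lr A M N ((op_const A a \<otimes>\<^bsub>D\<^esub> op_d A i) \<odot>\<^bsub>M\<^esub> x) y"
    using tensor_lr_d[OF x ya monom(2)] x y monom
    by (simp add: N.rsmult_assoc1 M.smult_assoc1 M.smult_closed tens_lr_smult)
  finally show ?case .
next
  case (add P Q)
  then show ?case
    using x y TR.rsmult_r_distr[of P Q "tens_lr A M N x y"]
    by (simp add: M.smult_l_distr N.rsmult_r_distr tens_lr_closed M.smult_closed N.rsmult_closed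
        tens_lr_add_left tens_lr_add_right P.T.a_ac P.T.minus_eq P.T.minus_add)
qed

end


section \<open>The adjunction and the dual of the ring of operators\<close>

lemma (in left_pair) linear_over_operators:
  assumes closed: "\<And>x. x \<in> carrier M \<Longrightarrow> f x \<in> carrier N"
    and add: "\<And>x y. \<lbrakk>x \<in> carrier M; y \<in> carrier M\<rbrakk> \<Longrightarrow> f (x \<oplus>\<^bsub>M\<^esub> y) = f x \<oplus>\<^bsub>N\<^esub> f y"
    and const: "\<And>a x. \<lbrakk>a \<in> carrier A; x \<in> carrier M\<rbrakk> \<Longrightarrow> f (op_const A a \<odot>\<^bsub>M\<^esub> x) = op_const A a \<odot>\<^bsub>N\<^esub> f x"
    and deriv: "\<And>i x. \<lbrakk>i < nder A; x \<in> carrier M\<rbrakk> \<Longrightarrow> f (op_d A i \<odot>\<^bsub>M\<^esub> x) = op_d A i \<odot>\<^bsub>N\<^esub> f x"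
  shows "(\<lambda>x\<in>carrier M. f x) \<in> mod_hom D M N"
proof -
  have "\<forall>x\<in>carrier M. f (P \<odot>\<^bsub>M\<^esub> x) = P \<odot>\<^bsub>N\<^esub> f x" if "P \<in> carrier D" for P
    using that
    by (induction rule: diff_ops_induct)
      (simp_all add: const deriv M.smult_l_distr N.smult_l_distr M.smult_assoc1 N.smult_assoc1
        M.smult_closed closed add)
  then show ?thesis using closed add by (auto simp: mod_hom_def M.smult_closed)
qed

lemma hom_group_simps:
  "carrier (hom_group R M N) = mod_hom R M N"
  "add (hom_group R M N) = (\<lambda>f g. \<lambda>x\<in>carrier M. f x \<oplus>\<^bsub>N\<^esub> g x)"
  by (simp_all add: hom_group_def)

text \<open>
  Currying is the usual bijection between balanced maps and homomorphisms into homomorphisms. It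
  respects the operators because \<open>f (d\<^sub>i (m \<otimes> n)) = f (d\<^sub>i m \<otimes> n) + f (m \<otimes> d\<^sub>i n)\<close> and
  \<open>d\<^sub>i (f (m \<otimes> n)) = (d\<^sub>i (\<phi> f m)) n + f (m \<otimes> d\<^sub>i n)\<close>: the left hand sides agree iff \<open>f\<close> commutes with \<open>d\<^sub>i\<close>
  on \<open>m \<otimes> n\<close>, and the right hand sides agree iff \<open>\<phi> f\<close> commutes with \<open>d\<^sub>i\<close> at \<open>m\<close>.
\<close>

lemma (in differential_ring) tensor_hom_adjunction:
  assumes L: "left_module D L" and M: "left_module D M" and N: "left_module D N"
  shows "(\<lambda>f. \<lambda>m\<in>carrier M. \<lambda>n\<in>carrier N. f (tens_ll A M N m n))
    \<in> iso (add_monoid (hom_group D (tensor_ll A M N) L)) (add_monoid (hom_group D M (hom_ll A N L)))"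
proof -
  interpret L: left_module D L by fact
  interpret MN: left_pair A M N by (intro left_pair.intro differential_ring_axioms M N)
  interpret NL: left_pair A N L by (intro left_pair.intro differential_ring_axioms N L)
  interpret M_NL: left_pair A M "hom_ll A N L"
    by (intro left_pair.intro differential_ring_axioms M NL.left_module_hom)
  interpret MN_L: left_pair A "tensor_ll A M N" L
    by (intro left_pair.intro differential_ring_axioms L MN.left_module_tensor)
  note c = MN.M.smult_closed MN.N.smult_closed L.smult_closed MN.tens_ll_closed op_const_closed op_d_closed
  let ?t = "tens_ll A M N" and ?T = "tensor_ll A M N"
  let ?\<phi> = "\<lambda>f. \<lambda>m\<in>carrier M. \<lambda>n\<in>carrier N. f (?t m n)"
  have into: "?\<phi> f \<in> mod_hom D M (hom_ll A N L)" if f: "f \<in> mod_hom D ?T L" for f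
  proof -
    note fD = mod_homD(1,2,3)[OF f, unfolded MN.tensor_ll_simps]
    have fc: "f (?t m n) \<in> carrier L" if "m \<in> carrier M" "n \<in> carrier N" for m n
      using fD(1) that by (simp add: c)
    have in_hom: "(\<lambda>n\<in>carrier N. f (?t m n)) \<in> mod_hom A (left_scalars A N) (left_scalars A L)"
      if m: "m \<in> carrier M" for m
      by (rule NL.hom_llI)
        (use m fc in \<open>simp_all add: MN.tens_ll_add_right MN.tens_ll_smult[symmetric]
          MN.tensor_ll_const[symmetric] fD c\<close>)
    show ?thesis
    proof (rule M_NL.linear_over_operators)
      fix m assume m: "m \<in> carrier M"
      show "(\<lambda>n\<in>carrier N. f (?t m n)) \<in> carrier (hom_ll A N L)" using in_hom[OF m] by simp
      show "(\<lambda>n\<in>carrier N. f (?t (m \<oplus>\<^bsub>M\<^esub> m') n))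
          = (\<lambda>n\<in>carrier N. f (?t m n)) \<oplus>\<^bsub>hom_ll A N L\<^esub> (\<lambda>n\<in>carrier N. f (?t m' n))"
        if m': "m' \<in> carrier M" for m'
        using m m' by (auto simp: fun_eq_iff restrict_def MN.tens_ll_add_left fD c)
      show "(\<lambda>n\<in>carrier N. f (?t (op_const A a \<odot>\<^bsub>M\<^esub> m) n))
          = op_const A a \<odot>\<^bsub>hom_ll A N L\<^esub> (\<lambda>n\<in>carrier N. f (?t m n))" if a: "a \<in> carrier A" for a
      proof (rule NL.P.mod_hom_eqI)
        show "(\<lambda>n\<in>carrier N. f (?t (op_const A a \<odot>\<^bsub>M\<^esub> m) n)) \<in> mod_hom A (left_scalars A N) (left_scalars A L)"
          by (rule in_hom) (use a m in \<open>simp add: c\<close>)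
        show "op_const A a \<odot>\<^bsub>hom_ll A N L\<^esub> (\<lambda>n\<in>carrier N. f (?t m n))
            \<in> mod_hom A (left_scalars A N) (left_scalars A L)"
          using NL.HL.smult_closed[of "op_const A a" "\<lambda>n\<in>carrier N. f (?t m n)"] in_hom[OF m] a by simp
        fix n assume "n \<in> carrier (left_scalars A N)"
        then have n: "n \<in> carrier N" by simp
        show "(\<lambda>n\<in>carrier N. f (?t (op_const A a \<odot>\<^bsub>M\<^esub> m) n)) n
            = (op_const A a \<odot>\<^bsub>hom_ll A N L\<^esub> (\<lambda>n\<in>carrier N. f (?t m n))) n"
          using NL.hom_ll_const[of "\<lambda>n\<in>carrier N. f (?t m n)" n a] in_hom[OF m] a m n
          by (simp add: MN.tensor_ll_const[symmetric] fD c)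
      qed
      show "(\<lambda>n\<in>carrier N. f (?t (op_d A i \<odot>\<^bsub>M\<^esub> m) n))
          = op_d A i \<odot>\<^bsub>hom_ll A N L\<^esub> (\<lambda>n\<in>carrier N. f (?t m n))" if i: "i < nder A" for i
      proof (rule NL.P.mod_hom_eqI)
        show "(\<lambda>n\<in>carrier N. f (?t (op_d A i \<odot>\<^bsub>M\<^esub> m) n)) \<in> mod_hom A (left_scalars A N) (left_scalars A L)"
          by (rule in_hom) (use i m in \<open>simp add: c\<close>)
        show "op_d A i \<odot>\<^bsub>hom_ll A N L\<^esub> (\<lambda>n\<in>carrier N. f (?t m n))
            \<in> mod_hom A (left_scalars A N) (left_scalars A L)"
          using NL.HL.smult_closed[of "op_d A i" "\<lambda>n\<in>carrier N. f (?t m n)"] in_hom[OF m] i by simp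
        fix n assume "n \<in> carrier (left_scalars A N)"
        then have n: "n \<in> carrier N" by simp
        have dm: "op_d A i \<odot>\<^bsub>M\<^esub> m \<in> carrier M" and dn: "op_d A i \<odot>\<^bsub>N\<^esub> n \<in> carrier N"
          using m n i by (simp_all add: c)
        have "op_d A i \<odot>\<^bsub>L\<^esub> f (?t m n) = f (op_d A i \<odot>\<^bsub>?T\<^esub> ?t m n)"
          using fD(3)[of "op_d A i" "?t m n"] m n i by (simp add: c)
        also have "\<dots> = f (?t (op_d A i \<odot>\<^bsub>M\<^esub> m) n) \<oplus>\<^bsub>L\<^esub> f (?t m (op_d A i \<odot>\<^bsub>N\<^esub> n))"
          using MN.tensor_ll_d[OF m n i] m n dm dn by (simp add: fD c)
        finally have "op_d A i \<odot>\<^bsub>L\<^esub> f (?t m n) \<ominus>\<^bsub>L\<^esub> f (?t m (op_d A i \<odot>\<^bsub>N\<^esub> n))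
            = f (?t (op_d A i \<odot>\<^bsub>M\<^esub> m) n)"
          using fc[OF dm n] fc[OF m dn] by (simp add: L.M.minus_eq L.M.a_assoc L.M.r_neg)
        then show "(\<lambda>n\<in>carrier N. f (?t (op_d A i \<odot>\<^bsub>M\<^esub> m) n)) n
            = (op_d A i \<odot>\<^bsub>hom_ll A N L\<^esub> (\<lambda>n\<in>carrier N. f (?t m n))) n"
          using NL.hom_ll_d[of "\<lambda>n\<in>carrier N. f (?t m n)" n i] in_hom[OF m] i m n dn by simp
      qed
    qed
  qed
  have hom: "?\<phi> \<in> hom (add_monoid (hom_group D ?T L)) (add_monoid (hom_group D M (hom_ll A N L)))"
  proof (rule homI)
    show "?\<phi> f \<in> carrier (add_monoid (hom_group D M (hom_ll A N L)))"
      if "f \<in> carrier (add_monoid (hom_group D ?T L))" for f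
      using into[of f] that by (simp add: hom_group_simps)
    show "?\<phi> (f \<otimes>\<^bsub>add_monoid (hom_group D ?T L)\<^esub> g)
        = ?\<phi> f \<otimes>\<^bsub>add_monoid (hom_group D M (hom_ll A N L))\<^esub> ?\<phi> g" for f g
      by (auto simp: hom_group_simps fun_eq_iff c)
  qed
  have inj: "inj_on ?\<phi> (mod_hom D ?T L)"
  proof (rule inj_onI)
    fix f g assume f: "f \<in> mod_hom D ?T L" and g: "g \<in> mod_hom D ?T L" and eq: "?\<phi> f = ?\<phi> g"
    have pure_eq: "f (?t m n) = g (?t m n)" if "m \<in> carrier M" "n \<in> carrier N" for m n
      using fun_cong[OF fun_cong[OF eq, of m], of n] that by simp
    have "f X = g X" if "X \<in> carrier MN.P.T" for X
      by (rule MN.P.tensor_ext[OF L.M.abelian_group_axioms, where X = X and f = f and g = g])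
        (use that pure_eq mod_homD(1,2)[OF f] mod_homD(1,2)[OF g] in \<open>auto simp: hom_def\<close>)
    then show "f = g"
      using mod_homD(4)[OF f] mod_homD(4)[OF g] by (auto intro: extensionalityI)
  qed
  have surj: "h \<in> ?\<phi> ` mod_hom D ?T L" if h: "h \<in> mod_hom D M (hom_ll A N L)" for h
  proof -
    note hD = mod_homD[OF h]
    have hm: "h m \<in> mod_hom A (left_scalars A N) (left_scalars A L)" if "m \<in> carrier M" for m
      using hD(1)[OF that] by simp
    note hmD = NL.hom_llD[OF hm]
    have h_const: "h (op_const A a \<odot>\<^bsub>M\<^esub> m) n = op_const A a \<odot>\<^bsub>L\<^esub> h m n"
      if "a \<in> carrier A" "m \<in> carrier M" "n \<in> carrier N" for a m n
      using hD(3)[of "op_const A a" m] NL.hom_ll_const[of "h m" n a] hD(1)[of m] that by simp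
    have h_d: "h (op_d A i \<odot>\<^bsub>M\<^esub> m) n = op_d A i \<odot>\<^bsub>L\<^esub> h m n \<ominus>\<^bsub>L\<^esub> h m (op_d A i \<odot>\<^bsub>N\<^esub> n)"
      if "i < nder A" "m \<in> carrier M" "n \<in> carrier N" for i m n
      using hD(3)[of "op_d A i" m] NL.hom_ll_d[of "h m" n i] hD(1)[of m] that by simp
    let ?l = "tensor_lift L (\<lambda>m n. h m n)"
    have bal: "MN.P.balanced L (\<lambda>m n. h m n)"
      unfolding MN.P.balanced_def by (auto simp: hmD hD(2) h_const)
    note lift = MN.P.tensor_lift_universal[OF L.M.abelian_group_axioms bal]
    have lc: "?l X \<in> carrier L" if "X \<in> carrier MN.P.T" for X
      using lift(1) that by (auto simp: hom_def)
    have la: "?l (X \<oplus>\<^bsub>MN.P.T\<^esub> Y) = ?l X \<oplus>\<^bsub>L\<^esub> ?l Y" if "X \<in> carrier MN.P.T" "Y \<in> carrier MN.P.T" for X Y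
      using lift(1) that by (auto simp: hom_def)
    have lt: "?l (?t m n) = h m n" if "m \<in> carrier M" "n \<in> carrier N" for m n
      using lift(2) that by simp
    have gen: "?l (P \<odot>\<^bsub>?T\<^esub> X) = P \<odot>\<^bsub>L\<^esub> ?l X"
      if P: "P \<in> carrier D" and X: "X \<in> carrier MN.P.T"
        and pure: "\<And>m n. m \<in> carrier M \<Longrightarrow> n \<in> carrier N \<Longrightarrow> ?l (P \<odot>\<^bsub>?T\<^esub> ?t m n) = P \<odot>\<^bsub>L\<^esub> h m n" for P X
      using MN.TL.smult_closed[OF P] MN.TL.smult_r_distr[OF P]
      by (intro MN.P.tensor_ext[OF L.M.abelian_group_axioms, where X = X
            and f = "\<lambda>X. ?l (P \<odot>\<^bsub>?T\<^esub> X)" and g = "\<lambda>X. P \<odot>\<^bsub>L\<^esub> ?l X"])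
        (auto simp: X hom_def lc la lt pure P L.smult_closed L.smult_r_distr)
    have l: "(\<lambda>X\<in>carrier ?T. ?l X) \<in> mod_hom D ?T L"
    proof (rule MN_L.linear_over_operators)
      show "?l (op_const A a \<odot>\<^bsub>?T\<^esub> X) = op_const A a \<odot>\<^bsub>L\<^esub> ?l X" if "a \<in> carrier A" "X \<in> carrier ?T" for a X
        by (rule gen) (use that in \<open>simp_all add: MN.tensor_ll_const lt c h_const\<close>)
      show "?l (op_d A i \<odot>\<^bsub>?T\<^esub> X) = op_d A i \<odot>\<^bsub>L\<^esub> ?l X" if "i < nder A" "X \<in> carrier ?T" for i X
        by (rule gen)
          (use that in \<open>simp_all add: MN.tensor_ll_d la lt c h_d hmD L.M.minus_eq L.M.a_assoc L.M.l_neg\<close>)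
    qed (simp_all add: lc la)
    have "h = ?\<phi> (\<lambda>X\<in>carrier ?T. ?l X)"
    proof (rule extensionalityI[OF hD(4)])
      fix m assume m: "m \<in> carrier M"
      show "h m = ?\<phi> (\<lambda>X\<in>carrier ?T. ?l X) m"
        using m by (auto intro!: extensionalityI[OF hmD(4)[OF m]] simp: lt c)
    qed simp
    then show ?thesis using l by blast
  qed
  show ?thesis
    unfolding iso_iff
  proof (intro conjI hom)
    show "?\<phi> ` carrier (add_monoid (hom_group D ?T L)) = carrier (add_monoid (hom_group D M (hom_ll A N L)))"
      using into surj by (auto simp: hom_group_simps)
    show "inj_on ?\<phi> (carrier (add_monoid (hom_group D ?T L)))"
      using inj by (simp add: hom_group_simps)
  qed
qed


lemma (in differential_ring) left_module_regular: "left_module D (regular_module A)"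
proof -
  interpret D: ring D by (rule ring_diff_ops)
  show ?thesis
    by (intro left_module.intro left_module_axioms.intro D.ring_axioms
        abelian_group_cong[OF D.abelian_group_axioms])
      (simp_all add: regular_module_def D.l_distr D.r_distr D.m_assoc)
qed

lemma regular_module_simps [simp]:
  "carrier (regular_module A) = carrier (diff_ops A)" "add (regular_module A) = add (diff_ops A)"
  "smult (regular_module A) = mult (diff_ops A)"
  by (simp_all add: regular_module_def)

text \<open>
  The obvious candidate \<open>P \<mapsto> f (P x)\<close> does not depend on \<open>x\<close> in a \<open>D\<close>-linear way. The correct one is forced:
  if \<open>h\<close> is \<open>D\<close>-linear, then \<open>h (d\<^sub>i x) P = \<partial>\<^sub>i (h x P) - h x (d\<^sub>i P)\<close> determines \<open>h x (d\<^sub>i P)\<close> from the maps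
  \<open>y \<mapsto> h y P\<close>, as the value at \<open>x\<close> of the Spencer operator applied to \<open>y \<mapsto> h y P\<close>. Starting from
  \<open>f = (y \<mapsto> h y 1)\<close> one obtains \<open>h x P = (P f) x\<close>, where \<open>P\<close> acts on \<open>f\<close> in the left module \<open>hom\<^sub>A(M, A)\<close>.
\<close>

lemma (in differential_ring) hom_dual_iso:
  assumes M: "left_module D M"
  shows "\<exists>\<phi> \<in> iso (add_monoid (hom_ll A M (base_module A)))
      (add_monoid (hom_group D M (dual_ops A))).
    \<forall>f\<in>carrier (hom_ll A M (base_module A)). \<forall>x\<in>carrier M. \<phi> f x \<one>\<^bsub>D\<^esub> = f x"
proof -
  interpret D: ring D by (rule ring_diff_ops)
  interpret MA: left_pair A M "base_module A"
    by (intro left_pair.intro differential_ring_axioms M left_module_base)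
  interpret DA: left_pair A "regular_module A" "base_module A"
    by (intro left_pair.intro differential_ring_axioms left_module_regular left_module_base)
  interpret MDA: left_pair A M "dual_ops A"
    by (intro left_pair.intro differential_ring_axioms M DA.left_module_hom)
  let ?R = "hom_ll A M (base_module A)" and ?B = "base_module A"
  let ?\<phi> = "\<lambda>f. \<lambda>x\<in>carrier M. \<lambda>P\<in>carrier D. (P \<odot>\<^bsub>?R\<^esub> f) x"
  have Rc: "P \<odot>\<^bsub>?R\<^esub> f \<in> carrier ?R" if "P \<in> carrier D" "f \<in> carrier ?R" for P f
    using MA.HL.smult_closed that .
  have Rx: "f x \<in> carrier A" if "f \<in> carrier ?R" "x \<in> carrier M" for f x
    using MA.hom_llD(1)[of f x] that by simp
  have R_add: "f (x \<oplus>\<^bsub>M\<^esub> y) = f x \<oplus> f y" if "f \<in> carrier ?R" "x \<in> carrier M" "y \<in> carrier M" for f x y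
    using MA.hom_llD(2)[of f x y] that by simp
  have R_const: "f (op_const A a \<odot>\<^bsub>M\<^esub> x) = op_const A a \<odot>\<^bsub>?B\<^esub> f x"
    if "f \<in> carrier ?R" "a \<in> carrier A" "x \<in> carrier M" for f a x
    using MA.hom_llD(3)[of f a x] that by simp
  have dual_eqI: "u = v" if "u \<in> carrier (dual_ops A)" "v \<in> carrier (dual_ops A)"
    "\<And>P. P \<in> carrier D \<Longrightarrow> u P = v P" for u v
    using that DA.P.mod_hom_eqI[of u v] by simp
  have in_dual: "(\<lambda>P\<in>carrier D. (P \<odot>\<^bsub>?R\<^esub> f) x) \<in> carrier (dual_ops A)"
    if f: "f \<in> carrier ?R" and x: "x \<in> carrier M" for f x
  proof -
    have "(\<lambda>P\<in>carrier (regular_module A). (P \<odot>\<^bsub>?R\<^esub> f) x)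
        \<in> mod_hom A (left_scalars A (regular_module A)) (left_scalars A ?B)"
    proof (rule DA.hom_llI)
      fix P assume P: "P \<in> carrier (regular_module A)"
      then show "(P \<odot>\<^bsub>?R\<^esub> f) x \<in> carrier ?B" using Rx[OF Rc[OF _ f] x] by simp
      show "((P \<oplus>\<^bsub>regular_module A\<^esub> Q) \<odot>\<^bsub>?R\<^esub> f) x = (P \<odot>\<^bsub>?R\<^esub> f) x \<oplus>\<^bsub>?B\<^esub> (Q \<odot>\<^bsub>?R\<^esub> f) x"
        if "Q \<in> carrier (regular_module A)" for Q
        using MA.HL.smult_l_distr[OF _ _ f, of P Q] P that x by simp
      show "((op_const A a \<odot>\<^bsub>regular_module A\<^esub> P) \<odot>\<^bsub>?R\<^esub> f) x = op_const A a \<odot>\<^bsub>?B\<^esub> (P \<odot>\<^bsub>?R\<^esub> f) x"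
        if "a \<in> carrier A" for a
        using MA.HL.smult_assoc1[OF _ _ f, of "op_const A a" P] MA.hom_ll_const[OF Rc[OF _ f] x, of P a]
          P that by simp
    qed
    then show ?thesis by simp
  qed
  have into: "?\<phi> f \<in> mod_hom D M (dual_ops A)" if f: "f \<in> carrier ?R" for f
  proof (rule MDA.linear_over_operators)
    fix x assume x: "x \<in> carrier M"
    show "(\<lambda>P\<in>carrier D. (P \<odot>\<^bsub>?R\<^esub> f) x) \<in> carrier (dual_ops A)" by (rule in_dual[OF f x])
    show "(\<lambda>P\<in>carrier D. (P \<odot>\<^bsub>?R\<^esub> f) (x \<oplus>\<^bsub>M\<^esub> y))
        = (\<lambda>P\<in>carrier D. (P \<odot>\<^bsub>?R\<^esub> f) x) \<oplus>\<^bsub>dual_ops A\<^esub> (\<lambda>P\<in>carrier D. (P \<odot>\<^bsub>?R\<^esub> f) y)"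
      if "y \<in> carrier M" for y
      using x that by (auto simp: fun_eq_iff R_add[OF Rc[OF _ f]])
    show "(\<lambda>P\<in>carrier D. (P \<odot>\<^bsub>?R\<^esub> f) (op_const A a \<odot>\<^bsub>M\<^esub> x))
        = op_const A a \<odot>\<^bsub>dual_ops A\<^esub> (\<lambda>P\<in>carrier D. (P \<odot>\<^bsub>?R\<^esub> f) x)" if a: "a \<in> carrier A" for a
    proof (rule dual_eqI)
      show "(\<lambda>P\<in>carrier D. (P \<odot>\<^bsub>?R\<^esub> f) (op_const A a \<odot>\<^bsub>M\<^esub> x)) \<in> carrier (dual_ops A)"
        by (rule in_dual[OF f]) (use a x in \<open>simp add: MA.M.smult_closed\<close>)
      show "op_const A a \<odot>\<^bsub>dual_ops A\<^esub> (\<lambda>P\<in>carrier D. (P \<odot>\<^bsub>?R\<^esub> f) x) \<in> carrier (dual_ops A)"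
        by (rule DA.HL.smult_closed[OF _ in_dual[OF f x]]) (use a in simp)
      fix P assume P: "P \<in> carrier D"
      show "(\<lambda>P\<in>carrier D. (P \<odot>\<^bsub>?R\<^esub> f) (op_const A a \<odot>\<^bsub>M\<^esub> x)) P
          = (op_const A a \<odot>\<^bsub>dual_ops A\<^esub> (\<lambda>P\<in>carrier D. (P \<odot>\<^bsub>?R\<^esub> f) x)) P"
        using DA.hom_ll_const[OF in_dual[OF f x], of P a] R_const[OF Rc[OF P f] a x] P a by simp
    qed
    show "(\<lambda>P\<in>carrier D. (P \<odot>\<^bsub>?R\<^esub> f) (op_d A i \<odot>\<^bsub>M\<^esub> x))
        = op_d A i \<odot>\<^bsub>dual_ops A\<^esub> (\<lambda>P\<in>carrier D. (P \<odot>\<^bsub>?R\<^esub> f) x)" if i: "i < nder A" for i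
    proof (rule dual_eqI)
      have dx: "op_d A i \<odot>\<^bsub>M\<^esub> x \<in> carrier M" using i x by (simp add: MA.M.smult_closed)
      show "(\<lambda>P\<in>carrier D. (P \<odot>\<^bsub>?R\<^esub> f) (op_d A i \<odot>\<^bsub>M\<^esub> x)) \<in> carrier (dual_ops A)"
        by (rule in_dual[OF f dx])
      show "op_d A i \<odot>\<^bsub>dual_ops A\<^esub> (\<lambda>P\<in>carrier D. (P \<odot>\<^bsub>?R\<^esub> f) x) \<in> carrier (dual_ops A)"
        by (rule DA.HL.smult_closed[OF _ in_dual[OF f x]]) (use i in simp)
      fix P assume P: "P \<in> carrier D"
      let ?u = "(P \<odot>\<^bsub>?R\<^esub> f) x" and ?v = "(P \<odot>\<^bsub>?R\<^esub> f) (op_d A i \<odot>\<^bsub>M\<^esub> x)"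
      \<comment> \<open>Two subtractions cancel: \<open>(d\<^sub>i P) f\<close> contributes the Spencer operator of \<open>P f\<close>, and the action on
        the dual subtracts this from \<open>\<partial>\<^sub>i\<close> of the value at \<open>P\<close>.\<close>
      have uv: "\<partial> i ?u \<in> carrier A" "?u \<in> carrier A" "?v \<in> carrier A"
        using Rx[OF Rc[OF P f]] x dx i der_closed by auto
      have "((op_d A i \<otimes>\<^bsub>D\<^esub> P) \<odot>\<^bsub>?R\<^esub> f) x = \<partial> i ?u \<ominus> ?v"
        using MA.HL.smult_assoc1[OF op_d_closed[OF i] P f] MA.hom_ll_d[OF Rc[OF P f] x i]
          base_module_generators(2)[OF uv(2) i] by simp
      then have "(op_d A i \<odot>\<^bsub>dual_ops A\<^esub> (\<lambda>P\<in>carrier D. (P \<odot>\<^bsub>?R\<^esub> f) x)) P = \<partial> i ?u \<ominus> (\<partial> i ?u \<ominus> ?v)"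
        using DA.hom_ll_d[OF in_dual[OF f x], of P i] base_module_generators(2)[OF uv(2) i] P i by simp
      also have "\<dots> = ?v"
        using uv by (simp add: minus_eq minus_add r_neg2 a_assoc[symmetric] r_neg)
      finally show "(\<lambda>P\<in>carrier D. (P \<odot>\<^bsub>?R\<^esub> f) (op_d A i \<odot>\<^bsub>M\<^esub> x)) P
          = (op_d A i \<odot>\<^bsub>dual_ops A\<^esub> (\<lambda>P\<in>carrier D. (P \<odot>\<^bsub>?R\<^esub> f) x)) P"
        using P by simp
    qed
  qed
  have at_one: "?\<phi> f x \<one>\<^bsub>D\<^esub> = f x" if "f \<in> carrier ?R" "x \<in> carrier M" for f x
    using MA.HL.smult_one[of f] that by simp
  have hom: "?\<phi> \<in> hom (add_monoid ?R) (add_monoid (hom_group D M (dual_ops A)))"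
  proof (rule homI)
    show "?\<phi> f \<in> carrier (add_monoid (hom_group D M (dual_ops A)))" if "f \<in> carrier (add_monoid ?R)" for f
      using into[of f] that by (simp add: hom_group_simps)
    show "?\<phi> (f \<otimes>\<^bsub>add_monoid ?R\<^esub> g) = ?\<phi> f \<otimes>\<^bsub>add_monoid (hom_group D M (dual_ops A))\<^esub> ?\<phi> g"
      if "f \<in> carrier (add_monoid ?R)" "g \<in> carrier (add_monoid ?R)" for f g
      using MA.HL.smult_r_distr[of _ f g] that by (auto simp: hom_group_simps fun_eq_iff)
  qed
  have inj: "inj_on ?\<phi> (carrier ?R)"
  proof (rule inj_onI)
    fix f g assume f: "f \<in> carrier ?R" and g: "g \<in> carrier ?R" and eq: "?\<phi> f = ?\<phi> g"
    have "f x = g x" if "x \<in> carrier M" for x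
      using at_one[OF f that] at_one[OF g that] eq by simp
    then show "f = g" using MA.P.mod_hom_eqI[of f g] f g by simp
  qed
  have surj: "h \<in> ?\<phi> ` carrier ?R" if h: "h \<in> mod_hom D M (dual_ops A)" for h
  proof -
    note hD = mod_homD[OF h]
    have hx: "h x \<in> mod_hom A (left_scalars A (regular_module A)) (left_scalars A ?B)"
      if "x \<in> carrier M" for x
      using hD(1)[OF that] by simp
    note hxD = DA.hom_llD[OF hx, unfolded regular_module_simps base_module_simps]
    \<comment> \<open>\<open>P \<mapsto> ev P\<close> turns out to be \<open>D\<close>-linear, hence is determined by its value at \<open>1\<close>.\<close>
    define ev where "ev P = (\<lambda>x\<in>carrier M. h x P)" for P
    have ev: "ev P \<in> carrier ?R" if P: "P \<in> carrier D" for P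
    proof -
      have "ev P \<in> mod_hom A (left_scalars A M) (left_scalars A ?B)"
        unfolding ev_def
      proof (rule MA.hom_llI)
        fix x assume x: "x \<in> carrier M"
        show "h x P \<in> carrier ?B" using hxD(1)[OF x P] by simp
        show "h (x \<oplus>\<^bsub>M\<^esub> y) P = h x P \<oplus>\<^bsub>?B\<^esub> h y P" if "y \<in> carrier M" for y
          using hD(2)[OF x that] P by simp
        show "h (op_const A a \<odot>\<^bsub>M\<^esub> x) P = op_const A a \<odot>\<^bsub>?B\<^esub> h x P" if "a \<in> carrier A" for a
          using hD(3)[of "op_const A a" x] DA.hom_ll_const[of "h x" P a] hD(1)[OF x] x P that by simp
      qed
      then show ?thesis by simp
    qed
    have ev_eqI: "u = v" if "u \<in> carrier ?R" "v \<in> carrier ?R" "\<And>x. x \<in> carrier M \<Longrightarrow> u x = v x" for u v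
      using MA.P.mod_hom_eqI[of u v] that by simp
    have ev_mult: "\<forall>P\<in>carrier D. ev (Q \<otimes>\<^bsub>D\<^esub> P) = Q \<odot>\<^bsub>?R\<^esub> ev P" if "Q \<in> carrier D" for Q
      using that
    proof (induction rule: diff_ops_induct)
      case (const a)
      show ?case
      proof
        fix P assume P: "P \<in> carrier D"
        show "ev (op_const A a \<otimes>\<^bsub>D\<^esub> P) = op_const A a \<odot>\<^bsub>?R\<^esub> ev P"
        proof (rule ev_eqI)
          fix x assume x: "x \<in> carrier M"
          show "ev (op_const A a \<otimes>\<^bsub>D\<^esub> P) x = (op_const A a \<odot>\<^bsub>?R\<^esub> ev P) x"
            using MA.hom_ll_const[OF ev[OF P] x const] hxD(3)[OF x const P] x by (simp add: ev_def)
        qed ((rule ev Rc[OF _ ev]; use P const in simp)+)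
      qed
    next
      case (deriv i)
      show ?case
      proof
        fix P assume P: "P \<in> carrier D"
        show "ev (op_d A i \<otimes>\<^bsub>D\<^esub> P) = op_d A i \<odot>\<^bsub>?R\<^esub> ev P"
        proof (rule ev_eqI)
          fix x assume x: "x \<in> carrier M"
          have dP: "op_d A i \<otimes>\<^bsub>D\<^esub> P \<in> carrier D" using P deriv by simp
          have dx: "op_d A i \<odot>\<^bsub>M\<^esub> x \<in> carrier M" using x deriv by (simp add: MA.M.smult_closed)
          have "h (op_d A i \<odot>\<^bsub>M\<^esub> x) P = op_d A i \<odot>\<^bsub>?B\<^esub> h x P \<ominus> h x (op_d A i \<otimes>\<^bsub>D\<^esub> P)"
            using hD(3)[of "op_d A i" x] DA.hom_ll_d[of "h x" P i] hD(1)[OF x] x P deriv by simp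
          moreover have "op_d A i \<odot>\<^bsub>?B\<^esub> h x P \<in> carrier A"
            using MA.N.smult_closed[of "op_d A i" "h x P"] hxD(1)[OF x P] deriv by simp
          ultimately have "h x (op_d A i \<otimes>\<^bsub>D\<^esub> P) = op_d A i \<odot>\<^bsub>?B\<^esub> h x P \<ominus> h (op_d A i \<odot>\<^bsub>M\<^esub> x) P"
            using hxD(1)[OF x dP] by (simp add: minus_eq minus_add a_assoc[symmetric] r_neg)
          then show "ev (op_d A i \<otimes>\<^bsub>D\<^esub> P) x = (op_d A i \<odot>\<^bsub>?R\<^esub> ev P) x"
            using MA.hom_ll_d[OF ev[OF P] x deriv] x dx by (simp add: ev_def)
        qed ((rule ev Rc[OF _ ev]; use P deriv in simp)+)
      qed
    next
      case (add Q S)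
      show ?case
      proof
        fix P assume P: "P \<in> carrier D"
        have "ev ((Q \<oplus>\<^bsub>D\<^esub> S) \<otimes>\<^bsub>D\<^esub> P) = ev (Q \<otimes>\<^bsub>D\<^esub> P) \<oplus>\<^bsub>?R\<^esub> ev (S \<otimes>\<^bsub>D\<^esub> P)"
          using add.hyps P by (auto simp: ev_def fun_eq_iff D.l_distr hxD(2))
        also have "\<dots> = (Q \<oplus>\<^bsub>D\<^esub> S) \<odot>\<^bsub>?R\<^esub> ev P"
          using add P MA.HL.smult_l_distr[OF add.hyps ev[OF P]] by simp
        finally show "ev ((Q \<oplus>\<^bsub>D\<^esub> S) \<otimes>\<^bsub>D\<^esub> P) = (Q \<oplus>\<^bsub>D\<^esub> S) \<odot>\<^bsub>?R\<^esub> ev P" .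
      qed
    next
      case (mult Q S)
      show ?case
      proof
        fix P assume P: "P \<in> carrier D"
        show "ev ((Q \<otimes>\<^bsub>D\<^esub> S) \<otimes>\<^bsub>D\<^esub> P) = (Q \<otimes>\<^bsub>D\<^esub> S) \<odot>\<^bsub>?R\<^esub> ev P"
          using mult P MA.HL.smult_assoc1[OF mult.hyps ev[OF P]] by (simp add: D.m_assoc)
      qed
    qed
    have "h = ?\<phi> (ev \<one>\<^bsub>D\<^esub>)"
    proof (rule extensionalityI[OF hD(4)])
      fix x assume x: "x \<in> carrier M"
      show "h x = ?\<phi> (ev \<one>\<^bsub>D\<^esub>) x"
      proof (rule extensionalityI[OF hxD(4)[OF x]])
        fix P assume P: "P \<in> carrier D"
        have "P \<odot>\<^bsub>?R\<^esub> ev \<one>\<^bsub>D\<^esub> = ev P" using bspec[OF ev_mult[OF P] D.one_closed] P by simp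
        then show "h x P = ?\<phi> (ev \<one>\<^bsub>D\<^esub>) x P" using x P by (simp add: ev_def)
      qed (use x in simp)
    qed simp
    then show ?thesis using ev[OF D.one_closed] by blast
  qed
  have "?\<phi> \<in> iso (add_monoid ?R) (add_monoid (hom_group D M (dual_ops A)))"
    unfolding iso_iff
  proof (intro conjI hom)
    show "?\<phi> ` carrier (add_monoid ?R) = carrier (add_monoid (hom_group D M (dual_ops A)))"
      using into surj by (auto simp: hom_group_simps simp del: MA.hom_ll_simps)
    show "inj_on ?\<phi> (carrier (add_monoid ?R))" using inj by simp
  qed
  then show ?thesis by (rule bexI[rotated]) (intro ballI at_one)
qed


section \<open>The module structures and isomorphisms\<close>

lemma (in left_pair) left_pair_structures:
  "left_module D (hom_ll A M N) \<and>
    (\<forall>f\<in>carrier (hom_ll A M N). \<forall>x\<in>carrier M.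
      (\<forall>a\<in>carrier A.
        (op_const A a \<odot>\<^bsub>hom_ll A M N\<^esub> f) x = op_const A a \<odot>\<^bsub>N\<^esub> f x \<and>
        (op_const A a \<odot>\<^bsub>hom_ll A M N\<^esub> f) x = f (op_const A a \<odot>\<^bsub>M\<^esub> x)) \<and>
      (\<forall>\<xi>\<in>op_T A.
        (\<xi> \<odot>\<^bsub>hom_ll A M N\<^esub> f) x = \<xi> \<odot>\<^bsub>N\<^esub> f x \<ominus>\<^bsub>N\<^esub> f (\<xi> \<odot>\<^bsub>M\<^esub> x))) \<and>
    left_module D (tensor_ll A M N) \<and>
    (\<forall>x\<in>carrier M. \<forall>y\<in>carrier N.
      (\<forall>a\<in>carrier A.
        op_const A a \<odot>\<^bsub>tensor_ll A M N\<^esub> tens_ll A M N x y = tens_ll A M N (op_const A a \<odot>\<^bsub>M\<^esub> x) y \<and>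
        op_const A a \<odot>\<^bsub>tensor_ll A M N\<^esub> tens_ll A M N x y = tens_ll A M N x (op_const A a \<odot>\<^bsub>N\<^esub> y)) \<and>
      (\<forall>\<xi>\<in>op_T A.
        \<xi> \<odot>\<^bsub>tensor_ll A M N\<^esub> tens_ll A M N x y =
          tens_ll A M N (\<xi> \<odot>\<^bsub>M\<^esub> x) y \<oplus>\<^bsub>tensor_ll A M N\<^esub> tens_ll A M N x (\<xi> \<odot>\<^bsub>N\<^esub> y)))"
proof (intro conjI ballI)
  fix f x a assume f: "f \<in> carrier (hom_ll A M N)" and x: "x \<in> carrier M" and a: "a \<in> carrier A"
  show "(op_const A a \<odot>\<^bsub>hom_ll A M N\<^esub> f) x = f (op_const A a \<odot>\<^bsub>M\<^esub> x)"
    using hom_ll_const[OF f x a] hom_llD(3)[of f a x] f x a by simp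
next
  fix x y a assume "x \<in> carrier M" "y \<in> carrier N" "a \<in> carrier A"
  then show "op_const A a \<odot>\<^bsub>tensor_ll A M N\<^esub> tens_ll A M N x y = tens_ll A M N x (op_const A a \<odot>\<^bsub>N\<^esub> y)"
    by (simp add: tensor_ll_const tens_ll_smult)
qed (rule left_module_hom left_module_tensor hom_ll_const hom_ll_T tensor_ll_const tensor_ll_T;
    assumption)+

lemma (in right_pair) right_pair_structures:
  "left_module D (hom_rr A M N) \<and>
    (\<forall>f\<in>carrier (hom_rr A M N). \<forall>x\<in>carrier M.
      (\<forall>a\<in>carrier A.
        (op_const A a \<odot>\<^bsub>hom_rr A M N\<^esub> f) x = f x \<boxdot>\<^bsub>N\<^esub> op_const A a \<and>
        (op_const A a \<odot>\<^bsub>hom_rr A M N\<^esub> f) x = f (x \<boxdot>\<^bsub>M\<^esub> op_const A a)) \<and>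
      (\<forall>\<xi>\<in>op_T A.
        (\<xi> \<odot>\<^bsub>hom_rr A M N\<^esub> f) x = f (x \<boxdot>\<^bsub>M\<^esub> \<xi>) \<ominus>\<^bsub>N\<^esub> f x \<boxdot>\<^bsub>N\<^esub> \<xi>))"
proof (intro conjI ballI)
  fix f x a assume f: "f \<in> carrier (hom_rr A M N)" and x: "x \<in> carrier M" and a: "a \<in> carrier A"
  show "(op_const A a \<odot>\<^bsub>hom_rr A M N\<^esub> f) x = f (x \<boxdot>\<^bsub>M\<^esub> op_const A a)"
    using hom_rr_const[OF f x a] hom_rrD(3)[of f a x] f x a by simp
qed (rule left_module_hom_rr hom_rr_const hom_rr_T; assumption)+

lemma (in left_right_pair) left_right_pair_structures:
  "right_module D (tensor_lr A M N) \<and>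
    (\<forall>x\<in>carrier M. \<forall>y\<in>carrier N.
      (\<forall>a\<in>carrier A.
        tens_lr A M N x y \<boxdot>\<^bsub>tensor_lr A M N\<^esub> op_const A a = tens_lr A M N (op_const A a \<odot>\<^bsub>M\<^esub> x) y \<and>
        tens_lr A M N x y \<boxdot>\<^bsub>tensor_lr A M N\<^esub> op_const A a = tens_lr A M N x (y \<boxdot>\<^bsub>N\<^esub> op_const A a)) \<and>
      (\<forall>\<xi>\<in>op_T A.
        tens_lr A M N x y \<boxdot>\<^bsub>tensor_lr A M N\<^esub> \<xi> =
          tens_lr A M N x (y \<boxdot>\<^bsub>N\<^esub> \<xi>) \<ominus>\<^bsub>tensor_lr A M N\<^esub> tens_lr A M N (\<xi> \<odot>\<^bsub>M\<^esub> x) y))"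
proof (intro conjI ballI)
  fix x y a assume "x \<in> carrier M" "y \<in> carrier N" "a \<in> carrier A"
  then show "tens_lr A M N x y \<boxdot>\<^bsub>tensor_lr A M N\<^esub> op_const A a = tens_lr A M N x (y \<boxdot>\<^bsub>N\<^esub> op_const A a)"
    by (simp add: tensor_lr_const tens_lr_smult)
qed (rule right_module_tensor_lr tensor_lr_const tensor_lr_T; assumption)+

lemma (in differential_ring) spencer_operator:
  assumes M: "left_module D M"
  shows "left_module D (hom_ll A M (base_module A)) \<and>
    (\<forall>f\<in>carrier (hom_ll A M (base_module A)). \<forall>x\<in>carrier M. \<forall>i<nder A.
      (op_d A i \<odot>\<^bsub>hom_ll A M (base_module A)\<^esub> f) x = \<partial> i (f x) \<ominus> f (op_d A i \<odot>\<^bsub>M\<^esub> x))"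
proof -
  interpret MA: left_pair A M "base_module A"
    by (intro left_pair.intro differential_ring_axioms M left_module_base)
  show ?thesis
  proof (intro conjI ballI allI impI MA.left_module_hom)
    fix f x i
    assume f: "f \<in> carrier (hom_ll A M (base_module A))" and x: "x \<in> carrier M" and i: "i < nder A"
    have "f x \<in> carrier A" using MA.hom_llD(1)[of f x] f x by simp
    then show "(op_d A i \<odot>\<^bsub>hom_ll A M (base_module A)\<^esub> f) x = \<partial> i (f x) \<ominus> f (op_d A i \<odot>\<^bsub>M\<^esub> x)"
      using MA.hom_ll_d[OF f x i] i by (simp add: base_module_generators(2))
  qed
qed

theorem theorem3p15:
  fixes A :: "'a diff_ring"
  assumes "differential_ring A"
  shows
    \<comment> \<open>(a)\<close>
    "(\<forall>(M :: ('a diff_op, 'm) module) (N :: ('a diff_op, 'n) module).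
        left_module (diff_ops A) M \<and> left_module (diff_ops A) N \<longrightarrow>
        left_module (diff_ops A) (hom_ll A M N) \<and>
        (\<forall>f\<in>carrier (hom_ll A M N). \<forall>x\<in>carrier M.
          (\<forall>a\<in>carrier A.
            (op_const A a \<odot>\<^bsub>hom_ll A M N\<^esub> f) x = op_const A a \<odot>\<^bsub>N\<^esub> f x \<and>
            (op_const A a \<odot>\<^bsub>hom_ll A M N\<^esub> f) x = f (op_const A a \<odot>\<^bsub>M\<^esub> x)) \<and>
          (\<forall>\<xi>\<in>op_T A.
            (\<xi> \<odot>\<^bsub>hom_ll A M N\<^esub> f) x = \<xi> \<odot>\<^bsub>N\<^esub> f x \<ominus>\<^bsub>N\<^esub> f (\<xi> \<odot>\<^bsub>M\<^esub> x))) \<and>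
        left_module (diff_ops A) (tensor_ll A M N) \<and>
        (\<forall>x\<in>carrier M. \<forall>y\<in>carrier N.
          (\<forall>a\<in>carrier A.
            op_const A a \<odot>\<^bsub>tensor_ll A M N\<^esub> tens_ll A M N x y = tens_ll A M N (op_const A a \<odot>\<^bsub>M\<^esub> x) y \<and>
            op_const A a \<odot>\<^bsub>tensor_ll A M N\<^esub> tens_ll A M N x y = tens_ll A M N x (op_const A a \<odot>\<^bsub>N\<^esub> y)) \<and>
          (\<forall>\<xi>\<in>op_T A.
            \<xi> \<odot>\<^bsub>tensor_ll A M N\<^esub> tens_ll A M N x y =
              tens_ll A M N (\<xi> \<odot>\<^bsub>M\<^esub> x) y \<oplus>\<^bsub>tensor_ll A M N\<^esub> tens_ll A M N x (\<xi> \<odot>\<^bsub>N\<^esub> y))))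
   \<and> (\<forall>M :: ('a diff_op, 'm) module. left_module (diff_ops A) M \<longrightarrow>
        left_module (diff_ops A) (hom_ll A M (base_module A)) \<and>
        (\<forall>f\<in>carrier (hom_ll A M (base_module A)). \<forall>x\<in>carrier M. \<forall>i<nder A.
          (op_d A i \<odot>\<^bsub>hom_ll A M (base_module A)\<^esub> f) x = \<partial>\<^bsub>A\<^esub> i (f x) \<ominus>\<^bsub>A\<^esub> f (op_d A i \<odot>\<^bsub>M\<^esub> x)))
   \<and> \<comment> \<open>(b)\<close>
     (\<forall>(L :: ('a diff_op, 'l) module) (M :: ('a diff_op, 'm) module) (N :: ('a diff_op, 'n) module).
        left_module (diff_ops A) L \<and> left_module (diff_ops A) M \<and> left_module (diff_ops A) N \<longrightarrow>
        (\<lambda>f. \<lambda>m\<in>carrier M. \<lambda>n\<in>carrier N. f (tens_ll A M N m n))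
          \<in> iso (add_monoid (hom_group (diff_ops A) (tensor_ll A M N) L))
                (add_monoid (hom_group (diff_ops A) M (hom_ll A N L))))
   \<and> \<comment> \<open>(c)\<close>
     (\<forall>(M :: ('a diff_op, 'm) rmodule) (N :: ('a diff_op, 'n) rmodule).
        right_module (diff_ops A) M \<and> right_module (diff_ops A) N \<longrightarrow>
        left_module (diff_ops A) (hom_rr A M N) \<and>
        (\<forall>f\<in>carrier (hom_rr A M N). \<forall>x\<in>carrier M.
          (\<forall>a\<in>carrier A.
            (op_const A a \<odot>\<^bsub>hom_rr A M N\<^esub> f) x = f x \<boxdot>\<^bsub>N\<^esub> op_const A a \<and>
            (op_const A a \<odot>\<^bsub>hom_rr A M N\<^esub> f) x = f (x \<boxdot>\<^bsub>M\<^esub> op_const A a)) \<and>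
          (\<forall>\<xi>\<in>op_T A.
            (\<xi> \<odot>\<^bsub>hom_rr A M N\<^esub> f) x = f (x \<boxdot>\<^bsub>M\<^esub> \<xi>) \<ominus>\<^bsub>N\<^esub> f x \<boxdot>\<^bsub>N\<^esub> \<xi>)))
   \<and> (\<forall>(M :: ('a diff_op, 'm) module) (N :: ('a diff_op, 'n) rmodule).
        left_module (diff_ops A) M \<and> right_module (diff_ops A) N \<longrightarrow>
        right_module (diff_ops A) (tensor_lr A M N) \<and>
        (\<forall>x\<in>carrier M. \<forall>y\<in>carrier N.
          (\<forall>a\<in>carrier A.
            tens_lr A M N x y \<boxdot>\<^bsub>tensor_lr A M N\<^esub> op_const A a = tens_lr A M N (op_const A a \<odot>\<^bsub>M\<^esub> x) y \<and>
            tens_lr A M N x y \<boxdot>\<^bsub>tensor_lr A M N\<^esub> op_const A a = tens_lr A M N x (y \<boxdot>\<^bsub>N\<^esub> op_const A a)) \<and>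
          (\<forall>\<xi>\<in>op_T A.
            tens_lr A M N x y \<boxdot>\<^bsub>tensor_lr A M N\<^esub> \<xi> =
              tens_lr A M N x (y \<boxdot>\<^bsub>N\<^esub> \<xi>) \<ominus>\<^bsub>tensor_lr A M N\<^esub> tens_lr A M N (\<xi> \<odot>\<^bsub>M\<^esub> x) y)))
   \<and> \<comment> \<open>(d)\<close>
     (\<forall>M :: ('a diff_op, 'm) module. left_module (diff_ops A) M \<longrightarrow>
        (\<exists>\<phi> \<in> iso (add_monoid (hom_ll A M (base_module A)))
                   (add_monoid (hom_group (diff_ops A) M (dual_ops A))).
          \<forall>f\<in>carrier (hom_ll A M (base_module A)). \<forall>x\<in>carrier M.
            \<phi> f x \<one>\<^bsub>diff_ops A\<^esub> = f x))"
proof -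
  interpret differential_ring A by fact
  show ?thesis
  proof (intro conjI; intro allI impI; (elim conjE)?)
  qed (rule left_pair.left_pair_structures[OF left_pair.intro[OF assms]] spencer_operator
      tensor_hom_adjunction right_pair.right_pair_structures[OF right_pair.intro[OF assms]]
      left_right_pair.left_right_pair_structures[OF left_right_pair.intro[OF assms]]
      hom_dual_iso; assumption)+
qed

end
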